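(* Let $r\ge 1$, let $\mathbf u=(u_1,\dots,u_r)$ and $\mathbf u'=(u_1',\dots,u_r')$ be two independent sets of equivariant parameters, put $t=t_1+t_2$ and $\beta=\sum_{i=1}^r(u_i'-u_i)$. Let $A_m:H_{\mathbf u'}\to H_{\mathbf u}$ be the Ext operator and let $\{B_k,L_k\}_{k\in\mathbb Z}$ be the Heisenberg--Virasoro operators acting on both $H_{\mathbf u}$ and $H_{\mathbf u'}$ (all defined in the context). Then for all $k>0$ and for each choice of sign $\pm$, writing $\varepsilon=\frac{1\pm1}{2}$ and $\bar\varepsilon=\frac{1\mp1}{2}$, one has $$[B_{\pm k},A_m]=\big(\beta-r(m-t\bar\varepsilon)\big)A_m ,$$ $$[L_{\pm k}-L_{\pm(k-1)},A_m]=\Big(\frac{m-t\bar\varepsilon}{t_1t_2}B_{\pm(k-1)}-\frac{m-t\varepsilon}{t_1t_2}B_{\pm k}\mp\frac{r\big(m^2r-(r+1)mt+t^2\bar\varepsilon\pm\delta_k^1(m-t\bar\varepsilon)^2\big)-(2mr-(r+1)t)\beta+\beta^2}{2t_1t_2}\Big)A_m .$$ Here $[X,A_m]$ means $X\circ A_m-A_m\circ X$, with $X$ acting on $H_{\mathbf u}$ in the first term and on $H_{\mathbf u'}$ in the second, and $\delta_k^1$ is the Kronecker delta.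
   Context: **Moduli spaces.** $\mathcal M_{r,d}$ is the moduli space of rank $r$, degree $d$ (i.e. $c_2=d$) torsion-free sheaves $\mathcal F$ on $\mathbb P^2$ with a framing $\mathcal F|_\infty\cong\mathcal O_\infty^{\oplus r}$ on a fixed line $\infty$; it is smooth of dimension $2rd$. The torus $T=\mathbb C^*\times\mathbb C^*\times(\mathbb C^* )^r$ acts (the first two factors scale $\mathbb P^2$ preserving $\infty$, the others act on the framing), with equivariant parameters $t_1,t_2,u_1,\dots,u_r$. $H_{\mathbf u,d}=H_T(\mathcal M_{r,d})$ localized (tensored with $\mathbb Q(t_1,t_2,u_1,\dots,u_r)$), $H_{\mathbf u}=\bigoplus_{d\ge0}H_{\mathbf u,d}$. The tautological bundle $\mathcal V$ has rank $d$ and fibers $H^1(\mathbb P^2,\mathcal F(-\infty))$. In $T$-equivariant $K$-theory, writing $\mathcal V'/\mathcal V$ for $\mathcal V'\otimes\mathcal V^\vee$, $$[T\mathcal M_{r,d}]=\sum_{i=1}^r\Big(\frac{\mathcal V}{e^{u_i}}+\frac{e^{u_i-t}}{\mathcal V}\Big)-(1-e^{-t_1})(1-e^{-t_2})\frac{\mathcal V}{\mathcal V}.$$ **Fixed points.** $T$-fixed points of $\mathcal M_{r,d}$ are indexed by $r$-partitions $\lambda=(\lambda^1,\dots,\lambda^r)$ of total size $d$, each $\lambda^i$ being identified with its Young diagram in the first quadrant. A box of $\lambda^i$ with southwest corner $(x,y)$, $x,y\ge 0$, has weight $\chi_\square=u_i+xt_1+yt_2$, and $\mathcal V|_\lambda=\sum_{\square\in\lambda}e^{\chi_\square}$.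 The classes $|\lambda\rangle=[\lambda]/e(T_\lambda\mathcal M_{r,d})$ form a basis of $H_{\mathbf u,d}$, and $c=\sum_\lambda c|_\lambda\,|\lambda\rangle$ for every class $c$. $\langle\lambda|F|\mu\rangle$ denotes the coefficient of $|\lambda\rangle$ in $F|\mu\rangle$. **Functions.** $\zeta(z)=\frac{(z+t_1)(z+t_2)}{z(z+t)}$, $\tau_{\mathbf u}(z)=\prod_{i=1}^r(z-u_i)$. **Ext operator.** On $\mathcal M_{r,d}\times\mathcal M_{r,d'}$, with independent rank $r$ tori having parameters $\mathbf u$ and $\mathbf u'$ on the two factors, the vector bundle $\mathcal E$ has fibers $\mathcal E|_{\mathcal F,\mathcal F'}=\mathrm{Ext}^1(\mathcal F',\mathcal F(-\infty))$ and equivariant class $$[\mathcal E]=\sum_{i=1}^r\Big(\frac{\mathcal V}{e^{u_i'}}+\frac{e^{u_i-t}}{\mathcal V'}\Big)-(1-e^{-t_1})(1-e^{-t_2})\frac{\mathcal V}{\mathcal V'},$$ where $\mathcal V,\mathcal V'$ are the tautological bundles of the two factors. The Chern polynomial is normalized as $$c(\mathcal E,m)=(-1)^{r\cdot\mathrm{rk}\,\mathcal V'}\sum_{i=0}^{\mathrm{rk}\,\mathcal E}c_i(\mathcal E)\,m^{\mathrm{rk}\,\mathcal E-i},$$ with $m$ a formal parameter; equivalently, if $x$ runs over the Chern roots of $\mathcal V$ and $x'$ over those of $\mathcal V'$, $$c(\mathcal E,m)=\prod_{x,x'}\zeta(x'-x-m)\prod_x\tau_{\mathbf u'}(x+m)\prod_{x'}\tau_{\mathbf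 u}(x'-m+t).$$ Let $p^1,p^2$ be the projections to $\mathcal M_{r,d}$ and $\mathcal M_{r,d'}$. Then $A_m|_d^{d'}:H_{\mathbf u',d'}\to H_{\mathbf u,d}$ is $\alpha\mapsto p^1_*(c(\mathcal E,m)\,p^{2*}\alpha)$ (push-forward defined by localization), and $A_m=\sum_{d,d'\ge0}A_m|_d^{d'}$, whose values lie in the completion $\prod_dH_{\mathbf u,d}$. **Heisenberg--Virasoro operators.** For $r$-partitions $\mu\subset\lambda$ with $|\lambda|-|\mu|=k$, a standard Young tableau (SYT) of shape $\lambda\backslash\mu$ is a labeling of its boxes by $1,\dots,k$ such that labels decrease as one goes up and to the right in each constituent partition; $\chi_i$ denotes the weight of the box labeled $i$. For a polynomial $p(z_1,\dots,z_k)$, define operators $C_p^{\pm}$ on $H_{\mathbf u}$ by $$\langle\lambda|C_p^+|\mu\rangle=\sum_{\text{SYT of shape }\lambda\backslash\mu}\frac{p(\chi_1,\dots,\chi_k)\prod_{i<j}\zeta(\chi_i-\chi_j)}{\prod_{i=1}^{k-1}(\chi_{i+1}-\chi_i+t)}\prod_{i=1}^k\Big[\frac{t_1t_2}{t}\prod_{\square\in\mu}\zeta(\chi_i-\chi_\square)\,\tau_{\mathbf u}(\chi_i+t)\Big],$$ $$\langle\mu|C_p^-|\lambda\rangle=\sum_{\text{SYT of shape }\lambda\backslash\mu}\frac{p(\chi_1,\dots,\chi_k)\prod_{i<j}\zeta(\chi_i-\chi_j)}{\prod_{i=1}^{k-1}(\chi_{i+1}-\chi_i+t)}\prod_{i=1}^k\Big[\frac{t_1t_2}{t}\prod_{\square\in\lambda}\zeta(\chi_\square-\chi_i)^{-1}\frac1{\tau_{\mathbf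 u}(\chi_i)}\Big],$$ all other matrix coefficients being $0$. (The expressions $\prod_{\square\in\mu}\zeta(z-\chi_\square)\tau_{\mathbf u}(z+t)$ and $\prod_{\square\in\lambda}\zeta(\chi_\square-z)^{-1}\tau_{\mathbf u}(z)^{-1}$ are regarded as rational functions of $z$ and evaluated at $z=\chi_i$ after cancellation.) For $k>0$ set $$B_{-k}=C_1^+,\quad B_k=C_1^-\quad(k\text{ variables}),\qquad L_{\mp k}=C^{\pm}_{p},\quad p=\frac{z_1+z_k-(k-1)rt}{2t_1t_2}.$$ Finally, with $\bar u_i=u_i+\frac{(r-1)t}{2}$, $B_0$ acts on $H_{\mathbf u}$ as the scalar $-\sum_i\bar u_i$ and $L_0$ acts on $H_{\mathbf u,d}$ as the scalar $d+\frac{r(r^2-1)t^2}{24t_1t_2}-\frac1{2t_1t_2}\sum_i\bar u_i^2$. On $H_{\mathbf u'}$ one uses $\mathbf u'$ in place of $\mathbf u$ throughout.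
   Formalization: For odd r the relations fail with plain Euler classes (r=k=1, lower sign, vacuum entry gives −(β−(m−t))); the push-forward from M_{r,d'} is therefore taken with an extra sign (−1)^{rd'}, which cancels the sign in c(E,m). Nothing changes for even r. *)

theory Defs
  imports
    "HOL-Library.FuncSet"
    "HOL-Library.Groups_Big_Fun"
    "HOL-Library.Poly_Mapping"
    "HOL-Computational_Algebra.Computational_Algebra"
begin

section \<open>Ground field\<close>

text \<open>
  The field of rational functions over the rationals in countably many indeterminates.
  The equivariant parameters and the formal parameter \<open>m\<close> are distinct indeterminates of it, and
  all localized equivariant cohomology groups are taken with coefficients extended to it.
  Indeterminates beyond the finitely many in use play no role.
\<close>

type_synonym ratfun = "((nat \<Rightarrow>\<^sub>0 nat) \<Rightarrow>\<^sub>0 rat) fract"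

definition indet :: "nat \<Rightarrow> ratfun" where
  "indet n = to_fract (Poly_Mapping.single (Poly_Mapping.single n 1) 1)"


section \<open>Fixed points\<close>

text \<open>
  The box \<open>(i, x, y)\<close> lies in the \<open>i\<close>-th constituent (\<open>i\<close> counted from 0) and has southwest
  corner \<open>(x, y)\<close>. An \<open>r\<close>-partition is the set of its boxes, so that \<open>\<nu> `` {i}\<close> is the Young
  diagram of the \<open>i\<close>-th constituent and \<open>card \<nu>\<close> is the total size.
\<close>

type_synonym box = "nat \<times> nat \<times> nat"

definition young_diagram :: "(nat \<times> nat) set \<Rightarrow> bool" where
  "young_diagram Y \<longleftrightarrow> finite Y \<and> (\<forall>(x, y)\<in>Y. \<forall>x'\<le>x. \<forall>y'\<le>y. (x', y') \<in> Y)"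

definition rpartitions :: "nat \<Rightarrow> box set set" where
  "rpartitions r = {\<nu>. (\<forall>i<r. young_diagram (\<nu> `` {i})) \<and> (\<forall>i\<ge>r. \<nu> `` {i} = {})}"

definition weight :: "'a::field \<Rightarrow> 'a \<Rightarrow> (nat \<Rightarrow> 'a) \<Rightarrow> box \<Rightarrow> 'a" where
  "weight t1 t2 u = (\<lambda>(i, x, y). u i + of_nat x * t1 + of_nat y * t2)"


section \<open>Equivariant K-theory classes at fixed points\<close>

text \<open>
  A class restricted to a fixed point is a virtual character, that is, an element of the group
  ring of the weights: \<open>'a \<Rightarrow>\<^sub>0 int\<close> with its convolution product, where \<open>character w\<close> is the
  exponential of the weight \<open>w\<close>.
\<close>

definition character :: "'a \<Rightarrow> ('a \<Rightarrow>\<^sub>0 int)" where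
  "character w = Poly_Mapping.single w 1"

definition dual :: "('a::ab_group_add \<Rightarrow>\<^sub>0 int) \<Rightarrow> ('a \<Rightarrow>\<^sub>0 int)" where
  "dual W = Poly_Mapping.map_key uminus W"

definition rank :: "('a \<Rightarrow>\<^sub>0 int) \<Rightarrow> int" where
  "rank W = (\<Sum>w\<in>Poly_Mapping.keys W. Poly_Mapping.lookup W w)"

definition chern_class :: "('a::field \<Rightarrow>\<^sub>0 int) \<Rightarrow> nat \<Rightarrow> 'a" where
  "chern_class W i =
     fps_nth (\<Prod>w\<in>Poly_Mapping.keys W.
       (1 + fps_const w * fps_X) powi Poly_Mapping.lookup W w) i"

definition euler_class :: "('a::field \<Rightarrow>\<^sub>0 int) \<Rightarrow> 'a" where
  "euler_class W = (\<Prod>w\<in>Poly_Mapping.keys W. w powi Poly_Mapping.lookup W w)"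

definition taut_class :: "'a::field \<Rightarrow> 'a \<Rightarrow> (nat \<Rightarrow> 'a) \<Rightarrow> box set \<Rightarrow> ('a \<Rightarrow>\<^sub>0 int)" where
  "taut_class t1 t2 u \<nu> = (\<Sum>b\<in>\<nu>. character (weight t1 t2 u b))"

definition tangent_class ::
    "nat \<Rightarrow> 'a::field \<Rightarrow> 'a \<Rightarrow> (nat \<Rightarrow> 'a) \<Rightarrow> box set \<Rightarrow> ('a \<Rightarrow>\<^sub>0 int)" where
  "tangent_class r t1 t2 u \<nu> =
     (let V = taut_class t1 t2 u \<nu> in
       (\<Sum>i<r. V * character (- u i) + character (u i - (t1 + t2)) * dual V)
       - (1 - character (- t1)) * (1 - character (- t2)) * (V * dual V))"

definition ext_class ::
    "nat \<Rightarrow> 'a::field \<Rightarrow> 'a \<Rightarrow> (nat \<Rightarrow> 'a) \<Rightarrow> (nat \<Rightarrow> 'a) \<Rightarrow> box set \<Rightarrow> box set \<Rightarrow> ('a \<Rightarrow>\<^sub>0 int)" where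
  "ext_class r t1 t2 u u' \<nu> \<nu>' =
     (let V = taut_class t1 t2 u \<nu>; V' = taut_class t1 t2 u' \<nu>' in
       (\<Sum>i<r. V * character (- u' i) + character (u i - (t1 + t2)) * dual V')
       - (1 - character (- t1)) * (1 - character (- t2)) * (V * dual V'))"

text \<open>The Chern polynomial of the Ext bundle, including the sign normalization.\<close>

definition ext_chern_poly ::
    "nat \<Rightarrow> 'a::field \<Rightarrow> 'a \<Rightarrow> 'a \<Rightarrow> (nat \<Rightarrow> 'a) \<Rightarrow> (nat \<Rightarrow> 'a) \<Rightarrow> box set \<Rightarrow> box set \<Rightarrow> 'a" where
  "ext_chern_poly r t1 t2 m u u' \<nu> \<nu>' =
     (let E = ext_class r t1 t2 u u' \<nu> \<nu>'; n = nat (rank E) in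
       (- 1) ^ (r * nat (rank (taut_class t1 t2 u' \<nu>')))
         * (\<Sum>i=0..n. chern_class E i * m ^ (n - i)))"


section \<open>Localized cohomology and the Ext operator\<close>

text \<open>
  A class is represented by its restrictions to the fixed points, which are also its coefficients
  in the basis \<open>|\<nu>\<rangle>\<close>, so that the direct sum over all degrees consists of the finitely supported
  functions on \<open>r\<close>-partitions and its completion of all functions on \<open>r\<close>-partitions (extended
  by 0 to the other sets of boxes).
\<close>

type_synonym 'a fockvec = "box set \<Rightarrow> 'a"

definition fock :: "nat \<Rightarrow> 'a::field fockvec set" where
  "fock r = {\<alpha>. finite {\<nu>. \<alpha> \<nu> \<noteq> 0} \<and> {\<nu>. \<alpha> \<nu> \<noteq> 0} \<subseteq> rpartitions r}"

text \<open>
  Push-forward along the first projection of a class on the product of the moduli spaces of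
  degrees \<open>d\<close> and \<open>d'\<close>, by localization. The integral over the second factor, of dimension
  \<open>2 * r * d'\<close>, is oriented by the sign \<open>(-1) ^ (r * d')\<close>. Equivalently, the Euler class of the
  tangent bundle in the localization formula carries the same normalizing sign as
  \<open>ext_chern_poly\<close>, whose value on the diagonal at \<open>m = 0\<close> it then is. With unsigned Euler classes
  in the push-forward, the commutation relations fail for odd \<open>r\<close>: for \<open>r = 1\<close>, the vacuum
  coefficient of the commutator with \<open>B\<^sub>-\<^sub>1\<close> would be \<open>- (\<beta> - (m - t))\<close> instead of \<open>\<beta> - (m - t)\<close>.
\<close>

definition pushforward ::
    "nat \<Rightarrow> 'a::field \<Rightarrow> 'a \<Rightarrow> (nat \<Rightarrow> 'a) \<Rightarrow> nat \<Rightarrow> nat \<Rightarrow> (box set \<Rightarrow> box set \<Rightarrow> 'a) \<Rightarrow> 'a fockvec" where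
  "pushforward r t1 t2 u' d d' \<gamma> = (\<lambda>\<nu>.
     if \<nu> \<in> rpartitions r \<and> card \<nu> = d
     then (- 1) ^ (r * d') * (\<Sum>\<mu> | \<mu> \<in> rpartitions r \<and> card \<mu> = d'.
            \<gamma> \<nu> \<mu> / euler_class (tangent_class r t1 t2 u' \<mu>))
     else 0)"

definition ext_block ::
    "nat \<Rightarrow> 'a::field \<Rightarrow> 'a \<Rightarrow> 'a \<Rightarrow> (nat \<Rightarrow> 'a) \<Rightarrow> (nat \<Rightarrow> 'a) \<Rightarrow> nat \<Rightarrow> nat \<Rightarrow> 'a fockvec \<Rightarrow> 'a fockvec" where
  "ext_block r t1 t2 m u u' d d' \<alpha> =
     pushforward r t1 t2 u' d d' (\<lambda>\<nu> \<mu>. ext_chern_poly r t1 t2 m u u' \<nu> \<mu> * \<alpha> \<mu>)"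

definition ext_op ::
    "nat \<Rightarrow> 'a::field \<Rightarrow> 'a \<Rightarrow> 'a \<Rightarrow> (nat \<Rightarrow> 'a) \<Rightarrow> (nat \<Rightarrow> 'a) \<Rightarrow> 'a fockvec \<Rightarrow> 'a fockvec" where
  "ext_op r t1 t2 m u u' \<alpha> =
     (\<lambda>\<nu>. Sum_any (\<lambda>(d, d'). ext_block r t1 t2 m u u' d d' \<alpha> \<nu>))"


section \<open>Heisenberg--Virasoro operators\<close>

definition zeta :: "'a::field \<Rightarrow> 'a \<Rightarrow> 'a \<Rightarrow> 'a" where
  "zeta t1 t2 z = (z + t1) * (z + t2) / (z * (z + (t1 + t2)))"

definition tau :: "nat \<Rightarrow> (nat \<Rightarrow> 'a::field) \<Rightarrow> 'a \<Rightarrow> 'a" where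
  "tau r u z = (\<Prod>i<r. z - u i)"

text \<open>Rational functions in one variable \<open>z\<close>, and their evaluation after cancellation.\<close>

definition ratconst :: "'a::field \<Rightarrow> 'a poly fract" where
  "ratconst c = to_fract [:c:]"

definition ratvar :: "'a::field poly fract" where
  "ratvar = to_fract [:0, 1:]"

definition rateval :: "'a::field poly fract \<Rightarrow> 'a \<Rightarrow> 'a" where
  "rateval R c = (THE v. \<exists>p q. poly q c \<noteq> 0 \<and> R = Fract p q \<and> v = poly p c / poly q c)"

definition plus_factor ::
    "nat \<Rightarrow> 'a::field \<Rightarrow> 'a \<Rightarrow> (nat \<Rightarrow> 'a) \<Rightarrow> box set \<Rightarrow> 'a poly fract" where
  "plus_factor r t1 t2 u \<mu> =
     (\<Prod>b\<in>\<mu>. zeta (ratconst t1) (ratconst t2) (ratvar - ratconst (weight t1 t2 u b)))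
     * tau r (\<lambda>i. ratconst (u i)) (ratvar + ratconst (t1 + t2))"

definition minus_factor ::
    "nat \<Rightarrow> 'a::field \<Rightarrow> 'a \<Rightarrow> (nat \<Rightarrow> 'a) \<Rightarrow> box set \<Rightarrow> 'a poly fract" where
  "minus_factor r t1 t2 u \<nu> =
     (\<Prod>b\<in>\<nu>. inverse (zeta (ratconst t1) (ratconst t2) (ratconst (weight t1 t2 u b) - ratvar)))
     * (1 / tau r (\<lambda>i. ratconst (u i)) ratvar)"

text \<open>Labelings are extensional, so that each tableau is counted once.\<close>

definition SYT :: "box set \<Rightarrow> (box \<Rightarrow> nat) set" where
  "SYT S = {f \<in> extensional S. bij_betw f S {1..card S} \<and>
     (\<forall>i x y x' y'. (i, x, y) \<in> S \<and> (i, x', y') \<in> S \<and> x \<le> x' \<and> y \<le> y' \<and> (x, y) \<noteq> (x', y')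
        \<longrightarrow> f (i, x', y') < f (i, x, y))}"

text \<open>The sequence \<open>\<chi>\<^sub>1, \<dots>, \<chi>\<^sub>k\<close> of weights of a tableau \<open>f\<close> of shape \<open>S\<close>.\<close>

definition syt_weight ::
    "'a::field \<Rightarrow> 'a \<Rightarrow> (nat \<Rightarrow> 'a) \<Rightarrow> box set \<Rightarrow> (box \<Rightarrow> nat) \<Rightarrow> nat \<Rightarrow> 'a" where
  "syt_weight t1 t2 u S f i = weight t1 t2 u (the_inv_into S f i)"

text \<open>
  A polynomial \<open>p(z\<^sub>1, \<dots>, z\<^sub>k)\<close> enters through its evaluation map on sequences \<open>z\<close>.
\<close>

definition syt_factor ::
    "'a::field \<Rightarrow> 'a \<Rightarrow> nat \<Rightarrow> ((nat \<Rightarrow> 'a) \<Rightarrow> 'a) \<Rightarrow> (nat \<Rightarrow> 'a) \<Rightarrow> 'a" where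
  "syt_factor t1 t2 k p \<chi> =
     p \<chi> * (\<Prod>(i, j) \<in> {(i, j). 1 \<le> i \<and> i < j \<and> j \<le> k}. zeta t1 t2 (\<chi> i - \<chi> j))
     / (\<Prod>i=1..<k. \<chi> (i + 1) - \<chi> i + (t1 + t2))"

definition skew_shape :: "nat \<Rightarrow> nat \<Rightarrow> box set \<Rightarrow> box set \<Rightarrow> bool" where
  "skew_shape r k \<nu> \<mu> \<longleftrightarrow>
     \<nu> \<in> rpartitions r \<and> \<mu> \<in> rpartitions r \<and> \<mu> \<subseteq> \<nu> \<and> card \<nu> = card \<mu> + k"

text \<open>Below, \<open>M \<nu> \<mu>\<close> is the matrix coefficient \<open>\<langle>\<nu>|M|\<mu>\<rangle>\<close>.\<close>

definition C_plus ::
    "nat \<Rightarrow> 'a::field \<Rightarrow> 'a \<Rightarrow> (nat \<Rightarrow> 'a) \<Rightarrow> nat \<Rightarrow> ((nat \<Rightarrow> 'a) \<Rightarrow> 'a) \<Rightarrow> box set \<Rightarrow> box set \<Rightarrow> 'a" where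
  "C_plus r t1 t2 u k p \<nu> \<mu> =
     (if skew_shape r k \<nu> \<mu> then
        (\<Sum>f\<in>SYT (\<nu> - \<mu>).
           let \<chi> = syt_weight t1 t2 u (\<nu> - \<mu>) f in
             syt_factor t1 t2 k p \<chi>
             * (\<Prod>i=1..k. t1 * t2 / (t1 + t2) * rateval (plus_factor r t1 t2 u \<mu>) (\<chi> i)))
      else 0)"

definition C_minus ::
    "nat \<Rightarrow> 'a::field \<Rightarrow> 'a \<Rightarrow> (nat \<Rightarrow> 'a) \<Rightarrow> nat \<Rightarrow> ((nat \<Rightarrow> 'a) \<Rightarrow> 'a) \<Rightarrow> box set \<Rightarrow> box set \<Rightarrow> 'a" where
  "C_minus r t1 t2 u k p \<mu> \<nu> =
     (if skew_shape r k \<nu> \<mu> then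
        (\<Sum>f\<in>SYT (\<nu> - \<mu>).
           let \<chi> = syt_weight t1 t2 u (\<nu> - \<mu>) f in
             syt_factor t1 t2 k p \<chi>
             * (\<Prod>i=1..k. t1 * t2 / (t1 + t2) * rateval (minus_factor r t1 t2 u \<nu>) (\<chi> i)))
      else 0)"

text \<open>
  All matrices used here have finitely many nonzero entries in each row, so they act on the
  completion.
\<close>

definition op_of_matrix :: "(box set \<Rightarrow> box set \<Rightarrow> 'a::field) \<Rightarrow> 'a fockvec \<Rightarrow> 'a fockvec" where
  "op_of_matrix M \<alpha> = (\<lambda>\<nu>. Sum_any (\<lambda>\<mu>. M \<nu> \<mu> * \<alpha> \<mu>))"

definition ubar :: "nat \<Rightarrow> 'a::field \<Rightarrow> 'a \<Rightarrow> (nat \<Rightarrow> 'a) \<Rightarrow> nat \<Rightarrow> 'a" where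
  "ubar r t1 t2 u i = u i + (of_nat r - 1) * (t1 + t2) / 2"

definition L_poly :: "nat \<Rightarrow> 'a::field \<Rightarrow> 'a \<Rightarrow> nat \<Rightarrow> (nat \<Rightarrow> 'a) \<Rightarrow> 'a" where
  "L_poly r t1 t2 k z = (z 1 + z k - (of_nat k - 1) * of_nat r * (t1 + t2)) / (2 * t1 * t2)"

definition B_op ::
    "nat \<Rightarrow> 'a::field \<Rightarrow> 'a \<Rightarrow> (nat \<Rightarrow> 'a) \<Rightarrow> int \<Rightarrow> 'a fockvec \<Rightarrow> 'a fockvec" where
  "B_op r t1 t2 u n =
     (if n < 0 then op_of_matrix (C_plus r t1 t2 u (nat (- n)) (\<lambda>_. 1))
      else if n > 0 then op_of_matrix (C_minus r t1 t2 u (nat n) (\<lambda>_. 1))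
      else (\<lambda>\<alpha> \<nu>. - (\<Sum>i<r. ubar r t1 t2 u i) * \<alpha> \<nu>))"

definition L_op ::
    "nat \<Rightarrow> 'a::field \<Rightarrow> 'a \<Rightarrow> (nat \<Rightarrow> 'a) \<Rightarrow> int \<Rightarrow> 'a fockvec \<Rightarrow> 'a fockvec" where
  "L_op r t1 t2 u n =
     (if n < 0 then op_of_matrix (C_plus r t1 t2 u (nat (- n)) (L_poly r t1 t2 (nat (- n))))
      else if n > 0 then op_of_matrix (C_minus r t1 t2 u (nat n) (L_poly r t1 t2 (nat n)))
      else (\<lambda>\<alpha> \<nu>. (of_nat (card \<nu>)
              + of_nat r * ((of_nat r)\<^sup>2 - 1) * (t1 + t2)\<^sup>2 / (24 * t1 * t2)
              - 1 / (2 * t1 * t2) * (\<Sum>i<r. (ubar r t1 t2 u i)\<^sup>2)) * \<alpha> \<nu>))"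

text \<open>
  The commutator with an operator \<open>A\<close> between two different spaces: \<open>X\<close> acts on the target of \<open>A\<close>
  and \<open>X'\<close> on its source.
\<close>

definition commutator ::
    "('a::field fockvec \<Rightarrow> 'a fockvec) \<Rightarrow> ('a fockvec \<Rightarrow> 'a fockvec) \<Rightarrow>
     ('a fockvec \<Rightarrow> 'a fockvec) \<Rightarrow> 'a fockvec \<Rightarrow> 'a fockvec" where
  "commutator X X' A \<alpha> = (\<lambda>\<nu>. X (A \<alpha>) \<nu> - A (X' \<alpha>) \<nu>)"

definition op_diff ::
    "('a::field fockvec \<Rightarrow> 'a fockvec) \<Rightarrow> ('a fockvec \<Rightarrow> 'a fockvec) \<Rightarrow> 'a fockvec \<Rightarrow> 'a fockvec" where
  "op_diff X Y \<alpha> = (\<lambda>\<nu>. X \<alpha> \<nu> - Y \<alpha> \<nu>)"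

end

theory Submission
  imports Defs
begin

text \<open>
  Let \<open>N\<^sub>\<nu>(z) = \<Prod>\<^sub>\<box> \<zeta>(z - \<chi>\<^sub>\<box>) \<tau>(z + t)\<close>, the product being over the boxes of \<open>\<nu>\<close>. All factors cancel
  except those of the corners: \<open>N\<^sub>\<nu>\<close> has simple poles at the removable boxes of \<open>\<nu>\<close> and
  zeros at the addable boxes shifted by \<open>- t\<close>. Multiplying a matrix coefficient
  \<open>\<langle>\<nu>|A|\<mu>\<rangle>\<close> by a step of \<open>C\<^sup>+\<close> that removes a box of \<open>\<nu>\<close>, or adds one to \<open>\<mu>\<close>, amounts up to sign to
  taking a residue of \<open>\<Phi>(z) = N\<^sub>\<nu>(z) / N\<^sub>\<mu>(z + m - t)\<close>, and a tableau is a chain of \<open>k\<close> such steps. Hence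
  \<open>C\<^sup>+ A\<close> and \<open>A C\<^sup>+\<close> are the extreme terms of a family of iterated residues in which the first \<open>j\<close>
  variables are at poles coming from \<open>\<nu>\<close> and the last \<open>k - j\<close> ones at poles coming from \<open>\<mu>\<close>. Two
  consecutive terms differ by the sum of all residues in one variable, thus by the residue at infinity.
  The factor \<open>1 / (\<chi>\<^sub>i\<^sub>+\<^sub>1 - \<chi>\<^sub>i + t)\<close> creates no pole, since it is cancelled by a zero of \<open>\<Phi>\<close>, but it makes the
  integrand decay. So the residue at infinity vanishes unless the variable is the first or the last
  one, and in these two cases it is a sum over chains with \<open>k - 1\<close> steps: this is where the
  differences \<open>L\<^sub>k - L\<^sub>k\<^sub>-\<^sub>1\<close> come from. The operators \<open>C\<^sup>-\<close> reduce to the same computation with the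
  roles of \<open>(\<nu>, u)\<close> and \<open>(\<mu>, u')\<close> exchanged and \<open>m\<close> replaced by \<open>t - m\<close>.
\<close>

section \<open>A residue theorem\<close>

text \<open>Why a zero of \<Phi> meets every gap: a box just removed from \<nu> becomes addable, so
  \<Phi> vanishes at its weight minus t; a box just added to \<mu> becomes removable, so \<Phi>
  vanishes at its shifted weight plus t. \<Phi> has as many zeros as poles, and each gap uses up one
  zero. With numerator 1 the residues sum to \<open>\<phi> r\<close> without a gap, to 1 up to sign
  with one gap, and to 0 with two. The numerator \<open>z_1 + z_k\<close> of the L operators raises
  the degree by one at the ends; power sums of the corner weights then enter, and these depend only
  on the parameters and on the number of boxes, which for k = 1 is what L_0 accounts for.

  The obstacle lies in A itself. Its coefficients are Chern polynomials cut off at the rank, and the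
  cut-off polynomial is a product of shifted weights only for an honest character, whereas the Ext
  class is given as a difference. So effectivity is proved at every pair of fixed points. Afterwards
  only the ratio of coefficients at pairs differing by one box matters; the locale
  \<open>kernel\<close> keeps nothing else, and both signs become instances of it.\<close>

definition res_sum :: "('a \<Rightarrow> 'f::field) \<Rightarrow> 'a set \<Rightarrow> ('b \<Rightarrow> 'f) \<Rightarrow> 'b set \<Rightarrow> 'f" where
  "res_sum w J v I = (\<Sum>x\<in>I. (\<Prod>n\<in>J. v x - w n) / (\<Prod>y\<in>I - {x}. v x - v y))"

text \<open>Each summand is a residue at the simple pole \<open>v x\<close>. A numerator vanishing
  at \<open>v p\<close> removes the pole \<open>p\<close> and cancels the factor
  \<open>v x - v p\<close> in the other denominators.\<close>

lemma sum_mult_linear_over_nodes: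
  fixes v :: "'b \<Rightarrow> 'f::field"
  assumes "finite I" "inj_on v I" "p \<in> I"
  shows "(\<Sum>x\<in>I. (v x - v p) * F x / (\<Prod>y\<in>I - {x}. v x - v y))
    = (\<Sum>x\<in>I - {p}. F x / (\<Prod>y\<in>I - {p} - {x}. v x - v y))"
proof -
  have "(v x - v p) * F x / (\<Prod>y\<in>I - {x}. v x - v y)
      = F x / (\<Prod>y\<in>I - {p} - {x}. v x - v y)" if x: "x \<in> I - {p}" for x
  proof -
    have "(\<Prod>y\<in>I - {x}. v x - v y) = (v x - v p) * (\<Prod>y\<in>I - {x} - {p}. v x - v y)"
      using assms x by (intro prod.remove) auto
    moreover have "I - {x} - {p} = I - {p} - {x}" by auto
    moreover have "v x - v p \<noteq> 0" using assms x by (auto dest: inj_onD)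
    ultimately show ?thesis by (metis mult_divide_mult_cancel_left)
  qed
  then have "(\<Sum>x\<in>I - {p}. (v x - v p) * F x / (\<Prod>y\<in>I - {x}. v x - v y))
      = (\<Sum>x\<in>I - {p}. F x / (\<Prod>y\<in>I - {p} - {x}. v x - v y))"
    by (rule sum.cong[OF refl])
  then show ?thesis
    by (simp only: sum.remove[OF assms(1,3)] diff_self mult_zero_left div_0 add_0_left)
qed

text \<open>For every \<open>x\<close> the constant \<open>v p - v q\<close> is the difference of
  \<open>v x - v q\<close> and \<open>v x - v p\<close>, so multiplying by it leaves the difference
  of two sums with one node fewer. These vanish by induction, or are both 1 if there were two
  nodes.\<close>

lemma res_sum_empty_zeros:
  fixes v :: "'b \<Rightarrow> 'f::field"
  assumes "finite I" "inj_on v I" "card I \<ge> 2"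
  shows "res_sum w {} v I = 0"
  using assms
proof (induction "card I" arbitrary: I rule: less_induct)
  case less
  obtain p I' where p: "I = insert p I'" "p \<notin> I'" "card I' \<ge> 1"
    using less.prems by (metis card_le_Suc_iff numeral_2_eq_2 plus_1_eq_Suc One_nat_def)
  then obtain q where q: "q \<in> I'" by fastforce
  have pq: "p \<in> I" "q \<in> I" "p \<noteq> q" using p q by auto
  have inj: "inj_on v (I - {x})" for x using less.prems(2) by (rule inj_on_diff)
  have drop: "(\<Sum>x\<in>I. (v x - v z) * 1 / (\<Prod>y\<in>I - {x}. v x - v y)) = res_sum w {} v (I - {z})"
    if "z \<in> I" for z
    unfolding res_sum_def
    by (subst sum_mult_linear_over_nodes[OF less.prems(1,2) that]) simp
  have "(v p - v q) * res_sum w {} v I = (\<Sum>x\<in>I. (v x - v q) * 1 / (\<Prod>y\<in>I - {x}. v x - v y))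
      - (\<Sum>x\<in>I. (v x - v p) * 1 / (\<Prod>y\<in>I - {x}. v x - v y))"
    unfolding res_sum_def sum_distrib_left sum_subtractf[symmetric]
    by (intro sum.cong refl) (simp add: diff_divide_distrib[symmetric])
  also have "\<dots> = res_sum w {} v (I - {q}) - res_sum w {} v (I - {p})"
    using drop pq by simp
  also have "\<dots> = 0"
  proof (cases "card I = 2")
    case True
    then have "card (I - {p}) = 1" "card (I - {q}) = 1"
      using less.prems(1) pq by auto
    then obtain a b where "I - {p} = {a}" "I - {q} = {b}"
      by (auto simp: card_1_singleton_iff)
    then show ?thesis by (simp add: res_sum_def)
  next
    case False
    then have "card (I - {p}) \<ge> 2" "card (I - {q}) \<ge> 2"
      using less.prems(1,3) pq by auto
    moreover have "card (I - {p}) < card I" "card (I - {q}) < card I"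
      using less.prems(1) pq by (blast intro: card_Diff1_less)+
    ultimately show ?thesis
      using less.hyps less.prems inj by simp
  qed
  finally show ?case
    using less.prems(2) pq by (auto dest: inj_onD)
qed

text \<open>The new factor is \<open>(v x - v p) + (v p - w n)\<close>. The first part trades the
  new zero for the pole \<open>p\<close>, which keeps the excess of zeros over poles; the second is
  constant and leaves an excess lower by one.\<close>

lemma res_sum_insert:
  fixes v :: "'b \<Rightarrow> 'f::field"
  assumes "finite I" "inj_on v I" "p \<in> I" "finite J" "n \<notin> J"
  shows "res_sum w (insert n J) v I
    = res_sum w J v (I - {p}) + (v p - w n) * res_sum w J v I"
proof -
  have "res_sum w (insert n J) v I
      = (\<Sum>x\<in>I. (v x - v p) * (\<Prod>n\<in>J. v x - w n) / (\<Prod>y\<in>I - {x}. v x - v y))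
      + (v p - w n) * res_sum w J v I"
    unfolding res_sum_def sum_distrib_left sum.distrib[symmetric]
    using assms(4,5)
    by (intro sum.cong refl) (simp add: add_divide_distrib[symmetric] algebra_simps)
  also have "(\<Sum>x\<in>I. (v x - v p) * (\<Prod>n\<in>J. v x - w n) / (\<Prod>y\<in>I - {x}. v x - v y))
      = res_sum w J v (I - {p})"
    unfolding res_sum_def by (rule sum_mult_linear_over_nodes[OF assms(1-3)])
  finally show ?thesis .
qed

text \<open>The right-hand sides are the coefficients of \<open>1/z\<close> at infinity of
  \<open>\<Prod>n. (z - w n) / \<Prod>x. (z - v x)\<close>.\<close>

lemma res_sum_eq:
  fixes v :: "'b \<Rightarrow> 'f::field" and w :: "'a \<Rightarrow> 'f"
  assumes "finite I" "inj_on v I" "finite J" and two: "(2 :: 'f) \<noteq> 0"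
  shows "card J + 2 \<le> card I \<Longrightarrow> res_sum w J v I = 0"
    and "card J + 1 = card I \<Longrightarrow> res_sum w J v I = 1"
    and "card J = card I \<Longrightarrow> res_sum w J v I = sum v I - sum w J"
    and "card J = card I + 1 \<Longrightarrow> res_sum w J v I
      = ((sum v I - sum w J)\<^sup>2 + (\<Sum>x\<in>I. (v x)\<^sup>2) - (\<Sum>n\<in>J. (w n)\<^sup>2)) / 2"
proof -
  have "(card J + 2 \<le> card I \<longrightarrow> res_sum w J v I = 0) \<and>
    (card J + 1 = card I \<longrightarrow> res_sum w J v I = 1) \<and>
    (card J = card I \<longrightarrow> res_sum w J v I = sum v I - sum w J) \<and>
    (card J = card I + 1 \<longrightarrow> res_sum w J v I
      = ((sum v I - sum w J)\<^sup>2 + (\<Sum>x\<in>I. (v x)\<^sup>2) - (\<Sum>n\<in>J. (w n)\<^sup>2)) / 2)"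
    using assms(3,1,2)
  proof (induction J arbitrary: I rule: finite_induct)
    case empty
    show ?case
    proof (intro conjI impI)
      assume "card {} + 2 \<le> card I" then show "res_sum w {} v I = 0"
        using empty res_sum_empty_zeros[of I v w] by auto
    next
      assume "card {} + 1 = card I"
      then obtain a where "I = {a}"
        by (metis One_nat_def add_cancel_right_left card.empty card_1_singletonE)
      then show "res_sum w {} v I = 1" by (simp add: res_sum_def)
    qed (use empty in \<open>auto simp: res_sum_def\<close>)
  next
    case (insert n J)
    show ?case
    proof (cases "I = {}")
      case True
      show ?thesis using insert.hyps by (auto simp: True res_sum_def)
    next
      case False
      then obtain p where p: "p \<in> I" by auto
      let ?I = "I - {p}"
      have fin: "finite ?I" "inj_on v ?I" "card I = Suc (card ?I)"
        using insert.prems card.remove[OF insert.prems(1) p] by (auto intro: inj_on_diff)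
      have sums: "sum g I = g p + sum g ?I" for g :: "'b \<Rightarrow> 'f"
        using insert.prems p by (intro sum.remove) auto
      note rec = res_sum_insert[OF insert.prems p insert.hyps(1,2), of w]
      note IH1 = insert.IH[OF fin(1,2)] and IH2 = insert.IH[OF insert.prems]
      have cJ: "card (insert n J) = Suc (card J)" using insert.hyps by simp
      show ?thesis
      proof (intro conjI impI)
        assume "card (insert n J) + 2 \<le> card I"
        then show "res_sum w (insert n J) v I = 0"
          using IH1 IH2 rec cJ fin(3) by auto
      next
        assume "card (insert n J) + 1 = card I"
        then show "res_sum w (insert n J) v I = 1"
          using IH1 IH2 rec cJ fin(3) by auto
      next
        assume c: "card (insert n J) = card I"
        have 1: "res_sum w J v ?I = sum v ?I - sum w J" "res_sum w J v I = 1"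
          using IH1 IH2 c cJ fin(3) by auto
        show "res_sum w (insert n J) v I = sum v I - sum w (insert n J)"
          unfolding rec 1 using insert.hyps by (simp add: sums)
      next
        assume c: "card (insert n J) = card I + 1"
        \<comment> \<open>The second-order coefficient at infinity is
          \<open>(p_1^2 + p_2) / 2\<close>, where \<open>p_i\<close> is the sum of the i-th powers
          of the poles minus that of the zeros; this is where 2 has to be invertible.\<close>
        have 1: "res_sum w J v ?I = ((sum v ?I - sum w J)\<^sup>2 + (\<Sum>x\<in>?I. (v x)\<^sup>2) - (\<Sum>n\<in>J. (w n)\<^sup>2)) / 2"
          "res_sum w J v I = sum v I - sum w J"
          using IH1 IH2 c cJ fin(3) by auto
        have half: "X / 2 + Y = Z / 2" if "X + 2 * Y = Z" for X Y Z :: 'f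
          using two by (simp add: that[symmetric] add_divide_distrib)
        define a b c d where "a = sum v ?I" and "b = sum w J" and "c = (\<Sum>x\<in>?I. (v x)\<^sup>2)"
          and "d = (\<Sum>n\<in>J. (w n)\<^sup>2)"
        note defs = this[symmetric]
        have J: "sum w (insert n J) = w n + b" "(\<Sum>n\<in>insert n J. (w n)\<^sup>2) = (w n)\<^sup>2 + d"
          using insert.hyps by (simp_all add: defs)
        show "res_sum w (insert n J) v I = ((sum v I - sum w (insert n J))\<^sup>2 + (\<Sum>x\<in>I. (v x)\<^sup>2)
            - (\<Sum>n\<in>insert n J. (w n)\<^sup>2)) / 2"
          unfolding rec 1 J sums defs
          by (rule half) (simp add: power2_eq_square algebra_simps)
      qed
    qed
  qed
  then show "card J + 2 \<le> card I \<Longrightarrow> res_sum w J v I = 0"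
    and "card J + 1 = card I \<Longrightarrow> res_sum w J v I = 1"
    and "card J = card I \<Longrightarrow> res_sum w J v I = sum v I - sum w J"
    and "card J = card I + 1 \<Longrightarrow> res_sum w J v I
      = ((sum v I - sum w J)\<^sup>2 + (\<Sum>x\<in>I. (v x)\<^sup>2) - (\<Sum>n\<in>J. (w n)\<^sup>2)) / 2"
    by blast+
qed

section \<open>Corners of partitions\<close>

lemma rpartitions_iff:
  "\<nu> \<in> rpartitions r \<longleftrightarrow> finite \<nu> \<and>
     (\<forall>i x y. (i, x, y) \<in> \<nu> \<longrightarrow> i < r \<and> (\<forall>x'\<le>x. \<forall>y'\<le>y. (i, x', y') \<in> \<nu>))"
proof
  assume "\<nu> \<in> rpartitions r"
  then have young: "young_diagram (\<nu> `` {i})" if "i < r" for i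
    using that unfolding rpartitions_def by blast
  have empty: "\<nu> `` {i} = {}" if "i \<ge> r" for i
    using that \<open>\<nu> \<in> rpartitions r\<close> unfolding rpartitions_def by blast
  have lt: "i < r" if "(i, x, y) \<in> \<nu>" for i x y
  proof (rule ccontr)
    assume "\<not> i < r"
    then have "\<nu> `` {i} = {}" by (intro empty) simp
    then show False using that by blast
  qed
  have "\<nu> = (SIGMA i:{..<r}. \<nu> `` {i})" using lt by auto
  moreover have "finite (SIGMA i:{..<r}. \<nu> `` {i})"
    using young unfolding young_diagram_def by blast
  ultimately have "finite \<nu>" by simp
  moreover have "(i, x', y') \<in> \<nu>" if "(i, x, y) \<in> \<nu>" "x' \<le> x" "y' \<le> y" for i x y x' y'
    using young[OF lt[OF that(1)]] that unfolding young_diagram_def by blast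
  ultimately show "finite \<nu> \<and>
     (\<forall>i x y. (i, x, y) \<in> \<nu> \<longrightarrow> i < r \<and> (\<forall>x'\<le>x. \<forall>y'\<le>y. (i, x', y') \<in> \<nu>))"
    using lt by blast
next
  assume A: "finite \<nu> \<and>
     (\<forall>i x y. (i, x, y) \<in> \<nu> \<longrightarrow> i < r \<and> (\<forall>x'\<le>x. \<forall>y'\<le>y. (i, x', y') \<in> \<nu>))"
  have "young_diagram (\<nu> `` {i})" for i
  proof -
    have "finite (\<nu> `` {i})" using A by (auto intro: finite_Image)
    moreover have "\<forall>(x, y)\<in>\<nu> `` {i}. \<forall>x'\<le>x. \<forall>y'\<le>y. (x', y') \<in> \<nu> `` {i}" using A by blast
    ultimately show ?thesis unfolding young_diagram_def by blast
  qed
  moreover have "\<nu> `` {i} = {}" if "i \<ge> r" for i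
  proof (rule ccontr)
    assume "\<nu> `` {i} \<noteq> {}"
    then obtain x y where "(i, x, y) \<in> \<nu>" by fast
    then have "i < r" using A by blast
    then show False using that by simp
  qed
  ultimately show "\<nu> \<in> rpartitions r"
    unfolding rpartitions_def by blast
qed

lemma rpartitions_finite: "\<nu> \<in> rpartitions r \<Longrightarrow> finite \<nu>"
  by (simp add: rpartitions_iff)

lemma rpartitions_down:
  "\<nu> \<in> rpartitions r \<Longrightarrow> (i, x, y) \<in> \<nu> \<Longrightarrow> x' \<le> x \<Longrightarrow> y' \<le> y \<Longrightarrow> (i, x', y') \<in> \<nu>"
  unfolding rpartitions_iff by blast

lemma rpartitions_less: "\<nu> \<in> rpartitions r \<Longrightarrow> (i, x, y) \<in> \<nu> \<Longrightarrow> i < r"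
  unfolding rpartitions_iff by blast

lemma rpartitionsI:
  assumes "finite \<nu>" "\<And>i x y. (i, x, y) \<in> \<nu> \<Longrightarrow> i < r"
    "\<And>i x y x' y'. (i, x, y) \<in> \<nu> \<Longrightarrow> x' \<le> x \<Longrightarrow> y' \<le> y \<Longrightarrow> (i, x', y') \<in> \<nu>"
  shows "\<nu> \<in> rpartitions r"
  using assms unfolding rpartitions_iff by blast

fun right_box :: "box \<Rightarrow> box" where "right_box (i, x, y) = (i, Suc x, y)"
fun up_box :: "box \<Rightarrow> box" where "up_box (i, x, y) = (i, x, Suc y)"
fun diag_box :: "box \<Rightarrow> box" where "diag_box (i, x, y) = (i, Suc x, Suc y)"

lemma inj_shift: "inj_on right_box A" "inj_on up_box A" "inj_on diag_box A"
  by (auto simp: inj_on_def)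

definition add_corners :: "nat \<Rightarrow> box set \<Rightarrow> box set" where
  "add_corners r \<nu> = {b. b \<notin> \<nu> \<and> insert b \<nu> \<in> rpartitions r}"

definition rem_corners :: "nat \<Rightarrow> box set \<Rightarrow> box set" where
  "rem_corners r \<nu> = {b \<in> \<nu>. \<nu> - {b} \<in> rpartitions r}"

lemma add_corners_iff:
  assumes "\<nu> \<in> rpartitions r"
  shows "(i, x, y) \<in> add_corners r \<nu> \<longleftrightarrow> i < r \<and> (i, x, y) \<notin> \<nu> \<and>
    (x = 0 \<or> (i, x - 1, y) \<in> \<nu>) \<and> (y = 0 \<or> (i, x, y - 1) \<in> \<nu>)"
proof
  assume A: "(i, x, y) \<in> add_corners r \<nu>"
  then have B: "(i, x, y) \<notin> \<nu>" "insert (i, x, y) \<nu> \<in> rpartitions r"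
    by (auto simp: add_corners_def)
  have 1: "(i, x', y') \<in> insert (i, x, y) \<nu>" if "x' \<le> x" "y' \<le> y" for x' y'
    using rpartitions_down[OF B(2)] that by blast
  have "i < r" using rpartitions_less[OF B(2)] by blast
  moreover have "x = 0 \<or> (i, x - 1, y) \<in> \<nu>"
    using 1[of "x - 1" y] by (cases x) simp_all
  moreover have "y = 0 \<or> (i, x, y - 1) \<in> \<nu>"
    using 1[of x "y - 1"] by (cases y) simp_all
  ultimately show "i < r \<and> (i, x, y) \<notin> \<nu> \<and>
    (x = 0 \<or> (i, x - 1, y) \<in> \<nu>) \<and> (y = 0 \<or> (i, x, y - 1) \<in> \<nu>)"
    using B by blast
next
  assume A: "i < r \<and> (i, x, y) \<notin> \<nu> \<and>
    (x = 0 \<or> (i, x - 1, y) \<in> \<nu>) \<and> (y = 0 \<or> (i, x, y - 1) \<in> \<nu>)"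
  have down: "(i, x', y') \<in> insert (i, x, y) \<nu>" if "x' \<le> x" "y' \<le> y" for x' y'
  proof (cases "x' = x \<and> y' = y")
    case False
    then have "x' \<le> x - 1 \<and> x \<noteq> 0 \<or> y' \<le> y - 1 \<and> y \<noteq> 0" using that by auto
    then show ?thesis using A that rpartitions_down[OF assms] by blast
  qed auto
  have "insert (i, x, y) \<nu> \<in> rpartitions r"
  proof (rule rpartitionsI)
    show "finite (insert (i, x, y) \<nu>)" using rpartitions_finite[OF assms] by simp
    show "j < r" if "(j, a, b) \<in> insert (i, x, y) \<nu>" for j a b
      using that A rpartitions_less[OF assms, of j a b] by auto
    show "(j, a', b') \<in> insert (i, x, y) \<nu>"
      if "(j, a, b) \<in> insert (i, x, y) \<nu>" "a' \<le> a" "b' \<le> b" for j a b a' b'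
      using that down[of a' b'] rpartitions_down[OF assms, of j a b a' b'] by auto
  qed
  then show "(i, x, y) \<in> add_corners r \<nu>" using A by (simp add: add_corners_def)
qed

lemma rem_corners_iff:
  assumes "\<nu> \<in> rpartitions r"
  shows "(i, x, y) \<in> rem_corners r \<nu> \<longleftrightarrow>
    (i, x, y) \<in> \<nu> \<and> (i, Suc x, y) \<notin> \<nu> \<and> (i, x, Suc y) \<notin> \<nu>"
proof
  assume A: "(i, x, y) \<in> rem_corners r \<nu>"
  then have B: "(i, x, y) \<in> \<nu>" "\<nu> - {(i, x, y)} \<in> rpartitions r"
    by (auto simp: rem_corners_def)
  show "(i, x, y) \<in> \<nu> \<and> (i, Suc x, y) \<notin> \<nu> \<and> (i, x, Suc y) \<notin> \<nu>"
    using rpartitions_down[OF B(2), of i "Suc x" y x y]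
      rpartitions_down[OF B(2), of i x "Suc y" x y] B(1) by auto
next
  assume A: "(i, x, y) \<in> \<nu> \<and> (i, Suc x, y) \<notin> \<nu> \<and> (i, x, Suc y) \<notin> \<nu>"
  have "(i', x', y') \<in> \<nu> - {(i, x, y)}"
    if "(i', a, b) \<in> \<nu> - {(i, x, y)}" "x' \<le> a" "y' \<le> b" for i' x' y' a b
  proof -
    have "(i', x', y') \<in> \<nu>" using that rpartitions_down[OF assms] by blast
    moreover have "(i', x', y') \<noteq> (i, x, y)"
    proof
      assume e: "(i', x', y') = (i, x, y)"
      then have "(i, a, b) \<in> \<nu>" "x \<le> a" "y \<le> b" "(a, b) \<noteq> (x, y)" using that by blast+
      then have "Suc x \<le> a \<and> y \<le> b \<or> x \<le> a \<and> Suc y \<le> b" by fastforce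
      then show False
        using A \<open>(i, a, b) \<in> \<nu>\<close> rpartitions_down[OF assms] by blast
    qed
    ultimately show ?thesis by simp
  qed
  note down = this
  have "\<nu> - {(i, x, y)} \<in> rpartitions r"
  proof (rule rpartitionsI)
    show "finite (\<nu> - {(i, x, y)})" using rpartitions_finite[OF assms] by simp
    show "j < r" if "(j, a, b) \<in> \<nu> - {(i, x, y)}" for j a b
      using that rpartitions_less[OF assms, of j a b] by blast
  qed (rule down)
  then show "(i, x, y) \<in> rem_corners r \<nu>" using A by (simp add: rem_corners_def)
qed

lemma finite_rem_corners: "\<nu> \<in> rpartitions r \<Longrightarrow> finite (rem_corners r \<nu>)"
  by (simp add: rem_corners_def rpartitions_finite)

lemma finite_add_corners:
  assumes "\<nu> \<in> rpartitions r" shows "finite (add_corners r \<nu>)"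
proof -
  have "add_corners r \<nu> \<subseteq> right_box ` \<nu> \<union> up_box ` \<nu> \<union> (\<lambda>i. (i, 0, 0)) ` {..<r}"
  proof
    fix b assume b: "b \<in> add_corners r \<nu>"
    obtain i x y where [simp]: "b = (i, x, y)" by (cases b)
    have "i < r \<and> (x = 0 \<or> (i, x - 1, y) \<in> \<nu>) \<and> (y = 0 \<or> (i, x, y - 1) \<in> \<nu>)"
      using b add_corners_iff[OF assms] by simp
    then consider "i < r" "x = 0" "y = 0" | "x \<noteq> 0" "(i, x - 1, y) \<in> \<nu>" | "y \<noteq> 0" "(i, x, y - 1) \<in> \<nu>"
      by blast
    then show "b \<in> right_box ` \<nu> \<union> up_box ` \<nu> \<union> (\<lambda>i. (i, 0, 0)) ` {..<r}"
    proof cases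
      case 1 then show ?thesis by simp
    next
      case 2
      then have "b = right_box (i, x - 1, y)" by simp
      with 2 show ?thesis by blast
    next
      case 3
      then have "b = up_box (i, x, y - 1)" by simp
      with 3 show ?thesis by blast
    qed
  qed
  then show ?thesis
    by (rule finite_subset) (use assms in \<open>simp add: rpartitions_finite\<close>)
qed

lemma corner_insert:
  assumes "b \<in> add_corners r \<nu>"
  shows "insert b \<nu> \<in> rpartitions r" "b \<notin> \<nu>" "insert b \<nu> - {b} = \<nu>"
  using assms by (auto simp: add_corners_def)

lemma corner_insert_rem:
  "\<nu> \<in> rpartitions r \<Longrightarrow> b \<in> add_corners r \<nu> \<Longrightarrow> b \<in> rem_corners r (insert b \<nu>)"
  by (simp add: add_corners_def rem_corners_def)

lemma corner_remove:
  assumes "b \<in> rem_corners r \<nu>"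
  shows "\<nu> - {b} \<in> rpartitions r" "b \<in> \<nu>" "insert b (\<nu> - {b}) = \<nu>"
  using assms by (auto simp: rem_corners_def)

lemma corner_remove_add:
  "\<nu> \<in> rpartitions r \<Longrightarrow> b \<in> rem_corners r \<nu> \<Longrightarrow> b \<in> add_corners r (\<nu> - {b})"
  by (simp add: add_corners_def rem_corners_def insert_absorb)

text \<open>Adding up the boxes of \<open>\<nu>\<close> with the signs of \<open>(1 - q\<^sub>1) (1 - q\<^sub>2)\<close> leaves only corners.\<close>

lemma corner_balance_mset:
  assumes "\<nu> \<in> rpartitions r"
  shows "mset_set (add_corners r \<nu>) + mset_set \<nu> + mset_set (diag_box ` \<nu>)
    = mset_set (diag_box ` rem_corners r \<nu>) + mset_set ((\<lambda>i. (i, 0, 0)) ` {..<r})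
      + mset_set (right_box ` \<nu>) + mset_set (up_box ` \<nu>)"
proof (rule multiset_eqI)
  fix b :: box
  obtain i x y where b: "b = (i, x, y)" by (cases b)
  note fin = finite_add_corners[OF assms] finite_rem_corners[OF assms] rpartitions_finite[OF assms]
  note iff = add_corners_iff[OF assms] rem_corners_iff[OF assms]
  have R: "(i, x, y) \<in> right_box ` \<nu> \<longleftrightarrow> x > 0 \<and> (i, x - 1, y) \<in> \<nu>"
    by (cases x) (auto intro: rev_image_eqI)
  have U: "(i, x, y) \<in> up_box ` \<nu> \<longleftrightarrow> y > 0 \<and> (i, x, y - 1) \<in> \<nu>"
    by (cases y) (auto intro: rev_image_eqI)
  have D: "(i, x, y) \<in> diag_box ` N \<longleftrightarrow> x > 0 \<and> y > 0 \<and> (i, x - 1, y - 1) \<in> N" for N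
    by (cases x; cases y) (auto intro: rev_image_eqI)
  have O: "(i, x, y) \<in> (\<lambda>i. (i, 0, 0)) ` {..<r} \<longleftrightarrow> i < r \<and> x = 0 \<and> y = 0" by auto
  have d1: "(i, x, y) \<in> \<nu> \<Longrightarrow> i < r"
    and d2: "(i, x, y) \<in> \<nu> \<Longrightarrow> (i, x - 1, y) \<in> \<nu> \<and> (i, x, y - 1) \<in> \<nu>"
    and d3: "(i, x - 1, y) \<in> \<nu> \<or> (i, x, y - 1) \<in> \<nu> \<Longrightarrow> (i, x - 1, y - 1) \<in> \<nu> \<and> i < r"
    and d4: "(i, x - 1, y - 1) \<in> \<nu> \<Longrightarrow> i < r"
    using rpartitions_less[OF assms] by (auto intro: rpartitions_down[OF assms])
  \<comment> \<open>Apart from the position relative to the axes, the multiplicity on each side is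
    decided by which of the box and its left, lower and diagonal neighbours lie in \<nu>;
    \<open>d1\<close> to \<open>d4\<close> exclude the combinations impossible in a Young
    diagram.\<close>
  show "count (mset_set (add_corners r \<nu>) + mset_set \<nu> + mset_set (diag_box ` \<nu>)) b
    = count (mset_set (diag_box ` rem_corners r \<nu>) + mset_set ((\<lambda>i. (i, 0, 0)) ` {..<r})
      + mset_set (right_box ` \<nu>) + mset_set (up_box ` \<nu>)) b"
    unfolding b count_union count_mset_set' R U D O iff
    using d1 d2 d3 d4 fin
    by (cases "x = 0"; cases "y = 0"; cases "(i, x, y) \<in> \<nu>"; cases "(i, x - 1, y) \<in> \<nu>";
        cases "(i, x, y - 1) \<in> \<nu>"; cases "(i, x - 1, y - 1) \<in> \<nu>"; cases "i < r")
       simp_all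
qed

lemma corner_sum:
  fixes g :: "box \<Rightarrow> 'a::comm_monoid_add"
  assumes "\<nu> \<in> rpartitions r"
  shows "(\<Sum>a\<in>add_corners r \<nu>. g a) + (\<Sum>b\<in>\<nu>. g b) + (\<Sum>b\<in>\<nu>. g (diag_box b))
    = (\<Sum>c\<in>rem_corners r \<nu>. g (diag_box c)) + (\<Sum>i<r. g (i, 0, 0)) + (\<Sum>b\<in>\<nu>. g (right_box b)) + (\<Sum>b\<in>\<nu>. g (up_box b))"
proof -
  have s: "(\<Sum>b\<in>A. g (f b)) = \<Sum>\<^sub># (image_mset g (mset_set (f ` A)))" if "inj_on f A" for f :: "'b \<Rightarrow> box" and A
    unfolding sum_unfold_sum_mset[symmetric] by (simp add: sum.reindex[OF that])
  have i: "inj_on (\<lambda>i::nat. (i, 0::nat, 0::nat)) {..<r}" by (auto simp: inj_on_def)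
  show ?thesis
    unfolding s[OF inj_shift(1)] s[OF inj_shift(2)] s[OF inj_shift(3)] s[OF i]
    unfolding sum_unfold_sum_mset image_mset_union[symmetric] sum_mset.union[symmetric]
      corner_balance_mset[OF assms] ..
qed

lemma corner_prod:
  fixes g :: "box \<Rightarrow> 'a::comm_monoid_mult"
  assumes "\<nu> \<in> rpartitions r"
  shows "(\<Prod>a\<in>add_corners r \<nu>. g a) * (\<Prod>b\<in>\<nu>. g b) * (\<Prod>b\<in>\<nu>. g (diag_box b))
    = (\<Prod>c\<in>rem_corners r \<nu>. g (diag_box c)) * (\<Prod>i<r. g (i, 0, 0)) * (\<Prod>b\<in>\<nu>. g (right_box b)) * (\<Prod>b\<in>\<nu>. g (up_box b))"
proof -
  have s: "(\<Prod>b\<in>A. g (f b)) = prod_mset (image_mset g (mset_set (f ` A)))" if "inj_on f A" for f :: "'b \<Rightarrow> box" and A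
    unfolding prod_unfold_prod_mset[symmetric] by (simp add: prod.reindex[OF that])
  have i: "inj_on (\<lambda>i::nat. (i, 0::nat, 0::nat)) {..<r}" by (auto simp: inj_on_def)
  show ?thesis
    unfolding s[OF inj_shift(1)] s[OF inj_shift(2)] s[OF inj_shift(3)] s[OF i]
    unfolding prod_unfold_prod_mset image_mset_union[symmetric] prod_mset.union[symmetric]
      corner_balance_mset[OF assms] ..
qed

text \<open>The balance for \<open>insert b \<nu>\<close> minus the balance for \<nu>: only the
  corners and the four shifts of \<open>b\<close> survive. Every term is moved to the side where it
  counts positively because multisets have no negatives.\<close>

lemma corner_step_mset:
  assumes "\<nu> \<in> rpartitions r" "b \<in> add_corners r \<nu>"
  shows "mset_set (add_corners r (insert b \<nu>)) + {#b, diag_box b#} + mset_set (diag_box ` rem_corners r \<nu>)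
    = mset_set (add_corners r \<nu>) + {#right_box b, up_box b#} + mset_set (diag_box ` rem_corners r (insert b \<nu>))"
proof -
  note A = corner_insert[OF assms(2)] rpartitions_finite[OF assms(1)]
  have im: "mset_set (f ` insert b \<nu>) = add_mset (f b) (mset_set (f ` \<nu>))" if "inj f" for f :: "box \<Rightarrow> box"
  proof -
    have "f b \<notin> f ` \<nu>" using that A(2) by (simp add: inj_image_mem_iff)
    then show ?thesis using A(4) by simp
  qed
  have inj: "inj right_box" "inj up_box" "inj diag_box"
    by (rule inj_shift)+
  have im0: "mset_set (insert b \<nu>) = add_mset b (mset_set \<nu>)" using A by simp
  note e1 = corner_balance_mset[OF A(1), unfolded im[OF inj(1)] im[OF inj(2)] im[OF inj(3)] im0]
    and e2 = corner_balance_mset[OF assms(1)]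
  have gen: "P1 + {#b, d#} + Q0 = P0 + {#a, c#} + Q1"
    if "P1 + add_mset b N + add_mset d D = Q1 + Z + add_mset a R + add_mset c U"
      "P0 + N + D = Q0 + Z + R + U"
    for P1 R U Q1 Z N D P0 Q0 :: "box multiset" and a b c d
  proof -
    have "(P1 + {#b, d#} + Q0) + (R + U + Z + N + D)
        = (P1 + add_mset b N + add_mset d D) + (Q0 + Z + R + U)"
      by (simp add: ac_simps)
    also have "\<dots> = (P0 + {#a, c#} + Q1) + (R + U + Z + N + D)"
      unfolding that(1) that(2)[symmetric] by (simp add: ac_simps)
    finally show ?thesis by (rule add_right_imp_eq)
  qed
  show ?thesis by (rule gen[OF e1 e2])
qed

section \<open>The function \<open>N\<^sub>\<nu>\<close> in cancelled form and its residues at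
  corners\<close>

definition corner_fun :: "nat \<Rightarrow> 'a::field \<Rightarrow> 'a \<Rightarrow> (nat \<Rightarrow> 'a) \<Rightarrow> box set \<Rightarrow> 'a \<Rightarrow> 'a" where
  "corner_fun r t1 t2 u \<nu> z =
     (\<Prod>a\<in>add_corners r \<nu>. z - weight t1 t2 u a + (t1 + t2)) / (\<Prod>c\<in>rem_corners r \<nu>. z - weight t1 t2 u c)"

lemma weight_shift:
  "weight t1 t2 u (right_box b) = weight t1 t2 u b + t1"
  "weight t1 t2 u (up_box b) = weight t1 t2 u b + t2"
  "weight t1 t2 u (diag_box b) = weight t1 t2 u b + (t1 + t2)"
  by (cases b; simp add: weight_def algebra_simps)+

lemma shift_neq:
  "right_box b \<noteq> b" "up_box b \<noteq> b" "diag_box b \<noteq> b"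
  "right_box b \<noteq> diag_box b" "up_box b \<noteq> diag_box b"
  by (cases b; simp)+

lemma diag_box_eq_iff: "diag_box b = diag_box c \<longleftrightarrow> b = c"
  by (cases b; cases c) simp

lemma weight_origin: "weight t1 t2 u (i, 0, 0) = u i"
  by (simp add: weight_def)

lemma card_corners:
  assumes "\<nu> \<in> rpartitions r"
  shows "card (add_corners r \<nu>) = card (rem_corners r \<nu>) + r"
  using corner_sum[OF assms, of "\<lambda>_. 1 :: nat"] by simp

text \<open>The mixed second difference along t1 and t2 of an affine function is 0, so the boxes
  contribute nothing.\<close>

lemma corner_weights_sum:
  assumes "\<nu> \<in> rpartitions r"
  shows "(\<Sum>a\<in>add_corners r \<nu>. weight t1 t2 u a - c)
    = (\<Sum>b\<in>rem_corners r \<nu>. weight t1 t2 u b + (t1 + t2) - c) + (\<Sum>i<r. u i - c)"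
proof -
  have "(\<Sum>b\<in>\<nu>. weight t1 t2 u b - c) + (\<Sum>b\<in>\<nu>. weight t1 t2 u (diag_box b) - c)
      = (\<Sum>b\<in>\<nu>. weight t1 t2 u (right_box b) - c) + (\<Sum>b\<in>\<nu>. weight t1 t2 u (up_box b) - c)"
    unfolding sum.distrib[symmetric] weight_shift by (intro sum.cong refl) (simp add: algebra_simps)
  then show ?thesis
    using corner_sum[OF assms, of "\<lambda>b. weight t1 t2 u b - c"]
    unfolding weight_shift(3) weight_origin by (simp add: add.assoc)
qed

text \<open>The mixed second difference of a square is \<open>2 * t1 * t2\<close>, once for every
  box; this is the source of the degree term that L_0 has to match.\<close>

lemma corner_weights_sum_squares:
  assumes "\<nu> \<in> rpartitions r"
  shows "(\<Sum>a\<in>add_corners r \<nu>. (weight t1 t2 u a - c)\<^sup>2) + 2 * t1 * t2 * of_nat (card \<nu>)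
    = (\<Sum>b\<in>rem_corners r \<nu>. (weight t1 t2 u b + (t1 + t2) - c)\<^sup>2) + (\<Sum>i<r. (u i - c)\<^sup>2)"
proof -
  have "(\<Sum>b\<in>\<nu>. (weight t1 t2 u b - c)\<^sup>2) + (\<Sum>b\<in>\<nu>. (weight t1 t2 u (diag_box b) - c)\<^sup>2)
      = (\<Sum>b\<in>\<nu>. (weight t1 t2 u (right_box b) - c)\<^sup>2) + (\<Sum>b\<in>\<nu>. (weight t1 t2 u (up_box b) - c)\<^sup>2)
      + (\<Sum>b\<in>\<nu>. 2 * t1 * t2)"
    unfolding sum.distrib[symmetric] weight_shift
    by (intro sum.cong refl) (simp add: algebra_simps power2_eq_square)
  moreover have "A + k = Q + Z" if "N + D = R + U + k" "A + N + D = Q + Z + R + U"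
    for A N D R U k Q Z :: 'a
  proof -
    have "(A + k) + (R + U) = A + (R + U + k)" by (simp add: ac_simps)
    also have "\<dots> = (Q + Z) + (R + U)"
      unfolding that(1)[symmetric] using that(2) by (simp add: add.assoc)
    finally show ?thesis by (rule add_right_imp_eq)
  qed
  moreover note corner_sum[OF assms, of "\<lambda>b. (weight t1 t2 u b - c)\<^sup>2"]
  ultimately have "(\<Sum>a\<in>add_corners r \<nu>. (weight t1 t2 u a - c)\<^sup>2) + (\<Sum>b\<in>\<nu>. 2 * t1 * t2)
    = (\<Sum>b\<in>rem_corners r \<nu>. (weight t1 t2 u (diag_box b) - c)\<^sup>2)
      + (\<Sum>i<r. (weight t1 t2 u (i, 0, 0) - c)\<^sup>2)"
    by blast
  then show ?thesis
    unfolding weight_shift(3) weight_origin by (simp add: mult.commute)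
qed

lemma corner_step_prod:
  fixes g :: "box \<Rightarrow> 'a::comm_monoid_mult"
  assumes "\<nu> \<in> rpartitions r" "b \<in> add_corners r \<nu>"
  shows "(\<Prod>a\<in>add_corners r (insert b \<nu>). g a) * (g b * g (diag_box b)) * (\<Prod>c\<in>rem_corners r \<nu>. g (diag_box c))
    = (\<Prod>a\<in>add_corners r \<nu>. g a) * (g (right_box b) * g (up_box b)) * (\<Prod>c\<in>rem_corners r (insert b \<nu>). g (diag_box c))"
proof -
  have s: "(\<Prod>b\<in>A. g (diag_box b)) = prod_mset (image_mset g (mset_set (diag_box ` A)))" for A
    unfolding prod_unfold_prod_mset[symmetric] by (simp add: prod.reindex[OF inj_shift(3)])
  show ?thesis
    using arg_cong[OF corner_step_mset[OF assms], of "\<lambda>M. prod_mset (image_mset g M)"]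
    unfolding s prod_unfold_prod_mset by (simp add: ac_simps)
qed

text \<open>The absence of integral relations separates boxes by their weights, which makes all
  poles simple. It also forces characteristic 0: by the case \<open>y = 0\<close>,
  \<open>i = j\<close>, no nonzero integral multiple of \<open>t1\<close> vanishes.\<close>

locale generic_weights =
  fixes t1 t2 :: "'a::field" and u :: "nat \<Rightarrow> 'a"
  assumes generic: "of_int x * t1 + of_int y * t2 + u i - u j = 0 \<Longrightarrow> x = 0 \<and> y = 0 \<and> i = j"
begin

lemma t_nonzero: "t1 \<noteq> 0" "t2 \<noteq> 0" "t1 + t2 \<noteq> 0" "(2 :: 'a) \<noteq> 0"
  using generic[of 1 0 0 0] generic[of 0 1 0 0] generic[of 1 1 0 0] generic[of 2 0 0 0] by auto

lemma weight_eq_iff: "weight t1 t2 u b = weight t1 t2 u c \<longleftrightarrow> b = c"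
proof
  assume e: "weight t1 t2 u b = weight t1 t2 u c"
  obtain i x y j x' y' where [simp]: "b = (i, x, y)" "c = (j, x', y')" by (cases b; cases c)
  have "of_int (int x - int x') * t1 + of_int (int y - int y') * t2 + u i - u j = 0"
    using e by (simp add: weight_def algebra_simps)
  from generic[OF this] show "b = c" by simp
qed simp

lemma weight_add_t_eq_iff: "weight t1 t2 u b + (t1 + t2) = weight t1 t2 u c \<longleftrightarrow> c = diag_box b"
  using weight_eq_iff[of "diag_box b" c] by (auto simp: weight_shift)

lemma diag_rem_not_add:
  assumes "\<nu> \<in> rpartitions r" "c \<in> rem_corners r \<nu>"
  shows "diag_box c \<notin> add_corners r \<nu>" "diag_box c \<notin> \<nu>"
proof -
  obtain i x y where [simp]: "c = (i, x, y)" by (cases c)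
  note A = assms(2)[simplified, unfolded rem_corners_iff[OF assms(1)]]
  show "diag_box c \<notin> add_corners r \<nu>"
    using A by (simp add: add_corners_iff[OF assms(1)])
  show "diag_box c \<notin> \<nu>"
    using A rpartitions_down[OF assms(1), of i "Suc x" "Suc y" "Suc x" y] by auto
qed

text \<open>Adding \<open>b\<close> multiplies N by the zeta factor of \<open>b\<close>, which has
  residue \<open>t1 * t2 / (t1 + t2)\<close> at the weight of \<open>b\<close>. So the left side is
  the residue of N for the enlarged shape at its new pole, and this explains the prefactor in
  \<open>C_plus\<close>.\<close>

lemma residue_at_removable:
  assumes "\<nu> \<in> rpartitions r" "b \<in> add_corners r \<nu>"
  shows "t1 * t2 / (t1 + t2) * corner_fun r t1 t2 u \<nu> (weight t1 t2 u b)
    = (\<Prod>a\<in>add_corners r (insert b \<nu>). weight t1 t2 u b - weight t1 t2 u a + (t1 + t2))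
      / (\<Prod>c\<in>rem_corners r (insert b \<nu>) - {b}. weight t1 t2 u b - weight t1 t2 u c)"
proof -
  let ?w = "weight t1 t2 u" and ?\<nu>' = "insert b \<nu>"
  \<comment> \<open>At the weight of \<open>b\<close> the factor of \<open>diag_box b\<close>
    vanishes. It occurs once on each side of the step identity; replacing it by 1 on both sides is
    the passage to the residue.\<close>
  define g where "g c = (if c = diag_box b then 1 else ?w b - ?w c + (t1 + t2))" for c
  note ins = corner_insert[OF assms(2)]
  have db: "diag_box b \<notin> add_corners r ?\<nu>'" "diag_box b \<notin> add_corners r \<nu>"
  proof -
    show "diag_box b \<notin> add_corners r ?\<nu>'"
      by (rule diag_rem_not_add[OF ins(1) corner_insert_rem[OF assms]])
    obtain i x y where [simp]: "b = (i, x, y)" by (cases b)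
    show "diag_box b \<notin> add_corners r \<nu>"
      using rpartitions_down[OF assms(1), of i x "Suc y" x y] ins(2)
      by (auto simp: add_corners_iff[OF assms(1)])
  qed
  have gd: "g (diag_box c) = (if c = b then 1 else ?w b - ?w c)" for c
    by (simp add: g_def weight_shift diag_box_eq_iff)
  have gb: "g b = t1 + t2" "g (right_box b) = t2" "g (up_box b) = t1" "g (diag_box b) = 1"
    using shift_neq[of b] by (simp_all add: g_def weight_shift)
  have R: "(\<Prod>c\<in>rem_corners r ?\<nu>'. g (diag_box c)) = (\<Prod>c\<in>rem_corners r ?\<nu>' - {b}. ?w b - ?w c)"
    using finite_rem_corners[OF ins(1)] corner_insert_rem[OF assms]
    by (simp add: prod.remove gd)
  have bR: "b \<notin> rem_corners r \<nu>" using ins(2) by (auto simp: rem_corners_def)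
  have R': "(\<Prod>c\<in>rem_corners r \<nu>. g (diag_box c)) = (\<Prod>c\<in>rem_corners r \<nu>. ?w b - ?w c)"
    using bR by (intro prod.cong refl) (auto simp: gd)
  have A: "(\<Prod>a\<in>add_corners r ?\<nu>'. g a) = (\<Prod>a\<in>add_corners r ?\<nu>'. ?w b - ?w a + (t1 + t2))"
    "(\<Prod>a\<in>add_corners r \<nu>. g a) = (\<Prod>a\<in>add_corners r \<nu>. ?w b - ?w a + (t1 + t2))"
    using db by (intro prod.cong refl; auto simp: g_def)+
  have nz: "(\<Prod>c\<in>rem_corners r \<nu>. ?w b - ?w c) \<noteq> 0"
    "(\<Prod>c\<in>rem_corners r ?\<nu>' - {b}. ?w b - ?w c) \<noteq> 0"
    using bR finite_rem_corners[OF assms(1)] finite_rem_corners[OF ins(1)]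
    by (auto simp: prod_zero_iff weight_eq_iff)
  have "t1 * t2 / s * (P / Q) = P' / Q'"
    if "P' * (s * 1) * Q = P * (t2 * t1) * Q'" "Q \<noteq> 0" "Q' \<noteq> 0" "s \<noteq> 0" for P Q P' Q' s
    using that by (simp add: divide_simps) (simp add: ac_simps)
  from this[OF corner_step_prod[OF assms, of g, unfolded R R' A gb] nz t_nonzero(3)]
  show ?thesis unfolding corner_fun_def .
qed

text \<open>The addable box \<open>b\<close> gives N a simple zero at its weight minus t, hence
  \<open>1 / N\<close> a pole. There the zeta factor of \<open>b\<close> has residue
  \<open>- t1 * t2 / (t1 + t2)\<close>, so the left side, taken at the enlarged shape, is minus the
  residue of \<open>1 / N\<close> for the original one.\<close>

lemma residue_at_addable:
  assumes "\<nu> \<in> rpartitions r" "b \<in> add_corners r \<nu>"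
  shows "t1 * t2 / (t1 + t2) / corner_fun r t1 t2 u (insert b \<nu>) (weight t1 t2 u b - (t1 + t2))
    = - ((\<Prod>c\<in>rem_corners r \<nu>. weight t1 t2 u b - weight t1 t2 u c - (t1 + t2))
      / (\<Prod>a\<in>add_corners r \<nu> - {b}. weight t1 t2 u b - weight t1 t2 u a))"
proof -
  let ?w = "weight t1 t2 u" and ?\<nu>' = "insert b \<nu>"
  define g where "g c = (if c = b then 1 else ?w b - ?w c)" for c
  note ins = corner_insert[OF assms(2)]
  have nd: "diag_box c \<noteq> b" if "c \<in> rem_corners r \<nu> \<or> c \<in> rem_corners r ?\<nu>'" for c
    using that diag_rem_not_add(1)[OF assms(1), of c] diag_rem_not_add(2)[OF ins(1), of c] assms(2)
    by blast
  have gb: "g b = 1" "g (right_box b) = - t1" "g (up_box b) = - t2" "g (diag_box b) = - (t1 + t2)"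
    using shift_neq[of b] by (simp_all add: g_def weight_shift)
  have R: "(\<Prod>c\<in>rem_corners r N. g (diag_box c)) = (\<Prod>c\<in>rem_corners r N. ?w b - ?w c - (t1 + t2))"
    if "N = \<nu> \<or> N = ?\<nu>'" for N
    using nd that by (intro prod.cong refl) (auto simp: g_def weight_shift)
  have A: "(\<Prod>a\<in>add_corners r \<nu>. g a) = (\<Prod>a\<in>add_corners r \<nu> - {b}. ?w b - ?w a)"
    using finite_add_corners[OF assms(1)] assms(2)
    by (simp add: prod.remove g_def)
  have A': "(\<Prod>a\<in>add_corners r ?\<nu>'. g a) = (\<Prod>a\<in>add_corners r ?\<nu>'. ?w b - ?w a)"
    by (intro prod.cong refl) (auto simp: g_def add_corners_def)
  have nz: "(\<Prod>a\<in>add_corners r \<nu> - {b}. ?w b - ?w a) \<noteq> 0"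
    "(\<Prod>a\<in>add_corners r ?\<nu>'. ?w b - ?w a) \<noteq> 0"
    using finite_add_corners[OF assms(1)] finite_add_corners[OF ins(1)]
    by (auto simp: prod_zero_iff weight_eq_iff) (auto simp: add_corners_def)
  have nz': "(\<Prod>c\<in>rem_corners r ?\<nu>'. ?w b - ?w c - (t1 + t2)) \<noteq> 0"
  proof -
    have "?w b - ?w c - (t1 + t2) \<noteq> 0" if "c \<in> rem_corners r ?\<nu>'" for c
    proof
      assume "?w b - ?w c - (t1 + t2) = 0"
      then have "?w c + (t1 + t2) = ?w b" by (simp add: algebra_simps)
      then show False using nd that weight_add_t_eq_iff by metis
    qed
    then show ?thesis using finite_rem_corners[OF ins(1)] by (simp add: prod_zero_iff)
  qed
  have e: "corner_fun r t1 t2 u ?\<nu>' (?w b - (t1 + t2))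
      = (\<Prod>a\<in>add_corners r ?\<nu>'. ?w b - ?w a) / (\<Prod>c\<in>rem_corners r ?\<nu>'. ?w b - ?w c - (t1 + t2))"
    unfolding corner_fun_def by (intro arg_cong2[where f = "(/)"] prod.cong refl) (simp_all add: algebra_simps)
  have "t1 * t2 / s / (P' / Q') = - (Q / P)"
    if "P' * (1 * - s) * Q = P * (- t1 * - t2) * Q'" "P \<noteq> 0" "P' \<noteq> 0" "Q' \<noteq> 0" "s \<noteq> 0"
    for P Q P' Q' s
    using that by (simp add: divide_simps) (simp add: ac_simps)
  from this[OF corner_step_prod[OF assms, of g, unfolded R[OF disjI1, OF refl] R[OF disjI2, OF refl] A A' gb]
      nz nz' t_nonzero(3)]
  show ?thesis unfolding e .
qed

end

section \<open>Pairs of fixed points: zeros, poles and residue sums of \<Phi>\<close>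

locale generic_pair = fst: generic_weights t1 t2 u + snd: generic_weights t1 t2 u'
  for t1 t2 :: "'a::field" and u u' :: "nat \<Rightarrow> 'a" +
  fixes m :: 'a
  assumes generic_shift: "of_int x * t1 + of_int y * t2 + u i - u' j + m \<noteq> 0"
begin

abbreviation "t \<equiv> t1 + t2"
text \<open>The sum of the poles minus the sum of the zeros of \<Phi>, which is its coefficient of
  1/z at infinity. It is the scalar \<open>\<beta> - r (m - t)\<close> in the relation for
  \<open>B\<^sub>-\<^sub>k\<close>.\<close>

abbreviation "\<phi> r \<equiv> of_nat r * (t - m) + (\<Sum>i<r. u' i - u i)"
abbreviation "\<chi> \<equiv> weight t1 t2 u"
abbreviation "\<chi>' \<equiv> weight t1 t2 u'"

lemma generic_pair_swap: "generic_pair t1 t2 u' u (t - m)"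
proof unfold_locales
  show "of_int x * t1 + of_int y * t2 + u' i - u j + (t - m) \<noteq> 0" for x y i j
  proof
    assume "of_int x * t1 + of_int y * t2 + u' i - u j + (t - m) = 0"
    then have "of_int (- x - 1) * t1 + of_int (- y - 1) * t2 + u j - u' i + m = 0"
      by (simp add: algebra_simps)
    then show False using generic_shift by blast
  qed
qed

text \<open>Genericity of m at work: poles of \<Phi> coming from \<nu> coincide with no poles or
  zeros coming from \<mu>, and conversely.\<close>

lemma weight_shift_neq: "\<chi> b \<noteq> \<chi>' c - m" "\<chi> b \<noteq> \<chi>' c - m + t" "\<chi> b - t \<noteq> \<chi>' c - m"
proof -
  obtain i x y j x' y' where [simp]: "b = (i, x, y)" "c = (j, x', y')" by (cases b; cases c)
  have *: "\<chi> b - \<chi>' c + m + (of_int e * t1 + of_int e * t2) \<noteq> 0" for e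
    using generic_shift[of "int x - int x' + e" "int y - int y' + e" i j]
    by (simp add: weight_def algebra_simps)
  show "\<chi> b \<noteq> \<chi>' c - m" using *[of 0] by auto
  show "\<chi> b \<noteq> \<chi>' c - m + t" "\<chi> b - t \<noteq> \<chi>' c - m"
    using *[of "-1"] by (auto simp: algebra_simps)
qed

text \<open>The one-box coefficient of \<open>C_plus\<close> at \<open>b\<close>, times the quotient
  of the coefficients of A at the shapes without and with \<open>b\<close>. The analogue for a box
  added to \<mu> is \<open>add_weight\<close>.\<close>

definition remove_weight :: "nat \<Rightarrow> box set \<Rightarrow> box set \<Rightarrow> box \<Rightarrow> 'a" where
  "remove_weight r \<nu> \<mu> b = t1 * t2 / t * corner_fun r t1 t2 u (\<nu> - {b}) (\<chi> b)
     / corner_fun r t1 t2 u' \<mu> (\<chi> b + m - t)"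

definition add_weight :: "nat \<Rightarrow> box set \<Rightarrow> box set \<Rightarrow> box \<Rightarrow> 'a" where
  "add_weight r \<nu> \<mu> b = t1 * t2 / t * corner_fun r t1 t2 u \<nu> (\<chi>' b - m)
     / corner_fun r t1 t2 u' (insert b \<mu>) (\<chi>' b - t)"

definition middle_sum :: "nat \<Rightarrow> box set \<Rightarrow> box set \<Rightarrow> ('a \<Rightarrow> 'a) \<Rightarrow> 'a" where
  "middle_sum r \<nu> \<mu> g = (\<Sum>b\<in>rem_corners r \<nu>. remove_weight r \<nu> \<mu> b * g (\<chi> b))
     - (\<Sum>b\<in>add_corners r \<mu>. add_weight r \<nu> \<mu> b * g (\<chi>' b - m))"

text \<open>A disjoint sum, since the same box can be a corner of both \<nu> and \<mu> and then
  stands for two different points.\<close>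

definition poles :: "nat \<Rightarrow> box set \<Rightarrow> box set \<Rightarrow> (box + box) set" where
  "poles r \<nu> \<mu> = rem_corners r \<nu> <+> add_corners r \<mu>"

definition zeros :: "nat \<Rightarrow> box set \<Rightarrow> box set \<Rightarrow> (box + box) set" where
  "zeros r \<nu> \<mu> = add_corners r \<nu> <+> rem_corners r \<mu>"

definition pole :: "box + box \<Rightarrow> 'a" where
  "pole = case_sum \<chi> (\<lambda>b. \<chi>' b - m)"

definition zero :: "box + box \<Rightarrow> 'a" where
  "zero = case_sum (\<lambda>b. \<chi> b - t) (\<lambda>b. \<chi>' b + t - m)"

context
  fixes r :: nat and \<nu> \<mu> :: "box set"
  assumes part: "\<nu> \<in> rpartitions r" "\<mu> \<in> rpartitions r"
begin

lemma finite_poles: "finite (poles r \<nu> \<mu>)" and finite_zeros: "finite (zeros r \<nu> \<mu>)"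
  using part by (simp_all add: poles_def zeros_def finite_rem_corners finite_add_corners)

text \<open>Both \<nu> and \<mu> have r more addable than removable corners, and they contribute
  this excess on opposite sides. So \<Phi> tends to 1 at infinity.\<close>

lemma card_poles: "card (zeros r \<nu> \<mu>) = card (poles r \<nu> \<mu>)"
  using part by (simp add: poles_def zeros_def card_Plus finite_rem_corners finite_add_corners card_corners)

lemma inj_pole: "inj_on pole A"
  by (rule inj_onI) (auto simp: pole_def fst.weight_eq_iff snd.weight_eq_iff weight_shift_neq
      weight_shift_neq[symmetric] split: sum.splits)

text \<open>Lets a zero be divided out: the quotients by \<open>z - zero n\<close> are then defined
  at every pole.\<close>

lemma pole_neq_zero:
  assumes "x \<in> poles r \<nu> \<mu>" "n \<in> zeros r \<nu> \<mu>"
  shows "pole x \<noteq> zero n"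
proof
  assume e: "pole x = zero n"
  show False
  proof (cases x; cases n)
    fix b c assume [simp]: "x = Inl b" "n = Inl c"
    have "\<chi> b + t = \<chi> c" using e by (simp add: pole_def zero_def)
    then have "c = diag_box b" by (simp only: fst.weight_add_t_eq_iff)
    then show False using assms fst.diag_rem_not_add[OF part(1)] by (auto simp: poles_def zeros_def)
  next
    fix b c assume [simp]: "x = Inr b" "n = Inr c"
    have "\<chi>' c + t = \<chi>' b" using e by (simp add: pole_def zero_def)
    then have "b = diag_box c" by (simp only: snd.weight_add_t_eq_iff)
    then show False using assms snd.diag_rem_not_add[OF part(2)] by (auto simp: poles_def zeros_def)
  next
    fix b c assume [simp]: "x = Inl b" "n = Inr c"
    show False using e weight_shift_neq(2)[of b c] by (simp add: pole_def zero_def algebra_simps)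
  next
    fix b c assume [simp]: "x = Inr b" "n = Inl c"
    show False using e weight_shift_neq(3)[of c b] by (simp add: pole_def zero_def)
  qed
qed

lemma prod_zeros:
  "(\<Prod>n\<in>zeros r \<nu> \<mu>. z - zero n)
    = (\<Prod>a\<in>add_corners r \<nu>. z - \<chi> a + t) * (\<Prod>c\<in>rem_corners r \<mu>. z - \<chi>' c - t + m)"
  unfolding zeros_def using part
  by (subst prod.Plus) (simp_all add: finite_rem_corners finite_add_corners zero_def algebra_simps)

lemma remove_weight_residue:
  assumes b: "b \<in> rem_corners r \<nu>"
  shows "remove_weight r \<nu> \<mu> b
    = (\<Prod>n\<in>zeros r \<nu> \<mu>. pole (Inl b) - zero n) / (\<Prod>y\<in>poles r \<nu> \<mu> - {Inl b}. pole (Inl b) - pole y)"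
proof -
  note rem = corner_remove[OF b] and add = corner_remove_add[OF part(1) b]
  have "poles r \<nu> \<mu> - {Inl b} = (rem_corners r \<nu> - {b}) <+> add_corners r \<mu>"
    by (auto simp: poles_def)
  then have "(\<Prod>y\<in>poles r \<nu> \<mu> - {Inl b}. pole (Inl b) - pole y)
      = (\<Prod>c\<in>rem_corners r \<nu> - {b}. \<chi> b - \<chi> c) * (\<Prod>a\<in>add_corners r \<mu>. \<chi> b + m - t - \<chi>' a + t)"
    using part by (simp add: prod.Plus finite_rem_corners finite_add_corners pole_def algebra_simps)
  moreover have "corner_fun r t1 t2 u' \<mu> (\<chi> b + m - t)
    = (\<Prod>a\<in>add_corners r \<mu>. \<chi> b + m - t - \<chi>' a + t) / (\<Prod>c\<in>rem_corners r \<mu>. \<chi> b - \<chi>' c - t + m)"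
    unfolding corner_fun_def by (intro arg_cong2[where f = "(/)"] prod.cong refl) (simp_all add: algebra_simps)
  ultimately show ?thesis
    unfolding remove_weight_def fst.residue_at_removable[OF rem(1) add, unfolded rem(3)] prod_zeros
    by (simp add: pole_def)
qed

lemma add_weight_residue:
  assumes b: "b \<in> add_corners r \<mu>"
  shows "add_weight r \<nu> \<mu> b
    = - ((\<Prod>n\<in>zeros r \<nu> \<mu>. pole (Inr b) - zero n) / (\<Prod>y\<in>poles r \<nu> \<mu> - {Inr b}. pole (Inr b) - pole y))"
proof -
  have "poles r \<nu> \<mu> - {Inr b} = rem_corners r \<nu> <+> (add_corners r \<mu> - {b})"
    by (auto simp: poles_def)
  then have P: "(\<Prod>y\<in>poles r \<nu> \<mu> - {Inr b}. pole (Inr b) - pole y)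
      = (\<Prod>c\<in>rem_corners r \<nu>. \<chi>' b - m - \<chi> c) * (\<Prod>a\<in>add_corners r \<mu> - {b}. \<chi>' b - \<chi>' a)"
    using part by (simp add: prod.Plus finite_rem_corners finite_add_corners pole_def algebra_simps)
  have Z: "(\<Prod>n\<in>zeros r \<nu> \<mu>. pole (Inr b) - zero n)
    = (\<Prod>a\<in>add_corners r \<nu>. \<chi>' b - m - \<chi> a + t) * (\<Prod>c\<in>rem_corners r \<mu>. \<chi>' b - \<chi>' c - t)"
    unfolding prod_zeros
    by (intro arg_cong2[where f = "(*)"] prod.cong refl) (simp_all add: pole_def algebra_simps)
  have "add_weight r \<nu> \<mu> b = corner_fun r t1 t2 u \<nu> (\<chi>' b - m)
     * (t1 * t2 / t / corner_fun r t1 t2 u' (insert b \<mu>) (\<chi>' b - t))"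
    by (simp add: add_weight_def)
  then show ?thesis
    by (simp only: snd.residue_at_addable[OF part(2) b] P Z) (simp add: corner_fun_def)
qed

text \<open>The minus sign in \<open>middle_sum\<close> meets the one in
  \<open>add_weight_residue\<close>, so the difference is the sum of the residues of \<Phi> times
  \<open>g\<close> over all poles of \<Phi>.\<close>

lemma middle_sum_eq:
  "middle_sum r \<nu> \<mu> g = (\<Sum>x\<in>poles r \<nu> \<mu>.
     (\<Prod>n\<in>zeros r \<nu> \<mu>. pole x - zero n) / (\<Prod>y\<in>poles r \<nu> \<mu> - {x}. pole x - pole y) * g (pole x))"
proof -
  have "(\<Sum>x\<in>poles r \<nu> \<mu>. F x) = (\<Sum>b\<in>rem_corners r \<nu>. F (Inl b)) + (\<Sum>b\<in>add_corners r \<mu>. F (Inr b))"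
    for F :: "box + box \<Rightarrow> 'a"
    unfolding poles_def using part by (simp add: sum.Plus finite_rem_corners finite_add_corners)
  then show ?thesis
    unfolding middle_sum_def
    by (simp add: remove_weight_residue add_weight_residue sum_negf pole_def)
qed

text \<open>The corner sums are taken with the shift t for \<nu> and m for \<mu>. Then the removable
  corners contribute equally to poles and zeros, and only the parameters remain.\<close>

lemma sum_poles_zeros:
  "sum pole (poles r \<nu> \<mu>) - sum zero (zeros r \<nu> \<mu>) = of_nat r * (t - m) + (\<Sum>i<r. u' i - u i)"
proof -
  have 1: "sum zero (zeros r \<nu> \<mu>) = (\<Sum>b\<in>rem_corners r \<nu>. \<chi> b) + (\<Sum>i<r. u i - t) + (\<Sum>b\<in>rem_corners r \<mu>. \<chi>' b + t - m)"
    unfolding zeros_def using part corner_weights_sum[OF part(1), of t1 t2 u t]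
    by (simp add: sum.Plus finite_rem_corners finite_add_corners zero_def)
  have 2: "sum pole (poles r \<nu> \<mu>) = (\<Sum>b\<in>rem_corners r \<nu>. \<chi> b) + ((\<Sum>b\<in>rem_corners r \<mu>. \<chi>' b + t - m) + (\<Sum>i<r. u' i - m))"
    unfolding poles_def using part corner_weights_sum[OF part(2), of t1 t2 u' m]
    by (simp add: sum.Plus finite_rem_corners finite_add_corners pole_def)
  show ?thesis unfolding 1 2 by (simp add: sum_subtractf algebra_simps)
qed

lemma sum_squares_poles_zeros:
  "(\<Sum>x\<in>poles r \<nu> \<mu>. (pole x)\<^sup>2) - (\<Sum>n\<in>zeros r \<nu> \<mu>. (zero n)\<^sup>2)
    = 2 * t1 * t2 * (of_nat (card \<nu>) - of_nat (card \<mu>)) + (\<Sum>i<r. (u' i - m)\<^sup>2) - (\<Sum>i<r. (u i - t)\<^sup>2)"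
proof -
  have 1: "(\<Sum>n\<in>zeros r \<nu> \<mu>. (zero n)\<^sup>2) + 2 * t1 * t2 * of_nat (card \<nu>)
    = (\<Sum>b\<in>rem_corners r \<nu>. (\<chi> b)\<^sup>2) + (\<Sum>i<r. (u i - t)\<^sup>2) + (\<Sum>b\<in>rem_corners r \<mu>. (\<chi>' b + t - m)\<^sup>2)"
    unfolding zeros_def using part corner_weights_sum_squares[OF part(1), of t1 t2 u t]
    by (simp add: sum.Plus finite_rem_corners finite_add_corners zero_def algebra_simps)
  have 2: "(\<Sum>x\<in>poles r \<nu> \<mu>. (pole x)\<^sup>2) + 2 * t1 * t2 * of_nat (card \<mu>)
     = (\<Sum>b\<in>rem_corners r \<nu>. (\<chi> b)\<^sup>2) + ((\<Sum>b\<in>rem_corners r \<mu>. (\<chi>' b + t - m)\<^sup>2) + (\<Sum>i<r. (u' i - m)\<^sup>2))"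
    unfolding poles_def using part corner_weights_sum_squares[OF part(2), of t1 t2 u' m]
    by (simp add: sum.Plus finite_rem_corners finite_add_corners pole_def algebra_simps)
  have "P - Z = k * (a - b) + x - y" if "Z + k * a = R + y + S" "P + k * b = R + (S + x)"
    for P Z k a b x y R S :: 'a
  proof -
    have "Z = R + y + S - k * a" "P = R + (S + x) - k * b" using that by (auto simp: algebra_simps)
    then show ?thesis by (simp add: algebra_simps)
  qed
  from this[OF 1 2] show ?thesis .
qed

lemma middle_sum_one: "middle_sum r \<nu> \<mu> (\<lambda>z. 1) = \<phi> r"
  using res_sum_eq(3)[OF finite_poles inj_pole finite_zeros fst.t_nonzero(4) card_poles]
  by (simp add: middle_sum_eq res_sum_def sum_poles_zeros)

lemma middle_sum_id:
  "middle_sum r \<nu> \<mu> (\<lambda>z. z) = ((\<phi> r)\<^sup>2 + 2 * t1 * t2 * (of_nat (card \<nu>) - of_nat (card \<mu>))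
     + (\<Sum>i<r. (u' i - m)\<^sup>2) - (\<Sum>i<r. (u i - t)\<^sup>2)) / 2"
proof -
  \<comment> \<open>The extra index \<open>None\<close> is a zero at 0; its factor is the
    \<open>z\<close> under the sum.\<close>
  let ?J = "insert None (Some ` zeros r \<nu> \<mu>)" and ?w = "case_option 0 zero"
  have None: "None \<notin> Some ` zeros r \<nu> \<mu>" by auto
  have card: "card ?J = card (poles r \<nu> \<mu>) + 1"
    using finite_zeros card_poles None by (simp add: card_image)
  have p: "(\<Prod>n\<in>?J. z - ?w n) = z * (\<Prod>n\<in>zeros r \<nu> \<mu>. z - zero n)" for z
    using finite_zeros None by (simp add: prod.reindex)
  have s: "(\<Sum>n\<in>?J. ?w n) = sum zero (zeros r \<nu> \<mu>)" "(\<Sum>n\<in>?J. (?w n)\<^sup>2) = (\<Sum>n\<in>zeros r \<nu> \<mu>. (zero n)\<^sup>2)"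
    using finite_zeros None by (simp_all add: sum.reindex)
  have "middle_sum r \<nu> \<mu> (\<lambda>z. z) = res_sum ?w ?J pole (poles r \<nu> \<mu>)"
    unfolding middle_sum_eq res_sum_def p by (simp add: mult.commute)
  also have "\<dots> = ((sum pole (poles r \<nu> \<mu>) - sum zero (zeros r \<nu> \<mu>))\<^sup>2
      + ((\<Sum>x\<in>poles r \<nu> \<mu>. (pole x)\<^sup>2) - (\<Sum>n\<in>zeros r \<nu> \<mu>. (zero n)\<^sup>2))) / 2"
  proof -
    have "finite ?J" using finite_zeros by simp
    from res_sum_eq(4)[OF finite_poles inj_pole this fst.t_nonzero(4) card, of ?w]
    show ?thesis unfolding s add_diff_eq .
  qed
  finally show ?thesis unfolding sum_poles_zeros sum_squares_poles_zeros by (simp add: algebra_simps)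
qed

text \<open>Dividing by \<open>z - zero n\<close> strikes one factor from the numerator, whose
  degree is then one below that of the denominator; hence the residue sum 1. The second sum follows
  from \<open>z / (z - w) = 1 + w / (z - w)\<close>.\<close>

lemma middle_sum_drop_one_zero:
  assumes n: "n \<in> zeros r \<nu> \<mu>"
  shows "middle_sum r \<nu> \<mu> (\<lambda>z. 1 / (z - zero n)) = 1"
    and "middle_sum r \<nu> \<mu> (\<lambda>z. z / (z - zero n)) = \<phi> r + zero n"
proof -
  let ?Z = "zeros r \<nu> \<mu> - {n}"
  have p: "(\<Prod>k\<in>zeros r \<nu> \<mu>. z - zero k) = (z - zero n) * (\<Prod>k\<in>?Z. z - zero k)" for z
    using finite_zeros n by (rule prod.remove)
  have card: "card ?Z + 1 = card (poles r \<nu> \<mu>)"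
    using card.remove[OF finite_zeros n] card_poles by simp
  have ne: "pole x - zero n \<noteq> 0" if "x \<in> poles r \<nu> \<mu>" for x using pole_neq_zero[OF that n] by simp
  have one: "middle_sum r \<nu> \<mu> (\<lambda>z. 1 / (z - zero n)) = res_sum zero ?Z pole (poles r \<nu> \<mu>)"
    unfolding middle_sum_eq res_sum_def p using ne by (intro sum.cong refl) simp
  then show e1: "middle_sum r \<nu> \<mu> (\<lambda>z. 1 / (z - zero n)) = 1"
    using res_sum_eq(2)[OF finite_poles inj_pole _ fst.t_nonzero(4) card] finite_zeros by simp
  have "middle_sum r \<nu> \<mu> (\<lambda>z. z / (z - zero n))
      = middle_sum r \<nu> \<mu> (\<lambda>z. 1) + zero n * middle_sum r \<nu> \<mu> (\<lambda>z. 1 / (z - zero n))"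
    unfolding middle_sum_eq sum_distrib_left sum.distrib[symmetric]
  proof (intro sum.cong refl)
    fix x assume "x \<in> poles r \<nu> \<mu>"
    have "F * (z / (z - c)) = F * 1 + c * (F * (1 / (z - c)))" if "z - c \<noteq> 0" for F z c :: 'a
      using that by (simp add: field_simps)
    then show "(\<Prod>n\<in>zeros r \<nu> \<mu>. pole x - zero n) / (\<Prod>y\<in>poles r \<nu> \<mu> - {x}. pole x - pole y) * (pole x / (pole x - zero n))
      = (\<Prod>n\<in>zeros r \<nu> \<mu>. pole x - zero n) / (\<Prod>y\<in>poles r \<nu> \<mu> - {x}. pole x - pole y) * 1
      + zero n * ((\<Prod>n\<in>zeros r \<nu> \<mu>. pole x - zero n) / (\<Prod>y\<in>poles r \<nu> \<mu> - {x}. pole x - pole y) * (1 / (pole x - zero n)))"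
      using ne[OF \<open>x \<in> poles r \<nu> \<mu>\<close>] by blast
  qed
  then show "middle_sum r \<nu> \<mu> (\<lambda>z. z / (z - zero n)) = \<phi> r + zero n"
    unfolding e1 middle_sum_one by simp
qed

text \<open>With two factors struck out the function decays like \<open>1 / z^2\<close> and has no
  residue at infinity.\<close>

lemma middle_sum_drop_two_zeros:
  assumes n: "n \<in> zeros r \<nu> \<mu>" "n' \<in> zeros r \<nu> \<mu>" "n \<noteq> n'"
  shows "middle_sum r \<nu> \<mu> (\<lambda>z. 1 / ((z - zero n) * (z - zero n'))) = 0"
proof -
  let ?Z = "zeros r \<nu> \<mu> - {n} - {n'}"
  have p: "(\<Prod>k\<in>zeros r \<nu> \<mu>. z - zero k) = (z - zero n) * ((z - zero n') * (\<Prod>k\<in>?Z. z - zero k))" for z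
    using finite_zeros n by (simp add: prod.remove[of _ n] prod.remove[of _ n'])
  have card: "card ?Z + 2 \<le> card (poles r \<nu> \<mu>)"
    using card.remove[OF finite_zeros n(1)] card.remove[of "zeros r \<nu> \<mu> - {n}" n'] finite_zeros n card_poles
    by simp
  have ne: "pole x - zero n \<noteq> 0" "pole x - zero n' \<noteq> 0" if "x \<in> poles r \<nu> \<mu>" for x
    using pole_neq_zero[OF that] n by auto
  have "middle_sum r \<nu> \<mu> (\<lambda>z. 1 / ((z - zero n) * (z - zero n'))) = res_sum zero ?Z pole (poles r \<nu> \<mu>)"
    unfolding middle_sum_eq res_sum_def p using ne by (intro sum.cong refl) simp
  then show ?thesis
    using res_sum_eq(1)[OF finite_poles inj_pole _ fst.t_nonzero(4) card] finite_zeros by simp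
qed

end

end

section \<open>Chains of partitions\<close>

fun rem_chain :: "nat \<Rightarrow> box set \<Rightarrow> box list \<Rightarrow> bool" where
  "rem_chain r \<nu> [] \<longleftrightarrow> \<nu> \<in> rpartitions r"
| "rem_chain r \<nu> (b # bs) \<longleftrightarrow> \<nu> \<in> rpartitions r \<and> b \<in> rem_corners r \<nu> \<and> rem_chain r (\<nu> - {b}) bs"

fun add_chain :: "nat \<Rightarrow> box set \<Rightarrow> box list \<Rightarrow> bool" where
  "add_chain r \<nu> [] \<longleftrightarrow> \<nu> \<in> rpartitions r"
| "add_chain r \<nu> (b # bs) \<longleftrightarrow> \<nu> \<in> rpartitions r \<and> b \<in> add_corners r \<nu> \<and> add_chain r (insert b \<nu>) bs"

definition rem_chains :: "nat \<Rightarrow> nat \<Rightarrow> box set \<Rightarrow> box list set" where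
  "rem_chains r k \<nu> = {bs. length bs = k \<and> rem_chain r \<nu> bs}"

definition add_chains :: "nat \<Rightarrow> nat \<Rightarrow> box set \<Rightarrow> box list set" where
  "add_chains r k \<nu> = {bs. length bs = k \<and> add_chain r \<nu> bs}"

fun rem_prod :: "(box set \<Rightarrow> box \<Rightarrow> 'a::comm_monoid_mult) \<Rightarrow> box set \<Rightarrow> box list \<Rightarrow> 'a" where
  "rem_prod s \<nu> [] = 1"
| "rem_prod s \<nu> (b # bs) = s \<nu> b * rem_prod s (\<nu> - {b}) bs"

text \<open>The step factor is taken at the larger of the two shapes, as in \<open>rem_prod\<close>,
  so that reversing a chain preserves the product.\<close>

fun add_prod :: "(box set \<Rightarrow> box \<Rightarrow> 'a::comm_monoid_mult) \<Rightarrow> box set \<Rightarrow> box list \<Rightarrow> 'a" where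
  "add_prod s \<nu> [] = 1"
| "add_prod s \<nu> (b # bs) = s (insert b \<nu>) b * add_prod s (insert b \<nu>) bs"

lemma rem_chainD:
  "rem_chain r \<nu> bs \<Longrightarrow> \<nu> \<in> rpartitions r \<and> \<nu> - set bs \<in> rpartitions r \<and> set bs \<subseteq> \<nu> \<and> distinct bs"
proof (induction bs arbitrary: \<nu>)
  case (Cons b bs)
  have "\<nu> - {b} - set bs = \<nu> - set (b # bs)" by auto
  then show ?case using Cons.prems Cons.IH[of "\<nu> - {b}"] corner_remove(2)[of b r \<nu>] by auto
qed simp

lemma add_chainD:
  "add_chain r \<nu> bs \<Longrightarrow> \<nu> \<in> rpartitions r \<and> \<nu> \<union> set bs \<in> rpartitions r \<and> set bs \<inter> \<nu> = {} \<and> distinct bs"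
proof (induction bs arbitrary: \<nu>)
  case (Cons b bs)
  have "insert b \<nu> \<union> set bs = \<nu> \<union> set (b # bs)" by auto
  then show ?case using Cons.prems Cons.IH[of "insert b \<nu>"] corner_insert(2)[of b r \<nu>] by auto
qed simp

text \<open>Chains grow at their end because in the mixed sums the variable that changes sides sits
  between the last removed and the last added box.\<close>

lemma rem_chain_snoc:
  "rem_chain r \<nu> (bs @ [b]) \<longleftrightarrow> rem_chain r \<nu> bs \<and> b \<in> rem_corners r (\<nu> - set bs)"
proof (induction bs arbitrary: \<nu>)
  case Nil
  show ?case using corner_remove(1)[of b r \<nu>] by auto
next
  case (Cons a bs)
  have "\<nu> - {a} - set bs = \<nu> - set (a # bs)" by auto
  then show ?case using Cons by auto
qed

lemma add_chain_snoc:
  "add_chain r \<nu> (bs @ [b]) \<longleftrightarrow> add_chain r \<nu> bs \<and> b \<in> add_corners r (\<nu> \<union> set bs)"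
proof (induction bs arbitrary: \<nu>)
  case Nil
  show ?case using corner_insert(1)[of b r \<nu>] by auto
qed auto

lemma rem_prod_snoc: "rem_prod s \<nu> (bs @ [b]) = rem_prod s \<nu> bs * s (\<nu> - set bs) b"
proof (induction bs arbitrary: \<nu>)
  case (Cons a bs)
  have "\<nu> - {a} - set bs = \<nu> - set (a # bs)" by auto
  then show ?case using Cons by (simp add: ac_simps)
qed simp

lemma add_prod_snoc: "add_prod s \<nu> (bs @ [b]) = add_prod s \<nu> bs * s (insert b (\<nu> \<union> set bs)) b"
  by (induction bs arbitrary: \<nu>) (simp_all add: ac_simps)

lemma rem_chains_0: "\<nu> \<in> rpartitions r \<Longrightarrow> rem_chains r 0 \<nu> = {[]}"
  by (auto simp: rem_chains_def)

lemma add_chains_0: "\<nu> \<in> rpartitions r \<Longrightarrow> add_chains r 0 \<nu> = {[]}"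
  by (auto simp: add_chains_def)

lemma length_Suc_snoc: "length bs = Suc k \<longleftrightarrow> (\<exists>as b. bs = as @ [b] \<and> length as = k)"
  by (cases bs rule: rev_cases) auto

lemma rem_chains_Suc:
  "rem_chains r (Suc k) \<nu> = (\<lambda>(bs, b). bs @ [b]) ` (SIGMA bs:rem_chains r k \<nu>. rem_corners r (\<nu> - set bs))"
  unfolding rem_chains_def length_Suc_snoc by (force simp: rem_chain_snoc)

lemma add_chains_Suc:
  "add_chains r (Suc k) \<nu> = (\<lambda>(bs, b). bs @ [b]) ` (SIGMA bs:add_chains r k \<nu>. add_corners r (\<nu> \<union> set bs))"
  unfolding add_chains_def length_Suc_snoc by (force simp: add_chain_snoc)

lemma finite_rem_chains: "finite (rem_chains r k \<nu>)"
proof (induction k)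
  case 0
  have "rem_chains r 0 \<nu> \<subseteq> {[]}" by (auto simp: rem_chains_def)
  then show ?case by (rule finite_subset) simp
next
  case (Suc k)
  have "finite (rem_corners r (\<nu> - set bs))" if "bs \<in> rem_chains r k \<nu>" for bs
    using that rem_chainD[of r \<nu> bs] by (intro finite_rem_corners) (auto simp: rem_chains_def)
  with Suc show ?case unfolding rem_chains_Suc by (intro finite_imageI finite_SigmaI) auto
qed

lemma finite_add_chains: "finite (add_chains r k \<nu>)"
proof (induction k)
  case 0
  have "add_chains r 0 \<nu> \<subseteq> {[]}" by (auto simp: add_chains_def)
  then show ?case by (rule finite_subset) simp
next
  case (Suc k)
  have "finite (add_corners r (\<nu> \<union> set bs))" if "bs \<in> add_chains r k \<nu>" for bs
    using that add_chainD[of r \<nu> bs] by (intro finite_add_corners) (auto simp: add_chains_def)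
  with Suc show ?case unfolding add_chains_Suc by (intro finite_imageI finite_SigmaI) auto
qed

lemma sum_rem_chains_Suc:
  "(\<Sum>bs\<in>rem_chains r (Suc k) \<nu>. F bs) = (\<Sum>bs\<in>rem_chains r k \<nu>. \<Sum>b\<in>rem_corners r (\<nu> - set bs). F (bs @ [b]))"
proof -
  have "finite (rem_corners r (\<nu> - set bs))" if "bs \<in> rem_chains r k \<nu>" for bs
    using that rem_chainD[of r \<nu> bs] by (intro finite_rem_corners) (auto simp: rem_chains_def)
  moreover have "inj_on (\<lambda>(bs, b). bs @ [b]) A" for A :: "(box list \<times> box) set"
    by (auto simp: inj_on_def)
  ultimately show ?thesis
    unfolding rem_chains_Suc
    by (subst sum.reindex) (auto simp: sum.Sigma finite_rem_chains case_prod_unfold)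
qed

lemma sum_add_chains_Suc:
  "(\<Sum>bs\<in>add_chains r (Suc k) \<nu>. F bs) = (\<Sum>bs\<in>add_chains r k \<nu>. \<Sum>b\<in>add_corners r (\<nu> \<union> set bs). F (bs @ [b]))"
proof -
  have "finite (add_corners r (\<nu> \<union> set bs))" if "bs \<in> add_chains r k \<nu>" for bs
    using that add_chainD[of r \<nu> bs] by (intro finite_add_corners) (auto simp: add_chains_def)
  moreover have "inj_on (\<lambda>(bs, b). bs @ [b]) A" for A :: "(box list \<times> box) set"
    by (auto simp: inj_on_def)
  ultimately show ?thesis
    unfolding add_chains_Suc
    by (subst sum.reindex) (auto simp: sum.Sigma finite_add_chains case_prod_unfold)
qed

text \<open>Supplies the zero of \<Phi> that cancels the gap between the last removed box and the
  next variable; \<open>last_add_chain\<close> does so on the other side.\<close>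

lemma last_rem_chain:
  assumes "rem_chain r \<nu> bs" "bs \<noteq> []"
  shows "last bs \<in> add_corners r (\<nu> - set bs)"
proof -
  obtain as b where [simp]: "bs = as @ [b]" using assms(2) by (cases bs rule: rev_cases) auto
  have "rem_chain r \<nu> as" "b \<in> rem_corners r (\<nu> - set as)"
    using assms(1) by (simp_all add: rem_chain_snoc)
  then have "b \<in> add_corners r (\<nu> - set as - {b})"
    using rem_chainD by (intro corner_remove_add) auto
  moreover have "\<nu> - set as - {b} = \<nu> - set bs" by auto
  ultimately show ?thesis by simp
qed

lemma last_add_chain:
  assumes "add_chain r \<nu> bs" "bs \<noteq> []"
  shows "last bs \<in> rem_corners r (\<nu> \<union> set bs)"
proof -
  obtain as b where [simp]: "bs = as @ [b]" using assms(2) by (cases bs rule: rev_cases) auto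
  have "add_chain r \<nu> as" "b \<in> add_corners r (\<nu> \<union> set as)"
    using assms(1) by (simp_all add: add_chain_snoc)
  then have "b \<in> rem_corners r (insert b (\<nu> \<union> set as))"
    using add_chainD by (intro corner_insert_rem) auto
  then show ?thesis by simp
qed

section \<open>Gap denominators and mixed residue sums for an abstract kernel\<close>

fun gaps :: "'a::field \<Rightarrow> 'a list \<Rightarrow> 'a" where
  "gaps t (x # y # zs) = (y - x + t) * gaps t (y # zs)"
| "gaps t zs = 1"

lemma gaps_Cons: "zs \<noteq> [] \<Longrightarrow> gaps t (z # zs) = (hd zs - z + t) * gaps t zs"
  by (cases zs) auto

lemma gaps_snoc: "zs \<noteq> [] \<Longrightarrow> gaps t (zs @ [z]) = gaps t zs * (z - last zs + t)"
  by (induction t zs rule: gaps.induct) (auto simp: mult.assoc)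

lemma gaps_append: "xs \<noteq> [] \<Longrightarrow> ys \<noteq> [] \<Longrightarrow> gaps t (xs @ ys) = gaps t xs * (hd ys - last xs + t) * gaps t ys"
  by (induction t xs rule: gaps.induct) (auto simp: mult.assoc gaps_Cons)

lemma gaps_shift: "gaps t (map (\<lambda>z. z - c) zs) = gaps t zs"
  by (induction t zs rule: gaps.induct) auto

text \<open>The sum \<open>z_1 + z_k\<close> in the polynomial of the L operators; a one-element
  list counts its element twice.\<close>

definition ends :: "'a::field list \<Rightarrow> 'a" where
  "ends zs = hd zs + last zs"

text \<open>Isolates what the argument uses of the coefficients \<open>K\<close> of A and of the
  step factors \<open>s\<close>, \<open>s'\<close>: moving one box multiplies \<open>K\<close> by a
  residue of \<Phi> up to sign.\<close>

locale kernel = generic_pair t1 t2 u u' m for t1 t2 :: "'a::field" and u u' m +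
  fixes r :: nat and K :: "box set \<Rightarrow> box set \<Rightarrow> 'a" and s s' :: "box set \<Rightarrow> box \<Rightarrow> 'a"
  assumes K_remove: "\<nu> \<in> rpartitions r \<Longrightarrow> \<mu> \<in> rpartitions r \<Longrightarrow> b \<in> rem_corners r \<nu> \<Longrightarrow>
      K (\<nu> - {b}) \<mu> * s \<nu> b = K \<nu> \<mu> * remove_weight r \<nu> \<mu> b"
    and K_add: "\<nu> \<in> rpartitions r \<Longrightarrow> \<mu> \<in> rpartitions r \<Longrightarrow> b \<in> add_corners r \<mu> \<Longrightarrow>
      K \<nu> (insert b \<mu>) * s' (insert b \<mu>) b = K \<nu> \<mu> * add_weight r \<nu> \<mu> b"
begin

text \<open>The added boxes come in reverse since a tableau lists them in the order of removal from
  the larger shape. The shift by m moves their weights to the poles of \<Phi>.\<close>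

definition chain_weights :: "box list \<Rightarrow> box list \<Rightarrow> 'a list" where
  "chain_weights as bs = map \<chi> as @ rev (map (\<lambda>b. \<chi>' b - m) bs)"

definition chain_coeff :: "box set \<Rightarrow> box set \<Rightarrow> box list \<Rightarrow> box list \<Rightarrow> 'a" where
  "chain_coeff \<nu> \<mu> as bs = K (\<nu> - set as) (\<mu> \<union> set bs) * rem_prod s \<nu> as * add_prod s' \<mu> bs"

text \<open>The sum over the residues where the first \<open>j\<close> variables are at the poles coming from \<open>\<nu>\<close>
  and the last \<open>l\<close> ones at those coming from \<open>\<mu>\<close>.\<close>

definition mixed_sum :: "box set \<Rightarrow> box set \<Rightarrow> nat \<Rightarrow> nat \<Rightarrow> ('a list \<Rightarrow> 'a) \<Rightarrow> 'a" where
  "mixed_sum \<nu> \<mu> j l P = (\<Sum>as\<in>rem_chains r j \<nu>. \<Sum>bs\<in>add_chains r l \<mu>.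
     chain_coeff \<nu> \<mu> as bs * (P (chain_weights as bs) / gaps t (chain_weights as bs)))"

text \<open>Only the variable between the first \<open>j\<close> and the last \<open>l\<close>
  changes sides. By \<open>K_remove\<close> and \<open>K_add\<close> both terms carry the same
  coefficient of the other variables, and what is left is the sum over all poles of \<Phi> in the
  moving one.\<close>

lemma mixed_sum_step:
  "mixed_sum \<nu> \<mu> (Suc j) l P - mixed_sum \<nu> \<mu> j (Suc l) P
    = (\<Sum>as\<in>rem_chains r j \<nu>. \<Sum>bs\<in>add_chains r l \<mu>. chain_coeff \<nu> \<mu> as bs
       * middle_sum r (\<nu> - set as) (\<mu> \<union> set bs)
           (\<lambda>z. P (map \<chi> as @ z # rev (map (\<lambda>b. \<chi>' b - m) bs))
             / gaps t (map \<chi> as @ z # rev (map (\<lambda>b. \<chi>' b - m) bs))))"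
proof -
  let ?H = "\<lambda>as bs z. P (map \<chi> as @ z # rev (map (\<lambda>b. \<chi>' b - m) bs))
             / gaps t (map \<chi> as @ z # rev (map (\<lambda>b. \<chi>' b - m) bs))"
  have 1: "mixed_sum \<nu> \<mu> (Suc j) l P = (\<Sum>as\<in>rem_chains r j \<nu>. \<Sum>bs\<in>add_chains r l \<mu>.
      \<Sum>b\<in>rem_corners r (\<nu> - set as). chain_coeff \<nu> \<mu> as bs
        * (remove_weight r (\<nu> - set as) (\<mu> \<union> set bs) b * ?H as bs (\<chi> b)))"
    unfolding mixed_sum_def sum_rem_chains_Suc
  proof (intro sum.cong refl, subst sum.swap, intro sum.cong refl)
    fix as bs b
    assume A: "as \<in> rem_chains r j \<nu>" "bs \<in> add_chains r l \<mu>" "b \<in> rem_corners r (\<nu> - set as)"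
    have p: "\<nu> - set as \<in> rpartitions r" "\<mu> \<union> set bs \<in> rpartitions r"
      using A rem_chainD[of r \<nu> as] add_chainD[of r \<mu> bs] by (auto simp: rem_chains_def add_chains_def)
    have "\<nu> - set (as @ [b]) = \<nu> - set as - {b}" by auto
    then have "chain_coeff \<nu> \<mu> (as @ [b]) bs
        = (K (\<nu> - set as - {b}) (\<mu> \<union> set bs) * s (\<nu> - set as) b) * (rem_prod s \<nu> as * add_prod s' \<mu> bs)"
      by (simp add: chain_coeff_def rem_prod_snoc ac_simps)
    also have "\<dots> = chain_coeff \<nu> \<mu> as bs * remove_weight r (\<nu> - set as) (\<mu> \<union> set bs) b"
      unfolding K_remove[OF p A(3)] by (simp add: chain_coeff_def ac_simps)
    finally show "chain_coeff \<nu> \<mu> (as @ [b]) bs * (P (chain_weights (as @ [b]) bs) / gaps t (chain_weights (as @ [b]) bs))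
       = chain_coeff \<nu> \<mu> as bs * (remove_weight r (\<nu> - set as) (\<mu> \<union> set bs) b * ?H as bs (\<chi> b))"
      by (simp add: chain_weights_def mult.assoc)
  qed
  have 2: "mixed_sum \<nu> \<mu> j (Suc l) P = (\<Sum>as\<in>rem_chains r j \<nu>. \<Sum>bs\<in>add_chains r l \<mu>.
      \<Sum>b\<in>add_corners r (\<mu> \<union> set bs). chain_coeff \<nu> \<mu> as bs
        * (add_weight r (\<nu> - set as) (\<mu> \<union> set bs) b * ?H as bs (\<chi>' b - m)))"
    unfolding mixed_sum_def sum_add_chains_Suc
  proof (intro sum.cong refl)
    fix as bs b
    assume A: "as \<in> rem_chains r j \<nu>" "bs \<in> add_chains r l \<mu>" "b \<in> add_corners r (\<mu> \<union> set bs)"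
    have p: "\<nu> - set as \<in> rpartitions r" "\<mu> \<union> set bs \<in> rpartitions r"
      using A rem_chainD[of r \<nu> as] add_chainD[of r \<mu> bs] by (auto simp: rem_chains_def add_chains_def)
    have "chain_coeff \<nu> \<mu> as (bs @ [b])
        = (K (\<nu> - set as) (insert b (\<mu> \<union> set bs)) * s' (insert b (\<mu> \<union> set bs)) b) * (rem_prod s \<nu> as * add_prod s' \<mu> bs)"
      by (simp add: chain_coeff_def add_prod_snoc ac_simps)
    also have "\<dots> = chain_coeff \<nu> \<mu> as bs * add_weight r (\<nu> - set as) (\<mu> \<union> set bs) b"
      unfolding K_add[OF p A(3)] by (simp add: chain_coeff_def ac_simps)
    finally show "chain_coeff \<nu> \<mu> as (bs @ [b]) * (P (chain_weights as (bs @ [b])) / gaps t (chain_weights as (bs @ [b])))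
       = chain_coeff \<nu> \<mu> as bs * (add_weight r (\<nu> - set as) (\<mu> \<union> set bs) b * ?H as bs (\<chi>' b - m))"
      by (simp add: chain_weights_def mult.assoc)
  qed
  show ?thesis
    unfolding 1 2 middle_sum_def sum_subtractf[symmetric] right_diff_distrib sum_distrib_left ..
qed

lemma middle_sum_cmult: "middle_sum r \<nu> \<mu> (\<lambda>z. c * g z) = c * middle_sum r \<nu> \<mu> g"
  by (simp add: middle_sum_def sum_distrib_left right_diff_distrib ac_simps)

lemma middle_sum_add: "middle_sum r \<nu> \<mu> (\<lambda>z. g z + h z) = middle_sum r \<nu> \<mu> g + middle_sum r \<nu> \<mu> h"
  by (simp add: middle_sum_def sum.distrib algebra_simps)

context
  fixes \<nu> \<mu> as bs
  assumes as: "rem_chain r \<nu> as" and bs: "add_chain r \<mu> bs"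
begin

lemma chain_ends: "\<nu> - set as \<in> rpartitions r" "\<mu> \<union> set bs \<in> rpartitions r"
  using as bs rem_chainD add_chainD by blast+

text \<open>The only gap of \<open>z\<close> cancels the zero at
  \<open>\<chi> (last as) - t\<close>. With \<open>ends\<close>, the last variable contributes
  \<open>\<phi> r\<close> plus that zero, which is \<open>\<chi> (last as)\<close> with the
  correction \<open>\<phi> r - t\<close>.\<close>

lemma middle_sum_right_end:
  assumes "as \<noteq> []" "P = (\<lambda>z. 1) \<and> c = 1 \<or> P = (\<lambda>z. \<chi> (hd as) + z) \<and> c = \<chi> (hd as) + \<chi> (last as) + (\<phi> r - t)"
  shows "middle_sum r (\<nu> - set as) (\<mu> \<union> set bs) (\<lambda>z. P z / gaps t (map \<chi> as @ [z])) = c / gaps t (map \<chi> as)"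
proof -
  let ?n = "Inl (last as) :: box + box"
  have n: "?n \<in> zeros r (\<nu> - set as) (\<mu> \<union> set bs)"
    using last_rem_chain[OF as assms(1)] by (simp add: zeros_def InlI InrI)
  note M = middle_sum_drop_one_zero[OF chain_ends n]
  have g: "P z / gaps t (map \<chi> as @ [z]) = (1 / gaps t (map \<chi> as)) * (P z / (z - zero ?n))" for z
    using assms(1) by (simp add: gaps_snoc last_map zero_def algebra_simps)
  from assms(2) have "middle_sum r (\<nu> - set as) (\<mu> \<union> set bs) (\<lambda>z. P z / (z - zero ?n)) = c"
  proof
    assume "P = (\<lambda>z. 1) \<and> c = 1" then show ?thesis using M(1) by simp
  next
    assume A: "P = (\<lambda>z. \<chi> (hd as) + z) \<and> c = \<chi> (hd as) + \<chi> (last as) + (\<phi> r - t)"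
    have "(\<lambda>z. P z / (z - zero ?n)) = (\<lambda>z. \<chi> (hd as) * (1 / (z - zero ?n)) + z / (z - zero ?n))"
      using A by (simp add: add_divide_distrib)
    then have "middle_sum r (\<nu> - set as) (\<mu> \<union> set bs) (\<lambda>z. P z / (z - zero ?n))
        = \<chi> (hd as) + (\<phi> r + zero ?n)"
      by (simp only: middle_sum_add middle_sum_cmult M mult_1_right)
    also have "\<dots> = c" using A by (simp add: zero_def algebra_simps)
    finally show ?thesis .
  qed
  then show ?thesis unfolding g middle_sum_cmult by simp
qed

text \<open>Here \<open>z\<close> enters its only gap with a minus sign, hence the sign of the
  result. The cancelled zero is \<open>hd bs' + t\<close>, which makes the correction
  \<open>\<phi> r + t\<close>.\<close>

lemma middle_sum_left_end:
  fixes bs' defines "bs' \<equiv> rev (map (\<lambda>b. \<chi>' b - m) bs)"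
  assumes "bs \<noteq> []" "P = (\<lambda>z. 1) \<and> c = 1 \<or> P = (\<lambda>z. z + last bs') \<and> c = hd bs' + last bs' + (\<phi> r + t)"
  shows "middle_sum r (\<nu> - set as) (\<mu> \<union> set bs) (\<lambda>z. P z / gaps t (z # bs')) = - (c / gaps t bs')"
proof -
  let ?n = "Inr (last bs) :: box + box"
  have n: "?n \<in> zeros r (\<nu> - set as) (\<mu> \<union> set bs)"
    using last_add_chain[OF bs assms(2)] by (simp add: zeros_def InlI InrI)
  note M = middle_sum_drop_one_zero[OF chain_ends n]
  have hd: "hd bs' = zero ?n - t" and ne: "bs' \<noteq> []"
    using assms(2) by (simp_all add: bs'_def hd_rev last_map zero_def)
  have hz: "hd bs' - z + t = - (z - zero ?n)" for z by (simp add: hd)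
  have g: "P z / gaps t (z # bs') = - (1 / gaps t bs') * (P z / (z - zero ?n))" for z
    by (simp only: gaps_Cons[OF ne] hz) (simp add: mult.commute del: minus_diff_eq)
  from assms(3) have "middle_sum r (\<nu> - set as) (\<mu> \<union> set bs) (\<lambda>z. P z / (z - zero ?n)) = c"
  proof
    assume "P = (\<lambda>z. 1) \<and> c = 1" then show ?thesis using M(1) by simp
  next
    assume A: "P = (\<lambda>z. z + last bs') \<and> c = hd bs' + last bs' + (\<phi> r + t)"
    have "(\<lambda>z. P z / (z - zero ?n)) = (\<lambda>z. last bs' * (1 / (z - zero ?n)) + z / (z - zero ?n))"
      using A by (simp add: add_divide_distrib add.commute)
    then have "middle_sum r (\<nu> - set as) (\<mu> \<union> set bs) (\<lambda>z. P z / (z - zero ?n)) = last bs' + (\<phi> r + zero ?n)"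
      by (simp only: middle_sum_add middle_sum_cmult M mult_1_right)
    also have "\<dots> = c" using A hd by (simp add: algebra_simps)
    finally show ?thesis .
  qed
  then show ?thesis unfolding g middle_sum_cmult by simp
qed

text \<open>Between two neighbours the gaps cancel two distinct zeros, so nothing remains at
  infinity. A constant numerator suffices because \<open>ends\<close> does not see an inner
  variable.\<close>

lemma middle_sum_inner:
  fixes bs' defines "bs' \<equiv> rev (map (\<lambda>b. \<chi>' b - m) bs)"
  assumes "as \<noteq> []" "bs \<noteq> []"
  shows "middle_sum r (\<nu> - set as) (\<mu> \<union> set bs) (\<lambda>z. c / gaps t (map \<chi> as @ z # bs')) = 0"
proof -
  let ?n = "Inl (last as) :: box + box" and ?n' = "Inr (last bs) :: box + box"
  have n: "?n \<in> zeros r (\<nu> - set as) (\<mu> \<union> set bs)" "?n' \<in> zeros r (\<nu> - set as) (\<mu> \<union> set bs)"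
    using last_rem_chain[OF as assms(2)] last_add_chain[OF bs assms(3)] by (simp_all add: zeros_def InlI InrI)
  have hd: "hd bs' = zero ?n' - t" and ne: "bs' \<noteq> []"
    using assms(3) by (simp_all add: bs'_def hd_rev last_map zero_def)
  have l: "last (map \<chi> as) = zero ?n + t" and ne': "map \<chi> as \<noteq> []"
    using assms(2) by (simp_all add: last_map zero_def)
  have "gaps t (map \<chi> as @ z # bs') = - (gaps t (map \<chi> as) * gaps t bs' * ((z - zero ?n) * (z - zero ?n')))" for z
    using ne ne' by (simp add: gaps_append gaps_Cons hd l del: map_is_Nil_conv) (simp add: algebra_simps)
  then have g: "c / gaps t (map \<chi> as @ z # bs')
      = - (c / (gaps t (map \<chi> as) * gaps t bs')) * (1 / ((z - zero ?n) * (z - zero ?n')))" for z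
    by simp
  show ?thesis
    unfolding g middle_sum_cmult middle_sum_drop_two_zeros[OF chain_ends n sum.distinct(1)] by simp
qed

end

context
  fixes \<nu> \<mu> assumes part: "\<nu> \<in> rpartitions r" "\<mu> \<in> rpartitions r"
begin

lemma mixed_sum_right_end:
  assumes "k > 0"
  shows "mixed_sum \<nu> \<mu> (Suc k) 0 (\<lambda>_. 1) - mixed_sum \<nu> \<mu> k 1 (\<lambda>_. 1) = mixed_sum \<nu> \<mu> k 0 (\<lambda>_. 1)"
    and "mixed_sum \<nu> \<mu> (Suc k) 0 ends - mixed_sum \<nu> \<mu> k 1 ends
      = mixed_sum \<nu> \<mu> k 0 ends + (\<phi> r - t) * mixed_sum \<nu> \<mu> k 0 (\<lambda>_. 1)"
proof -
  have ne: "rem_chain r \<nu> as" "as \<noteq> []" if "as \<in> rem_chains r k \<nu>" for as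
    using that assms by (auto simp: rem_chains_def)
  have nil: "add_chain r \<mu> []" using part by simp
  show "mixed_sum \<nu> \<mu> (Suc k) 0 (\<lambda>_. 1) - mixed_sum \<nu> \<mu> k 1 (\<lambda>_. 1) = mixed_sum \<nu> \<mu> k 0 (\<lambda>_. 1)"
    unfolding One_nat_def mixed_sum_step unfolding mixed_sum_def add_chains_0[OF part(2)]
    using middle_sum_right_end[OF ne(1) nil ne(2), of _ "\<lambda>z. 1" 1]
    by (intro sum.cong refl) (simp add: chain_weights_def)
  have e: "ends (map \<chi> as @ [z]) = \<chi> (hd as) + z" "ends (map \<chi> as) = \<chi> (hd as) + \<chi> (last as)"
    if "as \<noteq> []" for as z
    using that by (simp_all add: ends_def hd_map last_map)
  show "mixed_sum \<nu> \<mu> (Suc k) 0 ends - mixed_sum \<nu> \<mu> k 1 ends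
      = mixed_sum \<nu> \<mu> k 0 ends + (\<phi> r - t) * mixed_sum \<nu> \<mu> k 0 (\<lambda>_. 1)"
    unfolding One_nat_def mixed_sum_step unfolding mixed_sum_def add_chains_0[OF part(2)] sum_distrib_left
      sum.distrib[symmetric]
  proof (intro sum.cong refl)
    fix as bs assume A: "as \<in> rem_chains r k \<nu>" "bs \<in> {[] :: box list}"
    note A' = ne[OF A(1)]
    have M: "middle_sum r (\<nu> - set as) (\<mu> \<union> set []) (\<lambda>z. (\<chi> (hd as) + z) / gaps t (map \<chi> as @ [z]))
        = (\<chi> (hd as) + \<chi> (last as) + (\<phi> r - t)) / gaps t (map \<chi> as)"
      using middle_sum_right_end[OF A'(1) nil A'(2)] by blast
    show "chain_coeff \<nu> \<mu> as bs * middle_sum r (\<nu> - set as) (\<mu> \<union> set bs)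
            (\<lambda>z. ends (map \<chi> as @ z # rev (map (\<lambda>b. \<chi>' b - m) bs)) / gaps t (map \<chi> as @ z # rev (map (\<lambda>b. \<chi>' b - m) bs)))
        = chain_coeff \<nu> \<mu> as bs * (ends (chain_weights as bs) / gaps t (chain_weights as bs))
        + (\<phi> r - t) * (chain_coeff \<nu> \<mu> as bs * (1 / gaps t (chain_weights as bs)))"
    proof -
      have "x * ((a + b) / g) = x * (a / g) + b * (x * (1 / g))" for x a b g :: 'a
        by (simp add: add_divide_distrib algebra_simps)
      then show ?thesis
        using A(2) M by (simp add: e[OF A'(2)] chain_weights_def)
    qed
  qed
qed

lemma mixed_sum_left_end:
  assumes "k > 0"
  shows "mixed_sum \<nu> \<mu> 1 k (\<lambda>_. 1) - mixed_sum \<nu> \<mu> 0 (Suc k) (\<lambda>_. 1) = - mixed_sum \<nu> \<mu> 0 k (\<lambda>_. 1)"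
    and "mixed_sum \<nu> \<mu> 1 k ends - mixed_sum \<nu> \<mu> 0 (Suc k) ends
      = - mixed_sum \<nu> \<mu> 0 k ends - (\<phi> r + t) * mixed_sum \<nu> \<mu> 0 k (\<lambda>_. 1)"
proof -
  have ne: "add_chain r \<mu> bs" "bs \<noteq> []" if "bs \<in> add_chains r k \<mu>" for bs
    using that assms by (auto simp: add_chains_def)
  have nil: "rem_chain r \<nu> []" using part by simp
  show "mixed_sum \<nu> \<mu> 1 k (\<lambda>_. 1) - mixed_sum \<nu> \<mu> 0 (Suc k) (\<lambda>_. 1) = - mixed_sum \<nu> \<mu> 0 k (\<lambda>_. 1)"
    unfolding One_nat_def mixed_sum_step unfolding mixed_sum_def rem_chains_0[OF part(1)] sum_negf[symmetric]
  proof (intro sum.cong refl)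
    fix as bs assume A: "as \<in> {[] :: box list}" "bs \<in> add_chains r k \<mu>"
    let ?bs = "rev (map (\<lambda>b. \<chi>' b - m) bs)"
    have "middle_sum r (\<nu> - set []) (\<mu> \<union> set bs) (\<lambda>z. 1 / gaps t (z # ?bs)) = - (1 / gaps t ?bs)"
      using middle_sum_left_end[OF nil ne[OF A(2)]] by blast
    then show "chain_coeff \<nu> \<mu> as bs * middle_sum r (\<nu> - set as) (\<mu> \<union> set bs)
            (\<lambda>z. 1 / gaps t (map \<chi> as @ z # ?bs))
        = - (chain_coeff \<nu> \<mu> as bs * (1 / gaps t (chain_weights as bs)))"
      using A(1) by (simp add: chain_weights_def)
  qed
  show "mixed_sum \<nu> \<mu> 1 k ends - mixed_sum \<nu> \<mu> 0 (Suc k) ends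
      = - mixed_sum \<nu> \<mu> 0 k ends - (\<phi> r + t) * mixed_sum \<nu> \<mu> 0 k (\<lambda>_. 1)"
    unfolding One_nat_def mixed_sum_step unfolding mixed_sum_def rem_chains_0[OF part(1)] sum_negf[symmetric]
      sum_distrib_left sum_subtractf[symmetric]
  proof (intro sum.cong refl)
    fix as bs assume A: "as \<in> {[] :: box list}" "bs \<in> add_chains r k \<mu>"
    note A' = ne[OF A(2)]
    let ?bs = "rev (map (\<lambda>b. \<chi>' b - m) bs)"
    have M: "middle_sum r (\<nu> - set []) (\<mu> \<union> set bs) (\<lambda>z. (z + last ?bs) / gaps t (z # ?bs))
        = - ((hd ?bs + last ?bs + (\<phi> r + t)) / gaps t ?bs)"
      using middle_sum_left_end[OF nil A'] by blast
    have "?bs \<noteq> []" using A'(2) by simp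
    then have e: "ends (z # ?bs) = z + last ?bs" "ends ?bs = hd ?bs + last ?bs" for z
      by (simp_all add: ends_def)
    have "ends (chain_weights [] bs) = hd ?bs + last ?bs" "gaps t (chain_weights [] bs) = gaps t ?bs"
      using e by (simp_all add: chain_weights_def)
    note * = this
    have "chain_coeff \<nu> \<mu> [] bs * middle_sum r (\<nu> - set []) (\<mu> \<union> set bs)
            (\<lambda>z. ends (z # ?bs) / gaps t (z # ?bs))
        = - (chain_coeff \<nu> \<mu> [] bs * (ends (chain_weights [] bs) / gaps t (chain_weights [] bs)))
        - (\<phi> r + t) * (chain_coeff \<nu> \<mu> [] bs * (1 / gaps t (chain_weights [] bs)))"
    proof -
      have "x * - ((a + b) / g) = - (x * (a / g)) - b * (x * (1 / g))" for x a b g :: 'a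
        by (simp add: add_divide_distrib algebra_simps)
      with * show ?thesis unfolding e M by simp
    qed
    then show "chain_coeff \<nu> \<mu> as bs * middle_sum r (\<nu> - set as) (\<mu> \<union> set bs)
            (\<lambda>z. ends (map \<chi> as @ z # ?bs) / gaps t (map \<chi> as @ z # ?bs))
        = - (chain_coeff \<nu> \<mu> as bs * (ends (chain_weights as bs) / gaps t (chain_weights as bs)))
        - (\<phi> r + t) * (chain_coeff \<nu> \<mu> as bs * (1 / gaps t (chain_weights as bs)))"
      using A(1) by simp
  qed
qed

lemma mixed_sum_inner:
  assumes "j > 0" "l > 0" "P = ends \<or> P = (\<lambda>_. 1)"
  shows "mixed_sum \<nu> \<mu> (Suc j) l P = mixed_sum \<nu> \<mu> j (Suc l) P"
proof -
  have "mixed_sum \<nu> \<mu> (Suc j) l P - mixed_sum \<nu> \<mu> j (Suc l) P = 0"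
    unfolding mixed_sum_step
  proof (intro sum.neutral ballI)
    fix as bs assume A: "as \<in> rem_chains r j \<nu>" "bs \<in> add_chains r l \<mu>"
    let ?bs = "rev (map (\<lambda>b. \<chi>' b - m) bs)"
    have c: "rem_chain r \<nu> as" "add_chain r \<mu> bs" "as \<noteq> []" "bs \<noteq> []"
      using A assms by (auto simp: rem_chains_def add_chains_def)
    have "P (map \<chi> as @ z # ?bs) = P (map \<chi> as @ ?bs)" for z
      using assms(3) c(3,4) by (auto simp: ends_def)
    then show "chain_coeff \<nu> \<mu> as bs * middle_sum r (\<nu> - set as) (\<mu> \<union> set bs)
            (\<lambda>z. P (map \<chi> as @ z # ?bs) / gaps t (map \<chi> as @ z # ?bs)) = 0"
      using middle_sum_inner[OF c] by simp
  qed
  then show ?thesis by simp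
qed

lemma mixed_sum_inner_ends:
  assumes "P = ends \<or> P = (\<lambda>_. 1)"
  shows "mixed_sum \<nu> \<mu> (Suc n) 1 P = mixed_sum \<nu> \<mu> 1 (Suc n) P"
proof -
  have "i \<le> n \<Longrightarrow> mixed_sum \<nu> \<mu> (Suc n) 1 P = mixed_sum \<nu> \<mu> (Suc n - i) (Suc i) P" for i
  proof (induction i)
    case (Suc i)
    then have "Suc (Suc n - Suc i) = Suc n - i" "Suc n - Suc i > 0" by auto
    then show ?case using Suc mixed_sum_inner[of "Suc n - Suc i" "Suc i" P] assms by simp
  qed simp
  from this[of n] show ?thesis by simp
qed

text \<open>A single variable has no gap, so the coefficients of \<Phi> at infinity appear
  unreduced; \<open>ends\<close> is \<open>2 * z\<close>, which absorbs the half in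
  \<open>middle_sum_id\<close>.\<close>

lemma mixed_sum_base:
  "mixed_sum \<nu> \<mu> 1 0 (\<lambda>_. 1) - mixed_sum \<nu> \<mu> 0 1 (\<lambda>_. 1) = K \<nu> \<mu> * \<phi> r"
  "mixed_sum \<nu> \<mu> 1 0 ends - mixed_sum \<nu> \<mu> 0 1 ends = K \<nu> \<mu> *
    ((\<phi> r)\<^sup>2 + 2 * t1 * t2 * (of_nat (card \<nu>) - of_nat (card \<mu>)) + (\<Sum>i<r. (u' i - m)\<^sup>2) - (\<Sum>i<r. (u i - t)\<^sup>2))"
proof -
  show "mixed_sum \<nu> \<mu> 1 0 (\<lambda>_. 1) - mixed_sum \<nu> \<mu> 0 1 (\<lambda>_. 1) = K \<nu> \<mu> * \<phi> r"
    unfolding One_nat_def mixed_sum_step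
    using middle_sum_one[OF part] by (simp add: rem_chains_0 add_chains_0 part chain_coeff_def)
  have half: "2 * (Q / 2) = Q" for Q :: 'a using fst.t_nonzero(4) by simp
  note id2 = middle_sum_cmult[of \<nu> \<mu> 2 "\<lambda>z. z", unfolded middle_sum_id[OF part] half]
  have "ends [z] = 2 * z" for z :: 'a by (simp add: ends_def)
  then show "mixed_sum \<nu> \<mu> 1 0 ends - mixed_sum \<nu> \<mu> 0 1 ends = K \<nu> \<mu> *
    ((\<phi> r)\<^sup>2 + 2 * t1 * t2 * (of_nat (card \<nu>) - of_nat (card \<mu>)) + (\<Sum>i<r. (u' i - m)\<^sup>2) - (\<Sum>i<r. (u i - t)\<^sup>2))"
    unfolding One_nat_def mixed_sum_step
    using id2 by (simp add: rem_chains_0 add_chains_0 part chain_coeff_def)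
qed

text \<open>Crossing the last and the first position contributes the two extreme sums with one
  variable fewer, with opposite signs. So the difference does not depend on
  \<open>k\<close>.\<close>

lemma mixed_sum_one:
  "mixed_sum \<nu> \<mu> (Suc k) 0 (\<lambda>_. 1) - mixed_sum \<nu> \<mu> 0 (Suc k) (\<lambda>_. 1) = K \<nu> \<mu> * \<phi> r"
proof (induction k)
  case 0
  show ?case using mixed_sum_base(1) by simp
next
  case (Suc k)
  have "mixed_sum \<nu> \<mu> (Suc (Suc k)) 0 (\<lambda>_. 1) - mixed_sum \<nu> \<mu> 0 (Suc (Suc k)) (\<lambda>_. 1)
      = (mixed_sum \<nu> \<mu> (Suc (Suc k)) 0 (\<lambda>_. 1) - mixed_sum \<nu> \<mu> (Suc k) 1 (\<lambda>_. 1))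
      + (mixed_sum \<nu> \<mu> 1 (Suc k) (\<lambda>_. 1) - mixed_sum \<nu> \<mu> 0 (Suc (Suc k)) (\<lambda>_. 1))"
    using mixed_sum_inner_ends[of "\<lambda>_. 1" k] by simp
  then show ?case
    unfolding mixed_sum_right_end(1)[OF zero_less_Suc] mixed_sum_left_end(1)[OF zero_less_Suc]
    using Suc by simp
qed

text \<open>The same telescoping; the corrections \<open>\<phi> r - t\<close> and
  \<open>\<phi> r + t\<close> at the two ends differ, so sums with numerator 1, hence B operators,
  remain.\<close>

lemma mixed_sum_ends:
  "mixed_sum \<nu> \<mu> (Suc (Suc k)) 0 ends - mixed_sum \<nu> \<mu> 0 (Suc (Suc k)) ends
    = mixed_sum \<nu> \<mu> (Suc k) 0 ends - mixed_sum \<nu> \<mu> 0 (Suc k) ends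
    + (\<phi> r - t) * mixed_sum \<nu> \<mu> (Suc k) 0 (\<lambda>_. 1) - (\<phi> r + t) * mixed_sum \<nu> \<mu> 0 (Suc k) (\<lambda>_. 1)"
proof -
  have "mixed_sum \<nu> \<mu> (Suc (Suc k)) 0 ends - mixed_sum \<nu> \<mu> 0 (Suc (Suc k)) ends
      = (mixed_sum \<nu> \<mu> (Suc (Suc k)) 0 ends - mixed_sum \<nu> \<mu> (Suc k) 1 ends)
      + (mixed_sum \<nu> \<mu> 1 (Suc k) ends - mixed_sum \<nu> \<mu> 0 (Suc (Suc k)) ends)"
    using mixed_sum_inner_ends[of ends k] by simp
  then show ?thesis
    unfolding mixed_sum_right_end(2)[OF zero_less_Suc] mixed_sum_left_end(2)[OF zero_less_Suc] by simp
qed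

end

end

section \<open>Tableaux as chains\<close>

fun box_less :: "box \<Rightarrow> box \<Rightarrow> bool" where
  "box_less (i, x, y) (j, x', y') \<longleftrightarrow> i = j \<and> x \<le> x' \<and> y \<le> y' \<and> (x, y) \<noteq> (x', y')"

lemma rem_corners_box_less:
  assumes "\<nu> \<in> rpartitions r" "b \<in> rem_corners r \<nu>" "c \<in> \<nu>"
  shows "\<not> box_less b c"
proof
  assume l: "box_less b c"
  obtain i x y j x' y' where e: "b = (i, x, y)" "c = (j, x', y')" by (cases b; cases c)
  have "j = i" "x \<le> x'" "y \<le> y'" "(x, y) \<noteq> (x', y')" using l e by auto
  then have "Suc x \<le> x' \<and> y \<le> y' \<or> x \<le> x' \<and> Suc y \<le> y'" by auto
  then have "(i, Suc x, y) \<in> \<nu> \<or> (i, x, Suc y) \<in> \<nu>"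
    using rpartitions_down[OF assms(1)] assms(3) e \<open>j = i\<close> by blast
  then show False using assms(2) rem_corners_iff[OF assms(1)] e by blast
qed

text \<open>A box can be removed exactly when no remaining box lies above it or to its right. This
  turns the condition on successive shapes into one on the order of the boxes, as in the definition
  of tableaux.\<close>

lemma rem_chain_iff_sorted:
  assumes "\<nu> \<in> rpartitions r" "\<mu> \<in> rpartitions r" "\<mu> \<subseteq> \<nu>" "set bs = \<nu> - \<mu>" "distinct bs"
  shows "rem_chain r \<nu> bs \<longleftrightarrow> sorted_wrt (\<lambda>b c. \<not> box_less b c) bs"
  using assms
proof (induction bs arbitrary: \<nu>)
  case (Cons b bs)
  obtain i x y where b: "b = (i, x, y)" by (cases b)
  have b\<nu>: "b \<in> \<nu>" "b \<notin> \<mu>" using Cons.prems(4) by auto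
  have "b \<in> rem_corners r \<nu> \<longleftrightarrow> (\<forall>c\<in>set bs. \<not> box_less b c)"
  proof
    assume "b \<in> rem_corners r \<nu>"
    moreover have "set bs \<subseteq> \<nu>" using Cons.prems(4) by auto
    ultimately show "\<forall>c\<in>set bs. \<not> box_less b c"
      using rem_corners_box_less[OF Cons.prems(1)] by blast
  next
    assume A: "\<forall>c\<in>set bs. \<not> box_less b c"
    have "c \<notin> \<nu>" if "box_less b c" for c
    proof
      assume "c \<in> \<nu>"
      obtain j x' y' where c: "c = (j, x', y')" by (cases c)
      have "c \<notin> \<mu>" using that b\<nu>(2) b c rpartitions_down[OF Cons.prems(2)] by auto
      moreover have "c \<noteq> b" using that b by auto
      ultimately have "c \<in> set bs" using \<open>c \<in> \<nu>\<close> Cons.prems(4) by auto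
      then show False using A that by blast
    qed
    then show "b \<in> rem_corners r \<nu>"
      using b\<nu>(1) by (simp add: b rem_corners_iff[OF Cons.prems(1)])
  qed
  moreover have "rem_chain r (\<nu> - {b}) bs \<longleftrightarrow> sorted_wrt (\<lambda>b c. \<not> box_less b c) bs" if "b \<in> rem_corners r \<nu>"
  proof (rule Cons.IH)
    show "\<nu> - {b} \<in> rpartitions r" using corner_remove(1)[OF that] .
  qed (use Cons.prems b\<nu> in auto)
  ultimately show ?case using Cons.prems(1) by auto
qed simp

definition skew_chains :: "nat \<Rightarrow> nat \<Rightarrow> box set \<Rightarrow> box set \<Rightarrow> box list set" where
  "skew_chains r k \<nu> \<mu> = {bs \<in> rem_chains r k \<nu>. \<nu> - set bs = \<mu>}"

definition tableau_list :: "box set \<Rightarrow> (box \<Rightarrow> nat) \<Rightarrow> box list" where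
  "tableau_list S f = map (the_inv_into S f) [1..<Suc (card S)]"

text \<open>The boxes are read in the order of their labels. Labels decrease upwards and to the
  right, so label 1 sits at a removable corner and is the first box to go.\<close>

lemma bij_betw_tableau_list:
  assumes "skew_shape r k \<nu> \<mu>"
  shows "bij_betw (tableau_list (\<nu> - \<mu>)) (SYT (\<nu> - \<mu>)) (skew_chains r k \<nu> \<mu>)"
proof (rule bij_betwI')
  let ?S = "\<nu> - \<mu>"
  have part: "\<nu> \<in> rpartitions r" "\<mu> \<in> rpartitions r" "\<mu> \<subseteq> \<nu>"
    using assms by (auto simp: skew_shape_def)
  have card: "card ?S = k"
    using assms part(3) rpartitions_finite[OF part(2)] by (simp add: skew_shape_def card_Diff_subset)
  have bij: "bij_betw f ?S {1..k}" if "f \<in> SYT ?S" for f using that card by (auto simp: SYT_def)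
  have list: "tableau_list ?S f = map (the_inv_into ?S f) [1..<Suc k]" for f
    by (simp add: tableau_list_def card)
  have nth: "tableau_list ?S f ! i = the_inv_into ?S f (Suc i)" if "i < k" for f i
    using that by (simp add: list del: upt_Suc)
  show "tableau_list ?S f = tableau_list ?S g \<longleftrightarrow> f = g" if f: "f \<in> SYT ?S" and g: "g \<in> SYT ?S" for f g
  proof
    assume e: "tableau_list ?S f = tableau_list ?S g"
    show "f = g"
    proof (rule extensionalityI)
      show "f \<in> extensional ?S" "g \<in> extensional ?S" using f g by (auto simp: SYT_def)
      fix b assume b: "b \<in> ?S"
      then have "f b \<in> {1..k}" using bij[OF f] by (auto simp: bij_betw_def)
      then obtain i where i: "f b = Suc i" "i < k" by (cases "f b") auto
      have "the_inv_into ?S g (f b) = the_inv_into ?S f (f b)"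
        using e nth[OF i(2)] i(1) by metis
      also have "\<dots> = b" using bij[OF f] b by (intro the_inv_into_f_f) (auto simp: bij_betw_def)
      finally show "f b = g b"
        using f_the_inv_into_f_bij_betw[OF bij[OF g]] \<open>f b \<in> {1..k}\<close> by metis
    qed
  qed simp
  have set: "set (tableau_list ?S f) = ?S" and dist: "distinct (tableau_list ?S f)" if "f \<in> SYT ?S" for f
  proof -
    have b: "bij_betw (the_inv_into ?S f) {1..k} ?S" using bij_betw_the_inv_into[OF bij[OF that]] .
    have "{1..<Suc k} = {1..k}" by auto
    then show "set (tableau_list ?S f) = ?S" "distinct (tableau_list ?S f)"
      using b unfolding list by (auto simp: bij_betw_def distinct_map simp del: upt_Suc)
  qed
  show "tableau_list ?S f \<in> skew_chains r k \<nu> \<mu>" if f: "f \<in> SYT ?S" for f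
  proof -
    have "sorted_wrt (\<lambda>b c. \<not> box_less b c) (tableau_list ?S f)"
      unfolding sorted_wrt_iff_nth_less
    proof (intro allI impI notI)
      fix i j assume ij: "i < j" "j < length (tableau_list ?S f)"
      assume l: "box_less (tableau_list ?S f ! i) (tableau_list ?S f ! j)"
      let ?b = "tableau_list ?S f ! i" and ?c = "tableau_list ?S f ! j"
      have k: "i < k" "j < k" using ij by (simp_all add: list del: upt_Suc)
      then have fb: "f ?b = Suc i" "f ?c = Suc j"
        using f_the_inv_into_f_bij_betw[OF bij[OF f]] by (simp_all add: nth)
      have "i < length (tableau_list ?S f)" using ij by simp
      then have in_S: "?b \<in> ?S" "?c \<in> ?S"
        using nth_mem[of i "tableau_list ?S f"] nth_mem[OF ij(2)] by (simp_all only: set[OF f])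
      obtain p x y q x' y' where e: "?b = (p, x, y)" "?c = (q, x', y')" by (cases ?b; cases ?c)
      have "f ?c < f ?b" using f in_S l unfolding e SYT_def by auto
      then show False using fb ij by simp
    qed
    then have "rem_chain r \<nu> (tableau_list ?S f)"
      using rem_chain_iff_sorted[OF part set[OF f] dist[OF f]] by simp
    then show ?thesis
      using set[OF f] part(3) by (auto simp: skew_chains_def rem_chains_def list)
  qed
  show "\<exists>f\<in>SYT ?S. bs = tableau_list ?S f" if bs: "bs \<in> skew_chains r k \<nu> \<mu>" for bs
  proof -
    have bs': "rem_chain r \<nu> bs" "length bs = k" "\<nu> - set bs = \<mu>"
      using bs by (auto simp: skew_chains_def rem_chains_def)
    then have bs_set: "set bs = ?S" and d: "distinct bs" using rem_chainD[OF bs'(1)] by auto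
    let ?h = "\<lambda>i. bs ! (i - 1)"
    have h: "bij_betw ?h {1..k} ?S"
    proof (rule bij_betwI')
      show "(?h i = ?h j) = (i = j)" if "i \<in> {1..k}" "j \<in> {1..k}" for i j
        using that d bs'(2) by (auto simp: nth_eq_iff_index_eq)
      show "?h i \<in> ?S" if "i \<in> {1..k}" for i
      proof -
        have "i - 1 < length bs" using that bs'(2) by auto
        then show ?thesis using nth_mem bs_set by blast
      qed
      show "\<exists>i\<in>{1..k}. b = ?h i" if "b \<in> ?S" for b
      proof -
        have "b \<in> set bs" using that bs_set by simp
        then obtain i where "i < length bs" "bs ! i = b" by (auto simp: in_set_conv_nth)
        then show ?thesis using bs'(2) by (intro bexI[of _ "Suc i"]) auto
      qed
    qed
    \<comment> \<open>The label of a box is its position in the list, counted from 1. The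
      restriction makes the labeling extensional, as tableaux are required to be.\<close>
    define g where "g = the_inv_into {1..k} ?h"
    define f where "f = restrict g ?S"
    have g: "bij_betw g ?S {1..k}" unfolding g_def by (rule bij_betw_the_inv_into[OF h])
    then have fb: "bij_betw f ?S {1..k}" using bij_betw_cong[of ?S f g] by (simp add: f_def)
    have fh: "f (?h i) = i" "?h i \<in> ?S" if "i \<in> {1..k}" for i
      using that h the_inv_into_f_f[of ?h "{1..k}" i] by (auto simp: f_def g_def bij_betw_def)
    have hf: "?h (f b) = b" "f b \<in> {1..k}" if "b \<in> ?S" for b
      using that f_the_inv_into_f_bij_betw[OF h, of b] fb by (auto simp: f_def g_def bij_betw_def)
    have sorted: "sorted_wrt (\<lambda>b c. \<not> box_less b c) bs"
      using bs'(1) rem_chain_iff_sorted[OF part bs_set d] by simp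
    have "f (i, x', y') < f (i, x, y)"
      if A: "(i, x, y) \<in> ?S" "(i, x', y') \<in> ?S" "x \<le> x'" "y \<le> y'" "(x, y) \<noteq> (x', y')" for i x y x' y'
    proof (rule ccontr)
      assume n: "\<not> f (i, x', y') < f (i, x, y)"
      have "f (i, x, y) \<noteq> f (i, x', y')"
        using hf(1)[OF A(1)] hf(1)[OF A(2)] A(5) by auto
      with n have "f (i, x, y) - 1 < f (i, x', y') - 1" "f (i, x', y') - 1 < length bs"
        using hf(2)[OF A(1)] hf(2)[OF A(2)] bs'(2) by auto
      then have "\<not> box_less (?h (f (i, x, y))) (?h (f (i, x', y')))"
        using sorted unfolding sorted_wrt_iff_nth_less by blast
      then show False using A unfolding hf(1)[OF A(1)] hf(1)[OF A(2)] by auto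
    qed
    then have "f \<in> SYT ?S"
      using fb unfolding SYT_def card by (auto simp: f_def)
    moreover have "bs = tableau_list ?S f"
    proof (rule nth_equalityI)
      show "length bs = length (tableau_list ?S f)" using bs'(2) by (simp add: list)
      fix i assume "i < length bs"
      then have i: "i < k" using bs'(2) by simp
      have "the_inv_into ?S f (Suc i) = bs ! i"
        using fh[of "Suc i"] i fb by (intro the_inv_into_f_eq) (auto simp: bij_betw_def)
      then show "bs ! i = tableau_list ?S f ! i" using nth[OF i] by simp
    qed
    ultimately show ?thesis by blast
  qed
qed

lemma rem_chains_skew_shape:
  assumes "bs \<in> rem_chains r k \<nu>"
  shows "skew_shape r k \<nu> (\<nu> - set bs)"
proof -
  have bs: "rem_chain r \<nu> bs" "length bs = k" using assms by (auto simp: rem_chains_def)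
  note D = rem_chainD[OF bs(1)]
  have "card (set bs) = k" using D bs(2) distinct_card by blast
  moreover have "card (set bs) \<le> card \<nu>" using D by (intro card_mono rpartitions_finite) auto
  moreover have "card (\<nu> - set bs) = card \<nu> - card (set bs)" using D by (intro card_Diff_subset) auto
  ultimately show ?thesis using D by (auto simp: skew_shape_def)
qed

section \<open>Products over tableaux\<close>

fun pair_prod :: "('a \<Rightarrow> 'a \<Rightarrow> 'b::comm_monoid_mult) \<Rightarrow> 'a list \<Rightarrow> 'b" where
  "pair_prod g [] = 1"
| "pair_prod g (x # xs) = prod_list (map (g x) xs) * pair_prod g xs"

lemma prod_pairs_eq:
  fixes z :: "nat \<Rightarrow> 'a"
  shows "(\<Prod>(i, j) \<in> {(i, j). 1 \<le> i \<and> i < j \<and> j \<le> k}. g (z i) (z j)) = pair_prod g (map z [1..<Suc k])"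
proof -
  have "a \<le> n \<Longrightarrow> (\<Prod>i\<in>{a..<n}. \<Prod>j\<in>{i<..<n}. g (z i) (z j)) = pair_prod g (map z [a..<n])" for a n
  proof (induction a rule: inc_induct)
    case (step a)
    have "{a..<n} = insert a {Suc a..<n}" using step(2) by auto
    moreover have "[a..<n] = a # [Suc a..<n]" using step(2) by (rule upt_conv_Cons)
    moreover have "{a<..<n} = set [Suc a..<n]" by auto
    then have "(\<Prod>j\<in>{a<..<n}. g (z a) (z j)) = prod_list (map (\<lambda>j. g (z a) (z j)) [Suc a..<n])"
      by (simp add: prod.distinct_set_conv_list del: set_upt)
    ultimately show ?case using step(3) by (simp add: comp_def)
  qed simp
  note * = this
  have "(\<Prod>i\<in>{1..<Suc k}. \<Prod>j\<in>{i<..<Suc k}. g (z i) (z j)) = pair_prod g (map z [1..<Suc k])"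
    by (rule *) simp
  moreover have "{(i, j). 1 \<le> i \<and> i < j \<and> j \<le> k} = (SIGMA i:{1..<Suc k}. {i<..<Suc k})" by auto
  moreover have "(\<Prod>i\<in>{1..<Suc k}. \<Prod>j\<in>{i<..<Suc k}. g (z i) (z j))
      = (\<Prod>(i, j)\<in>(SIGMA i:{1..<Suc k}. {i<..<Suc k}). g (z i) (z j))"
    by (rule prod.Sigma) auto
  ultimately show ?thesis by (simp only:)
qed

lemma prod_gaps_eq:
  "(\<Prod>i=1..<k. z (i + 1) - z i + t) = gaps t (map z [1..<Suc k])"
proof (induction k)
  case (Suc k)
  show ?case
  proof (cases "k = 0")
    case False
    have "map z [1..<Suc (Suc k)] = map z [1..<Suc k] @ [z (Suc k)]" by simp
    moreover have "map z [1..<Suc k] \<noteq> []" "last (map z [1..<Suc k]) = z k" using False by (auto simp: last_map)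
    ultimately show ?thesis using Suc False by (simp add: gaps_snoc del: upt_Suc map_append)
  qed simp
qed simp

lemma prod_rateval_eq:
  "(\<Prod>i=1..k. h (z i)) = prod_list (map h (map z [1..<Suc k]))"
proof -
  have "{1..k} = set [1..<Suc k]" by auto
  then show ?thesis by (simp add: prod.distinct_set_conv_list comp_def del: set_upt upt_Suc)
qed

section \<open>Evaluation after cancellation\<close>

text \<open>All representatives with a denominator nonzero at \<open>c\<close> give the same value,
  so it is enough to exhibit one; the quotients over corners serve for this.\<close>

lemma rateval_Fract:
  assumes "poly q c \<noteq> 0"
  shows "rateval (Fract p q) c = poly p c / poly q c"
  unfolding rateval_def
proof (rule the_equality)
  show "\<exists>p' q'. poly q' c \<noteq> 0 \<and> Fract p q = Fract p' q' \<and> poly p c / poly q c = poly p' c / poly q' c"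
    using assms by blast
next
  fix v assume "\<exists>p' q'. poly q' c \<noteq> 0 \<and> Fract p q = Fract p' q' \<and> v = poly p' c / poly q' c"
  then obtain p' q' where A: "poly q' c \<noteq> 0" "Fract p q = Fract p' q'" "v = poly p' c / poly q' c" by blast
  have "q \<noteq> 0" "q' \<noteq> 0" using assms A(1) by auto
  then have "p * q' = p' * q" using A(2) by (simp add: eq_fract)
  then have "poly p c * poly q' c = poly p' c * poly q c" by (metis poly_mult)
  then show "v = poly p c / poly q c" using A assms by (simp add: frac_eq_eq)
qed

lemma to_fract_prod: "to_fract (\<Prod>x\<in>A. f x) = (\<Prod>x\<in>A. to_fract (f x))"
  by (induction A rule: infinite_finite_induct) auto

lemma ratconst_simps:
  "ratconst (a + b) = ratconst a + ratconst b" "ratconst (a - b) = ratconst a - ratconst b"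
  "ratconst (a * b) = ratconst a * ratconst b" "ratconst 0 = 0" "ratconst 1 = 1"
  by (simp_all add: ratconst_def flip: to_fract_add to_fract_diff to_fract_mult to_fract_0 to_fract_1)

lemma ratconst_of_nat: "ratconst (of_nat n) = of_nat n"
  by (induction n) (simp_all add: ratconst_simps)

lemma weight_ratconst:
  "weight (ratconst t1) (ratconst t2) (\<lambda>i. ratconst (u i)) b = ratconst (weight t1 t2 u b)"
  by (cases b) (simp add: weight_def ratconst_simps ratconst_of_nat)

lemma ratvar_diff_ratconst: "ratvar - ratconst c = to_fract [:- c, 1:]"
  by (simp add: ratvar_def ratconst_def flip: to_fract_diff)

lemma ratvar_neq_ratconst: "ratvar - ratconst c \<noteq> 0"
  by (simp add: ratvar_diff_ratconst)

text \<open>The corner identity for the function \<open>z - weight b + t\<close>: its values at the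
  right, upper and diagonal shifts of a box are the factors of zeta. The field is arbitrary, so that
  \<open>z\<close> may also be the variable of a field of rational functions.\<close>

lemma corner_fun_eq_prod_zeta:
  fixes z :: "'a::field"
  assumes "\<nu> \<in> rpartitions r"
    and nz: "\<And>b. b \<in> \<nu> \<Longrightarrow> z - weight t1 t2 u b \<noteq> 0 \<and> z - weight t1 t2 u b + (t1 + t2) \<noteq> 0"
  shows "corner_fun r t1 t2 u \<nu> z = (\<Prod>b\<in>\<nu>. zeta t1 t2 (z - weight t1 t2 u b)) * tau r u (z + (t1 + t2))"
proof -
  let ?w = "weight t1 t2 u" and ?t = "t1 + t2"
  have g: "z - ?w (right_box b) + ?t = z - ?w b + t2" "z - ?w (up_box b) + ?t = z - ?w b + t1"
    "z - ?w (diag_box b) + ?t = z - ?w b" "z - ?w (i, 0, 0) + ?t = z + ?t - u i" for b i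
    by (simp_all add: weight_shift weight_origin algebra_simps)
  have fin: "finite \<nu>" using rpartitions_finite[OF assms(1)] .
  have nz': "(\<Prod>b\<in>\<nu>. z - ?w b) \<noteq> 0" "(\<Prod>b\<in>\<nu>. z - ?w b + ?t) \<noteq> 0"
    using nz fin by (simp_all add: prod_zero_iff)
  have nz'': "(\<Prod>b\<in>rem_corners r \<nu>. z - ?w b) \<noteq> 0"
    using nz finite_rem_corners[OF assms(1)] by (auto simp: prod_zero_iff rem_corners_def)
  have "A / R = (P1 * P2 / (D * N)) * T" if "A * N * D = R * T * P2 * P1" "R \<noteq> 0" "N \<noteq> 0" "D \<noteq> 0"
    for A R P1 P2 D N T :: 'a
    using that by (simp add: divide_simps) (simp add: ac_simps)
  from this[OF corner_prod[OF assms(1), of "\<lambda>b. z - ?w b + ?t", unfolded g] nz'' nz'(2) nz'(1)]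
  show ?thesis
    unfolding corner_fun_def zeta_def tau_def prod_dividef prod.distrib by simp
qed

text \<open>The symmetry by which the factors of \<open>C_minus\<close>, where zeta has the
  reflected argument, become the factors of N at \<open>z - t\<close>.\<close>

lemma zeta_reflect: "zeta t1 t2 (- z - (t1 + t2)) = zeta t1 t2 z"
proof -
  have "- z - (t1 + t2) + t1 = - (z + t2)" "- z - (t1 + t2) + t2 = - (z + t1)"
    "- z - (t1 + t2) + (t1 + t2) = - z" "- z - (t1 + t2) = - (z + (t1 + t2))"
    by simp_all
  then show ?thesis unfolding zeta_def by (simp only: minus_mult_minus) (simp add: mult.commute)
qed

text \<open>The shift \<open>c\<close> is 0 for \<open>C_plus\<close> and t for
  \<open>C_minus\<close>, whose one-variable factor is the reciprocal of N at
  \<open>z - t\<close>.\<close>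

definition corner_num :: "nat \<Rightarrow> 'a::field \<Rightarrow> 'a \<Rightarrow> (nat \<Rightarrow> 'a) \<Rightarrow> box set \<Rightarrow> 'a \<Rightarrow> 'a poly" where
  "corner_num r t1 t2 u \<nu> c = (\<Prod>a\<in>add_corners r \<nu>. [:- (weight t1 t2 u a - (t1 + t2) + c), 1:])"

definition corner_den :: "nat \<Rightarrow> 'a::field \<Rightarrow> 'a \<Rightarrow> (nat \<Rightarrow> 'a) \<Rightarrow> box set \<Rightarrow> 'a \<Rightarrow> 'a poly" where
  "corner_den r t1 t2 u \<nu> c = (\<Prod>a\<in>rem_corners r \<nu>. [:- (weight t1 t2 u a + c), 1:])"

lemma poly_corner:
  "poly (corner_num r t1 t2 u \<nu> c) z / poly (corner_den r t1 t2 u \<nu> c) z = corner_fun r t1 t2 u \<nu> (z - c)"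
  unfolding corner_num_def corner_den_def corner_fun_def poly_prod
  by (intro arg_cong2[where f = "(/)"] prod.cong refl) (simp_all add: algebra_simps)

lemma corner_fun_rat:
  "corner_fun r (ratconst t1) (ratconst t2) (\<lambda>i. ratconst (u i)) \<nu> (ratvar - ratconst c)
    = to_fract (corner_num r t1 t2 u \<nu> c) / to_fract (corner_den r t1 t2 u \<nu> c)"
proof -
  have 1: "ratvar - ratconst c - ratconst w + (ratconst t1 + ratconst t2) = ratvar - ratconst (w - (t1 + t2) + c)"
    "ratvar - ratconst c - ratconst w = ratvar - ratconst (w + c)" for w
    by (simp_all add: ratconst_simps algebra_simps)
  show ?thesis
    unfolding corner_fun_def weight_ratconst unfolding 1(1) unfolding 1(2) unfolding corner_num_def corner_den_def to_fract_prod ratvar_diff_ratconst ..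
qed

lemma plus_factor_eq:
  assumes "\<nu> \<in> rpartitions r"
  shows "plus_factor r t1 t2 u \<nu> = Fract (corner_num r t1 t2 u \<nu> 0) (corner_den r t1 t2 u \<nu> 0)"
proof -
  have nz: "ratvar - weight (ratconst t1) (ratconst t2) (\<lambda>i. ratconst (u i)) b \<noteq> 0 \<and>
    ratvar - weight (ratconst t1) (ratconst t2) (\<lambda>i. ratconst (u i)) b + (ratconst t1 + ratconst t2) \<noteq> 0" for b
    using ratvar_neq_ratconst[of "weight t1 t2 u b"] ratvar_neq_ratconst[of "weight t1 t2 u b - (t1 + t2)"]
    by (simp add: weight_ratconst ratconst_simps algebra_simps)
  have "plus_factor r t1 t2 u \<nu> = corner_fun r (ratconst t1) (ratconst t2) (\<lambda>i. ratconst (u i)) \<nu> ratvar"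
    unfolding corner_fun_eq_prod_zeta[OF assms nz] plus_factor_def weight_ratconst
    by (simp add: ratconst_simps)
  then show ?thesis
    using corner_fun_rat[of r t1 t2 u \<nu> 0] by (simp add: ratconst_simps Fract_conv_to_fract)
qed

lemma minus_factor_eq:
  assumes "\<nu> \<in> rpartitions r"
  shows "minus_factor r t1 t2 u \<nu>
    = Fract (corner_den r t1 t2 u \<nu> (t1 + t2)) (corner_num r t1 t2 u \<nu> (t1 + t2))"
proof -
  let ?z = "ratvar - ratconst (t1 + t2)"
  have nz: "?z - weight (ratconst t1) (ratconst t2) (\<lambda>i. ratconst (u i)) b \<noteq> 0 \<and>
    ?z - weight (ratconst t1) (ratconst t2) (\<lambda>i. ratconst (u i)) b + (ratconst t1 + ratconst t2) \<noteq> 0" for b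
    using ratvar_neq_ratconst[of "weight t1 t2 u b"] ratvar_neq_ratconst[of "weight t1 t2 u b + (t1 + t2)"]
    by (simp add: weight_ratconst ratconst_simps algebra_simps)
  have "zeta (ratconst t1) (ratconst t2) (ratconst w - ratvar) = zeta (ratconst t1) (ratconst t2) (?z - ratconst w)" for w
    using zeta_reflect[of "ratconst t1" "ratconst t2" "ratconst w - ratvar"]
    by (simp add: ratconst_simps algebra_simps)
  then have "minus_factor r t1 t2 u \<nu> = inverse (corner_fun r (ratconst t1) (ratconst t2) (\<lambda>i. ratconst (u i)) \<nu> ?z)"
    unfolding corner_fun_eq_prod_zeta[OF assms nz] minus_factor_def weight_ratconst
    by (simp add: ratconst_simps prod_inversef[unfolded comp_def] divide_inverse)
  then show ?thesis
    unfolding corner_fun_rat by (simp add: Fract_conv_to_fract)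
qed

section \<open>Tableau sums rewritten as sums over chains\<close>

context generic_weights
begin

text \<open>The coefficient of \<open>B\<^sub>-\<^sub>1\<close> that adds the box \<open>b\<close>;
  like \<open>minus_step\<close> it is indexed by the larger of the two shapes.\<close>

definition plus_step :: "nat \<Rightarrow> box set \<Rightarrow> box \<Rightarrow> 'a" where
  "plus_step r \<nu> b = t1 * t2 / (t1 + t2) * corner_fun r t1 t2 u (\<nu> - {b}) (weight t1 t2 u b)"

definition minus_step :: "nat \<Rightarrow> box set \<Rightarrow> box \<Rightarrow> 'a" where
  "minus_step r \<nu> b = t1 * t2 / (t1 + t2) / corner_fun r t1 t2 u \<nu> (weight t1 t2 u b - (t1 + t2))"

lemma rateval_plus_factor:
  assumes "\<nu> \<in> rpartitions r" "b \<notin> \<nu>"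
  shows "rateval (plus_factor r t1 t2 u \<nu>) (weight t1 t2 u b) = corner_fun r t1 t2 u \<nu> (weight t1 t2 u b)"
proof -
  have "poly (corner_den r t1 t2 u \<nu> 0) (weight t1 t2 u b) \<noteq> 0"
    using assms(2) finite_rem_corners[OF assms(1)]
    unfolding corner_den_def poly_prod by (auto simp: prod_zero_iff weight_eq_iff rem_corners_def)
  then show ?thesis
    unfolding plus_factor_eq[OF assms(1)] by (simp add: rateval_Fract poly_corner)
qed

lemma rateval_minus_factor:
  assumes "\<nu> \<in> rpartitions r" "b \<in> \<nu>"
  shows "rateval (minus_factor r t1 t2 u \<nu>) (weight t1 t2 u b)
    = inverse (corner_fun r t1 t2 u \<nu> (weight t1 t2 u b - (t1 + t2)))"
proof -
  have "poly (corner_num r t1 t2 u \<nu> (t1 + t2)) (weight t1 t2 u b) \<noteq> 0"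
    using assms(2) finite_add_corners[OF assms(1)]
    unfolding corner_num_def poly_prod by (auto simp: prod_zero_iff weight_eq_iff add_corners_def)
  then show ?thesis
    unfolding minus_factor_eq[OF assms(1)] poly_corner[symmetric] by (simp add: rateval_Fract)
qed

lemma corner_fun_outside:
  assumes "\<nu> \<in> rpartitions r" "b \<notin> \<nu>"
  shows "corner_fun r t1 t2 u \<nu> (weight t1 t2 u b)
    = (\<Prod>c\<in>\<nu>. zeta t1 t2 (weight t1 t2 u b - weight t1 t2 u c)) * tau r u (weight t1 t2 u b + (t1 + t2))"
proof (rule corner_fun_eq_prod_zeta[OF assms(1)])
  fix c assume c: "c \<in> \<nu>"
  obtain i x y where b: "b = (i, x, y)" by (cases b)
  have "c \<noteq> diag_box b"
    using rpartitions_down[OF assms(1), of i "Suc x" "Suc y" x y] c assms(2) b by auto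
  then have "weight t1 t2 u b + (t1 + t2) \<noteq> weight t1 t2 u c" by (simp only: weight_add_t_eq_iff not_False_eq_True)
  then show "weight t1 t2 u b - weight t1 t2 u c \<noteq> 0 \<and> weight t1 t2 u b - weight t1 t2 u c + (t1 + t2) \<noteq> 0"
    using assms(2) c by (auto simp: weight_eq_iff algebra_simps)
qed

text \<open>For a box \<open>c\<close> of \<nu> the product over all boxes degenerates at this
  point, the factor of \<open>c\<close> itself having a zero denominator. So the cancelled forms are
  compared. That \<open>b\<close> is removable keeps the factors of its right, upper and diagonal
  shifts from vanishing.\<close>

lemma corner_fun_step_inside:
  assumes "\<nu> \<in> rpartitions r" "b \<in> rem_corners r \<nu>" "c \<in> \<nu>" "c \<noteq> b"
  shows "inverse (corner_fun r t1 t2 u (\<nu> - {b}) (weight t1 t2 u c - (t1 + t2)))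
    = zeta t1 t2 (weight t1 t2 u b - weight t1 t2 u c) * inverse (corner_fun r t1 t2 u \<nu> (weight t1 t2 u c - (t1 + t2)))"
proof -
  let ?w = "weight t1 t2 u" and ?t = "t1 + t2" and ?\<nu> = "\<nu> - {b}"
  let ?z = "?w c - ?t"
  note rem = corner_remove[OF assms(2)] and add = corner_remove_add[OF assms(1,2)]
  define g where "g a = ?w c - ?w a" for a
  have nr: "c \<noteq> diag_box d" if "d \<in> rem_corners r \<nu> \<or> d \<in> rem_corners r ?\<nu>" for d
    using that diag_rem_not_add(2)[OF assms(1), of d] diag_rem_not_add(2)[OF rem(1), of d] assms(3,4) by auto
  have nz: "(\<Prod>d\<in>rem_corners r N. g (diag_box d)) \<noteq> 0" if "N = \<nu> \<or> N = ?\<nu>" for N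
  proof -
    have "g (diag_box d) \<noteq> 0" if "d \<in> rem_corners r N" for d
      using nr[of d] that \<open>N = \<nu> \<or> N = ?\<nu>\<close> by (auto simp: g_def weight_eq_iff)
    moreover have "finite (rem_corners r N)" using that assms(1) rem(1) finite_rem_corners by blast
    ultimately show ?thesis by (simp add: prod_zero_iff)
  qed
  have nl: "\<not> box_less b c" by (rule rem_corners_box_less[OF assms(1-3)])
  have g0: "g b \<noteq> 0" "g (diag_box b) \<noteq> 0" "g (right_box b) \<noteq> 0" "g (up_box b) \<noteq> 0"
    using assms(4) nl by (cases b; auto simp: g_def weight_eq_iff)+
  have cf: "corner_fun r t1 t2 u N ?z = (\<Prod>a\<in>add_corners r N. g a) / (\<Prod>d\<in>rem_corners r N. g (diag_box d))" for N
    unfolding corner_fun_def by (intro arg_cong2[where f = "(/)"] prod.cong refl) (simp_all add: g_def weight_shift algebra_simps)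
  have z: "zeta t1 t2 (?w b - ?w c) = g (right_box b) * g (up_box b) / (g b * g (diag_box b))"
  proof -
    have "?w b - ?w c + t1 = - g (right_box b)" "?w b - ?w c + t2 = - g (up_box b)"
      "?w b - ?w c + ?t = - g (diag_box b)" "?w b - ?w c = - g b"
      by (simp_all add: g_def weight_shift)
    then show ?thesis unfolding zeta_def by (simp only: minus_mult_minus)
  qed
  have "inverse (A0 / R0) = (rb * ub / (gb * db)) * inverse (A1 / R1)"
    if "A1 * (gb * db) * R0 = A0 * (rb * ub) * R1" "R0 \<noteq> 0" "R1 \<noteq> 0" "gb \<noteq> 0" "db \<noteq> 0" "rb \<noteq> 0" "ub \<noteq> 0"
    for A0 R0 A1 R1 rb ub gb db :: 'a
  \<comment> \<open>If \<open>A0\<close> vanishes, so does \<open>A1\<close>, and both sides are 0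
    by the convention for \<open>inverse 0\<close>.\<close>
  proof (cases "A0 = 0")
    case True then show ?thesis using that by auto
  next
    case False
    then have "A1 \<noteq> 0" using that by auto
    with False show ?thesis using that by (simp add: divide_simps) (simp add: ac_simps)
  qed
  from this[OF corner_step_prod[OF rem(1) add, of g, unfolded rem(3)] nz[OF disjI2, OF refl] nz[OF disjI1, OF refl] g0]
  show ?thesis unfolding cf z .
qed

text \<open>When \<open>b\<close> is removed, what is left of the shape is \<mu> and the boxes
  removed later. The latter supply the zeta factors of the pairs in which \<open>b\<close> comes
  first.\<close>

lemma rem_prod_plus_step:
  assumes "rem_chain r \<nu> bs" "\<nu> - set bs = \<mu>"
  shows "rem_prod (plus_step r) \<nu> bs
    = pair_prod (\<lambda>x y. zeta t1 t2 (x - y)) (map (weight t1 t2 u) bs)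
      * prod_list (map (\<lambda>b. t1 * t2 / (t1 + t2) * corner_fun r t1 t2 u \<mu> (weight t1 t2 u b)) bs)"
  using assms
proof (induction bs arbitrary: \<nu>)
  case (Cons b bs)
  let ?w = "weight t1 t2 u"
  have c: "rem_chain r (\<nu> - {b}) bs" "b \<in> rem_corners r \<nu>" "\<nu> \<in> rpartitions r" using Cons.prems by auto
  note D = rem_chainD[OF c(1)]
  have \<mu>: "\<nu> - {b} - set bs = \<mu>" using Cons.prems(2) by auto
  have fin: "finite (\<nu> - {b})" using D rpartitions_finite by blast
  have "\<nu> - {b} = \<mu> \<union> set bs" "\<mu> \<inter> set bs = {}" using D \<mu> by auto
  then have "(\<Prod>c\<in>\<nu> - {b}. zeta t1 t2 (?w b - ?w c))
      = (\<Prod>c\<in>\<mu>. zeta t1 t2 (?w b - ?w c)) * (\<Prod>c\<in>set bs. zeta t1 t2 (?w b - ?w c))"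
    using fin by (metis finite_Un prod.union_disjoint)
  also have "(\<Prod>c\<in>set bs. zeta t1 t2 (?w b - ?w c)) = prod_list (map (\<lambda>c. zeta t1 t2 (?w b - ?w c)) bs)"
    using D by (intro prod.distinct_set_conv_list) simp
  finally have "corner_fun r t1 t2 u (\<nu> - {b}) (?w b)
      = prod_list (map (\<lambda>c. zeta t1 t2 (?w b - ?w c)) bs) * corner_fun r t1 t2 u \<mu> (?w b)"
    using corner_fun_outside[of "\<nu> - {b}" r b] corner_fun_outside[of \<mu> r b] D \<mu>
    by (auto simp: ac_simps)
  then show ?case using Cons.IH[OF c(1) \<mu>] by (simp add: plus_step_def comp_def ac_simps)
qed simp

text \<open>Each shape along the chain is \<nu> without the boxes removed earlier, and taking away
  \<open>b\<close> multiplies every later factor by the zeta factor of a pair in which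
  \<open>b\<close> comes first.\<close>

lemma rem_prod_minus_step:
  assumes "rem_chain r \<nu> bs"
  shows "rem_prod (minus_step r) \<nu> bs
    = pair_prod (\<lambda>x y. zeta t1 t2 (x - y)) (map (weight t1 t2 u) bs)
      * prod_list (map (\<lambda>b. t1 * t2 / (t1 + t2) * inverse (corner_fun r t1 t2 u \<nu> (weight t1 t2 u b - (t1 + t2)))) bs)"
  using assms
proof (induction bs arbitrary: \<nu>)
  case (Cons b bs)
  let ?w = "weight t1 t2 u" and ?k = "t1 * t2 / (t1 + t2)"
  have c: "rem_chain r (\<nu> - {b}) bs" "b \<in> rem_corners r \<nu>" "\<nu> \<in> rpartitions r" using Cons.prems by auto
  have D: "set bs \<subseteq> \<nu> - {b}" using rem_chainD[OF c(1)] by simp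
  have "prod_list (map (\<lambda>c. ?k * inverse (corner_fun r t1 t2 u (\<nu> - {b}) (?w c - (t1 + t2)))) bs)
      = prod_list (map (\<lambda>c. zeta t1 t2 (?w b - ?w c)) bs)
      * prod_list (map (\<lambda>c. ?k * inverse (corner_fun r t1 t2 u \<nu> (?w c - (t1 + t2)))) bs)"
    using D
  proof (induction bs)
    case (Cons d ds)
    then have "d \<in> \<nu>" "d \<noteq> b" by auto
    from corner_fun_step_inside[OF c(3,2) this] Cons show ?case by (simp add: ac_simps)
  qed simp
  then show ?case using Cons.IH[OF c(1)]
    by (simp add: minus_step_def comp_def divide_inverse ac_simps)
qed simp

text \<open>In the tableau sums of \<open>C_plus\<close> and \<open>C_minus\<close> the product over pairs of boxes is absorbed by
  evaluating the corner function anew at each step of the chain.\<close>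

definition chain_matrix ::
    "nat \<Rightarrow> nat \<Rightarrow> ('a list \<Rightarrow> 'a) \<Rightarrow> (box set \<Rightarrow> box \<Rightarrow> 'a) \<Rightarrow> box set \<Rightarrow> box set \<Rightarrow> 'a" where
  "chain_matrix r k P s \<nu> \<mu> = (\<Sum>bs\<in>skew_chains r k \<nu> \<mu>.
     P (map (weight t1 t2 u) bs) / gaps (t1 + t2) (map (weight t1 t2 u) bs) * rem_prod s \<nu> bs)"

lemma tableau_sum_eq:
  assumes p: "\<And>z. p z = P (map z [1..<Suc k])"
    and h: "\<And>bs. bs \<in> skew_chains r k \<nu> \<mu> \<Longrightarrow> rem_prod s \<nu> bs
      = pair_prod (\<lambda>x y. zeta t1 t2 (x - y)) (map (weight t1 t2 u) bs) * prod_list (map h (map (weight t1 t2 u) bs))"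
  shows "(if skew_shape r k \<nu> \<mu> then (\<Sum>f\<in>SYT (\<nu> - \<mu>). let \<chi> = syt_weight t1 t2 u (\<nu> - \<mu>) f in
      syt_factor t1 t2 k p \<chi> * (\<Prod>i=1..k. h (\<chi> i))) else 0) = chain_matrix r k P s \<nu> \<mu>"
proof (cases "skew_shape r k \<nu> \<mu>")
  case False
  then have "skew_chains r k \<nu> \<mu> = {}"
    using rem_chains_skew_shape by (auto simp: skew_chains_def)
  then show ?thesis using False by (simp add: chain_matrix_def)
next
  case True
  let ?S = "\<nu> - \<mu>"
  have card: "card ?S = k"
    using True rpartitions_finite[of \<mu> r] by (auto simp: skew_shape_def card_Diff_subset)
  have "chain_matrix r k P s \<nu> \<mu> = (\<Sum>f\<in>SYT ?S. P (map (weight t1 t2 u) (tableau_list ?S f))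
      / gaps (t1 + t2) (map (weight t1 t2 u) (tableau_list ?S f)) * rem_prod s \<nu> (tableau_list ?S f))"
    unfolding chain_matrix_def by (rule sum.reindex_bij_betw[OF bij_betw_tableau_list[OF True], symmetric])
  also have "\<dots> = (\<Sum>f\<in>SYT ?S. let \<chi> = syt_weight t1 t2 u ?S f in
      syt_factor t1 t2 k p \<chi> * (\<Prod>i=1..k. h (\<chi> i)))"
  proof (rule sum.cong[OF refl])
    fix f assume f: "f \<in> SYT ?S"
    let ?\<chi> = "syt_weight t1 t2 u ?S f"
    have m: "map (weight t1 t2 u) (tableau_list ?S f) = map ?\<chi> [1..<Suc k]"
      by (simp add: tableau_list_def card syt_weight_def comp_def del: upt_Suc)
    have "tableau_list ?S f \<in> skew_chains r k \<nu> \<mu>"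
      using bij_betw_tableau_list[OF True] f by (auto simp: bij_betw_def)
    from h[OF this] show "P (map (weight t1 t2 u) (tableau_list ?S f))
        / gaps (t1 + t2) (map (weight t1 t2 u) (tableau_list ?S f)) * rem_prod s \<nu> (tableau_list ?S f)
      = (let \<chi> = ?\<chi> in syt_factor t1 t2 k p \<chi> * (\<Prod>i=1..k. h (\<chi> i)))"
      unfolding m syt_factor_def Let_def p[symmetric] prod_pairs_eq[where g = "\<lambda>x y. zeta t1 t2 (x - y)"]
        prod_gaps_eq prod_rateval_eq[of h ?\<chi> k] by (simp add: ac_simps)
  qed
  finally show ?thesis using True by simp
qed

lemma C_plus_eq:
  assumes p: "\<And>z. p z = P (map z [1..<Suc k])"
  shows "C_plus r t1 t2 u k p \<nu> \<mu> = chain_matrix r k P (plus_step r) \<nu> \<mu>"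
proof -
  let ?h = "\<lambda>z. t1 * t2 / (t1 + t2) * rateval (plus_factor r t1 t2 u \<mu>) z"
  have "rem_prod (plus_step r) \<nu> bs
      = pair_prod (\<lambda>x y. zeta t1 t2 (x - y)) (map (weight t1 t2 u) bs) * prod_list (map ?h (map (weight t1 t2 u) bs))"
    if "bs \<in> skew_chains r k \<nu> \<mu>" for bs
  proof -
    have bs: "rem_chain r \<nu> bs" "\<nu> - set bs = \<mu>" using that by (auto simp: skew_chains_def rem_chains_def)
    have "?h (weight t1 t2 u b) = t1 * t2 / (t1 + t2) * corner_fun r t1 t2 u \<mu> (weight t1 t2 u b)"
      if "b \<in> set bs" for b
      using that bs rem_chainD[OF bs(1)] rateval_plus_factor[of \<mu> r b] by auto
    then have "map ?h (map (weight t1 t2 u) bs)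
        = map (\<lambda>b. t1 * t2 / (t1 + t2) * corner_fun r t1 t2 u \<mu> (weight t1 t2 u b)) bs"
      unfolding map_map by (intro map_cong[OF refl]) (simp only: comp_def)
    then show ?thesis by (simp only: rem_prod_plus_step[OF bs])
  qed
  from tableau_sum_eq[of p P k r \<nu> \<mu> "plus_step r" ?h, OF p this] show ?thesis
    by (simp add: C_plus_def)
qed

lemma C_minus_eq:
  assumes p: "\<And>z. p z = P (map z [1..<Suc k])"
  shows "C_minus r t1 t2 u k p \<mu> \<nu> = chain_matrix r k P (minus_step r) \<nu> \<mu>"
proof -
  let ?h = "\<lambda>z. t1 * t2 / (t1 + t2) * rateval (minus_factor r t1 t2 u \<nu>) z"
  have "rem_prod (minus_step r) \<nu> bs
      = pair_prod (\<lambda>x y. zeta t1 t2 (x - y)) (map (weight t1 t2 u) bs) * prod_list (map ?h (map (weight t1 t2 u) bs))"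
    if "bs \<in> skew_chains r k \<nu> \<mu>" for bs
  proof -
    have bs: "rem_chain r \<nu> bs" using that by (auto simp: skew_chains_def rem_chains_def)
    have "?h (weight t1 t2 u b)
        = t1 * t2 / (t1 + t2) * inverse (corner_fun r t1 t2 u \<nu> (weight t1 t2 u b - (t1 + t2)))"
      if "b \<in> set bs" for b
      using that rem_chainD[OF bs] rateval_minus_factor[of \<nu> r b] by auto
    then have "map ?h (map (weight t1 t2 u) bs)
        = map (\<lambda>b. t1 * t2 / (t1 + t2) * inverse (corner_fun r t1 t2 u \<nu> (weight t1 t2 u b - (t1 + t2)))) bs"
      unfolding map_map by (intro map_cong[OF refl]) (simp only: comp_def)
    then show ?thesis by (simp only: rem_prod_minus_step[OF bs])
  qed
  from tableau_sum_eq[of p P k r \<nu> \<mu> "minus_step r" ?h, OF p this] show ?thesis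
    by (simp add: C_minus_def)
qed

end

section \<open>Characteristic classes of virtual characters\<close>

lemma lookup_character: "Poly_Mapping.lookup (character w) v = of_bool (w = v)"
  by (simp add: character_def lookup_single when_def)

lemma character_mult: "character v * character w = character (v + w)" for v w :: "'a::field"
  by (simp add: character_def mult_single)

lemma one_eq_character: "1 = (character 0 :: 'a::field \<Rightarrow>\<^sub>0 int)"
  by (simp add: character_def)

lemma dual_character: "dual (character w) = character (- w)" for w :: "'a::field"
  using map_key_single[of uminus "- w" "1::int"] by (simp add: dual_def character_def)

lemma dual_add: "dual (V + W) = dual V + dual W" for V W :: "'a::field \<Rightarrow>\<^sub>0 int"
  by (simp add: dual_def map_key_plus)

lemma dual_sum: "dual (\<Sum>x\<in>A. W x) = (\<Sum>x\<in>A. dual (W x))" for W :: "'b \<Rightarrow> ('a::field \<Rightarrow>\<^sub>0 int)"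
proof (induction A rule: infinite_finite_induct)
  case (insert x A)
  then show ?case by (simp add: dual_add)
qed (simp_all add: dual_def)

lemma rank_superset:
  "finite F \<Longrightarrow> Poly_Mapping.keys W \<subseteq> F \<Longrightarrow> rank W = (\<Sum>w\<in>F. Poly_Mapping.lookup W w)"
  unfolding rank_def by (intro sum.mono_neutral_left) (auto simp: in_keys_iff)

lemma rank_add: "rank (V + W) = rank V + rank W"
proof -
  let ?F = "Poly_Mapping.keys V \<union> Poly_Mapping.keys W"
  have "Poly_Mapping.keys (V + W) \<subseteq> ?F" by (rule keys_add)
  then show ?thesis
    by (simp add: rank_superset[of ?F] lookup_add sum.distrib)
qed

lemma rank_taut_class: "rank (taut_class t1 t2 u \<nu>) = int (card \<nu>)"
proof -
  have "rank (\<Sum>b\<in>A. character (w b)) = int (card A)" for A and w :: "box \<Rightarrow> 'a"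
  proof (induction A rule: infinite_finite_induct)
    case (insert x A)
    then show ?case by (simp add: rank_add) (simp add: rank_def character_def)
  qed (simp_all add: rank_def)
  then show ?thesis unfolding taut_class_def .
qed

text \<open>Weights equal to \<open>- m\<close> are skipped, so that the value is multiplicative on all virtual characters.\<close>

definition nonzero_part :: "'a::field \<Rightarrow> 'a" where
  "nonzero_part x = (if x = 0 then 1 else x)"

definition chern_value :: "'a::field \<Rightarrow> ('a \<Rightarrow>\<^sub>0 int) \<Rightarrow> 'a" where
  "chern_value m W = (\<Prod>w\<in>Poly_Mapping.keys W. nonzero_part (m + w) powi Poly_Mapping.lookup W w)"

lemma nonzero_part_nonzero [simp]: "nonzero_part x \<noteq> 0"
  by (simp add: nonzero_part_def)

lemma chern_value_superset:
  "finite F \<Longrightarrow> Poly_Mapping.keys W \<subseteq> F \<Longrightarrow>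
    chern_value m W = (\<Prod>w\<in>F. nonzero_part (m + w) powi Poly_Mapping.lookup W w)"
  unfolding chern_value_def by (intro prod.mono_neutral_left) (auto simp: in_keys_iff)

lemma chern_value_nonzero: "chern_value m W \<noteq> 0"
  by (simp add: chern_value_def prod_zero_iff)

lemma chern_value_add: "chern_value m (V + W) = chern_value m V * chern_value m W"
proof -
  let ?F = "Poly_Mapping.keys V \<union> Poly_Mapping.keys W"
  have "Poly_Mapping.keys (V + W) \<subseteq> ?F" by (rule keys_add)
  then show ?thesis
    by (simp add: chern_value_superset[of ?F] lookup_add power_int_add prod.distrib)
qed

lemma chern_value_0: "chern_value m 0 = 1"
  by (simp add: chern_value_def)

lemma chern_value_diff: "chern_value m (V - W) = chern_value m V / chern_value m W"
  using chern_value_add[of m "V - W" W] chern_value_nonzero[of m W] by simp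

lemma chern_value_sum: "chern_value m (\<Sum>x\<in>A. W x) = (\<Prod>x\<in>A. chern_value m (W x))"
  by (induction A rule: infinite_finite_induct) (simp_all add: chern_value_0 chern_value_add)

lemma chern_value_character: "chern_value m (character w) = nonzero_part (m + w)"
  by (simp add: chern_value_def character_def)

lemma euler_class_eq:
  assumes "Poly_Mapping.lookup W 0 = 0"
  shows "euler_class W = chern_value 0 W"
  unfolding euler_class_def chern_value_def
  using assms by (intro prod.cong refl) (auto simp: in_keys_iff nonzero_part_def)

text \<open>For an effective character the total Chern class is a polynomial of degree at most the
  rank, so the sum cut off there is complete; homogenising it at \<open>1 / m\<close> turns every
  factor \<open>1 + w / m\<close> into \<open>m + w\<close>. For a virtual character the series may
  go on, and the cut-off sum is in general no product.\<close>

lemma chern_polynomial_eq: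
  fixes W :: "'a::field \<Rightarrow>\<^sub>0 int"
  assumes eff: "\<And>w. Poly_Mapping.lookup W w \<ge> 0" and "Poly_Mapping.lookup W (- m) = 0" "m \<noteq> 0"
  shows "(\<Sum>i=0..nat (rank W). chern_class W i * m ^ (nat (rank W) - i)) = chern_value m W"
proof -
  let ?K = "Poly_Mapping.keys W"
  define e where "e w = nat (Poly_Mapping.lookup W w)" for w
  define Q where "Q = (\<Prod>w\<in>?K. [:1, w:] ^ e w)"
  define n where "n = nat (rank W)"
  have "rank W = int (\<Sum>w\<in>?K. e w)" using eff by (simp add: rank_def e_def)
  then have n: "n = (\<Sum>w\<in>?K. e w)" by (simp only: n_def nat_int)
  have pw: "x powi Poly_Mapping.lookup W w = x ^ e w" for x :: "'b::{inverse,power}" and w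
    using eff by (simp add: e_def power_int_def)
  have "fps_of_poly Q = (\<Prod>w\<in>?K. (1 + fps_const w * fps_X) ^ e w)"
    unfolding Q_def fps_of_poly_prod fps_of_poly_power
    by (intro prod.cong refl) (simp add: fps_of_poly_pCons)
  then have c: "chern_class W i = coeff Q i" for i
    unfolding chern_class_def pw by (metis fps_of_poly_nth)
  have "degree Q \<le> (\<Sum>w\<in>?K. degree ([:1, w:] ^ e w))"
    unfolding Q_def by (rule order_trans[OF degree_prod_sum_le]) simp_all
  also have "\<dots> \<le> n" unfolding n
  proof (rule sum_mono)
    fix w
    have "degree ([:1, w:] ^ e w) \<le> degree [:1, w:] * e w" by (rule degree_power_le)
    also have "\<dots> \<le> 1 * e w" by (intro mult_right_mono) auto
    finally show "degree ([:1, w:] ^ e w) \<le> e w" by simp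
  qed
  finally have d: "degree Q \<le> n" .
  have "(\<Sum>i=0..n. coeff Q i * m ^ (n - i)) = m ^ n * (\<Sum>i=0..n. coeff Q i * (1 / m) ^ i)"
    unfolding sum_distrib_left
    by (intro sum.cong refl) (use assms(3) in \<open>simp add: power_diff power_divide\<close>)
  also have "(\<Sum>i=0..n. coeff Q i * (1 / m) ^ i) = poly Q (1 / m)"
    unfolding poly_altdef using d
    by (intro sum.mono_neutral_right) (auto simp: coeff_eq_0)
  also have "m ^ n * poly Q (1 / m) = (\<Prod>w\<in>?K. (m + w) ^ e w)"
    unfolding n power_sum Q_def poly_prod prod.distrib[symmetric] poly_power power_mult_distrib[symmetric]
  proof (intro prod.cong refl)
    fix w
    have "m * poly [:1, w:] (1 / m) = m + w" using assms(3) by (simp add: field_simps)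
    then show "(m * poly [:1, w:] (1 / m)) ^ e w = (m + w) ^ e w" by (simp only:)
  qed
  also have "\<dots> = chern_value m W"
    unfolding chern_value_def pw
  proof (intro prod.cong refl)
    fix w assume "w \<in> ?K"
    then have "m + w \<noteq> 0" using assms(2) by (auto simp: in_keys_iff add_eq_0_iff)
    then show "(m + w) ^ e w = nonzero_part (m + w) ^ e w" by (simp add: nonzero_part_def)
  qed
  finally show ?thesis unfolding n_def[symmetric] c .
qed

section \<open>The Ext bundle at fixed points\<close>

lemma dual_taut_class: "dual (taut_class t1 t2 u \<nu>) = (\<Sum>c\<in>\<nu>. character (- weight t1 t2 u c))"
  by (simp add: taut_class_def dual_sum dual_character)

text \<open>The corner balance of \<mu> absorbs the factor
  \<open>(1 - character (- t1)) * (1 - character (- t2))\<close>. The result is additive in the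
  boxes of \<nu>, so a box added to \<nu> brings weights indexed by the corners of \<mu>. The roles
  are exchanged in \<open>ext_class_corners_fst\<close>.\<close>

lemma ext_class_corners_snd:
  assumes "\<mu> \<in> rpartitions r"
  shows "ext_class r t1 t2 u u' \<nu> \<mu>
    = (\<Sum>b\<in>\<nu>. character (weight t1 t2 u b)) * ((\<Sum>a\<in>add_corners r \<mu>. character (- weight t1 t2 u' a))
        - (\<Sum>c\<in>rem_corners r \<mu>. character (- weight t1 t2 u' c - (t1 + t2))))
      + (\<Sum>i<r. character (u i - (t1 + t2))) * (\<Sum>c\<in>\<mu>. character (- weight t1 t2 u' c))"
proof -
  let ?e = "\<lambda>b. character (- weight t1 t2 u' b)"
  have "(1 - character (- t1)) * (1 - character (- t2)) * ?e c
      = ?e c + ?e (diag_box c) - ?e (right_box c) - ?e (up_box c)" for c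
    by (simp add: algebra_simps one_eq_character character_mult weight_shift)
  then have N: "(1 - character (- t1)) * (1 - character (- t2)) * (\<Sum>c\<in>\<mu>. ?e c)
      = (\<Sum>c\<in>\<mu>. ?e c) + (\<Sum>c\<in>\<mu>. ?e (diag_box c)) - (\<Sum>c\<in>\<mu>. ?e (right_box c)) - (\<Sum>c\<in>\<mu>. ?e (up_box c))"
    unfolding sum_distrib_left by (simp add: sum.distrib sum_subtractf)
  have R: "(\<Sum>c\<in>rem_corners r \<mu>. character (- weight t1 t2 u' c - (t1 + t2))) = (\<Sum>c\<in>rem_corners r \<mu>. ?e (diag_box c))"
    by (intro sum.cong refl arg_cong[where f = character]) (simp add: weight_shift)
  have O: "(\<Sum>i<r. ?e (i, 0, 0)) = (\<Sum>i<r. character (- u' i))" by (simp add: weight_origin)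
  have "Z - (A + B - C - D) = P - Q" if "P + A + B = Q + Z + C + D" for A B C D P Q Z :: "'a \<Rightarrow>\<^sub>0 int"
    using that by (simp add: algebra_simps)
  from this[OF corner_sum[OF assms, of ?e, unfolded O]]
  have W: "(\<Sum>i<r. character (- u' i)) - (1 - character (- t1)) * (1 - character (- t2)) * (\<Sum>c\<in>\<mu>. ?e c)
      = (\<Sum>a\<in>add_corners r \<mu>. ?e a) - (\<Sum>c\<in>rem_corners r \<mu>. ?e (diag_box c))"
    unfolding N .
  have "(\<Sum>i<r. V * f i + g i * U) - q * (V * U) = V * ((\<Sum>i<r. f i) - q * U) + (\<Sum>i<r. g i) * U"
    for V U q :: "'a \<Rightarrow>\<^sub>0 int" and f g
    unfolding sum.distrib sum_distrib_left[symmetric] sum_distrib_right[symmetric]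
    by (simp add: algebra_simps)
  then show ?thesis
    unfolding ext_class_def Let_def dual_taut_class R W[symmetric]
    unfolding taut_class_def .
qed

lemma ext_class_corners_fst:
  assumes "\<nu> \<in> rpartitions r"
  shows "ext_class r t1 t2 u u' \<nu> \<mu>
    = (\<Sum>c\<in>\<mu>. character (- weight t1 t2 u' c)) * ((\<Sum>a\<in>add_corners r \<nu>. character (weight t1 t2 u a - (t1 + t2)))
        - (\<Sum>c\<in>rem_corners r \<nu>. character (weight t1 t2 u c)))
      + (\<Sum>b\<in>\<nu>. character (weight t1 t2 u b)) * (\<Sum>i<r. character (- u' i))"
proof -
  let ?e = "\<lambda>b. character (weight t1 t2 u b - (t1 + t2))"
  have "(1 - character (- t1)) * (1 - character (- t2)) * character (weight t1 t2 u c)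
      = ?e c + ?e (diag_box c) - ?e (right_box c) - ?e (up_box c)" for c
    by (simp add: algebra_simps one_eq_character character_mult weight_shift)
  then have N: "(1 - character (- t1)) * (1 - character (- t2)) * (\<Sum>c\<in>\<nu>. character (weight t1 t2 u c))
      = (\<Sum>c\<in>\<nu>. ?e c) + (\<Sum>c\<in>\<nu>. ?e (diag_box c)) - (\<Sum>c\<in>\<nu>. ?e (right_box c)) - (\<Sum>c\<in>\<nu>. ?e (up_box c))"
    unfolding sum_distrib_left by (simp add: sum.distrib sum_subtractf)
  have R: "(\<Sum>c\<in>rem_corners r \<nu>. character (weight t1 t2 u c)) = (\<Sum>c\<in>rem_corners r \<nu>. ?e (diag_box c))"
    by (intro sum.cong refl) (simp add: weight_shift)
  have O: "(\<Sum>i<r. ?e (i, 0, 0)) = (\<Sum>i<r. character (u i - (t1 + t2)))" by (simp add: weight_origin)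
  have "Z - (A + B - C - D) = P - Q" if "P + A + B = Q + Z + C + D" for A B C D P Q Z :: "'a \<Rightarrow>\<^sub>0 int"
    using that by (simp add: algebra_simps)
  from this[OF corner_sum[OF assms, of ?e, unfolded O]]
  have W: "(\<Sum>i<r. character (u i - (t1 + t2)))
      - (1 - character (- t1)) * (1 - character (- t2)) * (\<Sum>c\<in>\<nu>. character (weight t1 t2 u c))
      = (\<Sum>a\<in>add_corners r \<nu>. ?e a) - (\<Sum>c\<in>rem_corners r \<nu>. ?e (diag_box c))"
    unfolding N .
  have "(\<Sum>i<r. V * f i + g i * U) - q * (V * U) = U * ((\<Sum>i<r. g i) - q * V) + V * (\<Sum>i<r. f i)"
    for V U q :: "'a \<Rightarrow>\<^sub>0 int" and f g
    unfolding sum.distrib sum_distrib_left[symmetric] sum_distrib_right[symmetric]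
    by (simp add: algebra_simps)
  then show ?thesis
    unfolding ext_class_def Let_def dual_taut_class R W[symmetric]
    unfolding taut_class_def .
qed

lemma chern_value_insert_fst:
  assumes "\<mu> \<in> rpartitions r" "finite \<nu>" "b \<notin> \<nu>"
  shows "chern_value m (ext_class r t1 t2 u u' (insert b \<nu>) \<mu>) = chern_value m (ext_class r t1 t2 u u' \<nu> \<mu>)
    * ((\<Prod>a\<in>add_corners r \<mu>. nonzero_part (m + (weight t1 t2 u b - weight t1 t2 u' a)))
      / (\<Prod>c\<in>rem_corners r \<mu>. nonzero_part (m + (weight t1 t2 u b - weight t1 t2 u' c - (t1 + t2)))))"
proof -
  have "ext_class r t1 t2 u u' (insert b \<nu>) \<mu> = ext_class r t1 t2 u u' \<nu> \<mu>
      + ((\<Sum>a\<in>add_corners r \<mu>. character (weight t1 t2 u b - weight t1 t2 u' a))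
        - (\<Sum>c\<in>rem_corners r \<mu>. character (weight t1 t2 u b - weight t1 t2 u' c - (t1 + t2))))"
    using assms(2,3)
    by (simp add: ext_class_corners_snd[OF assms(1)] algebra_simps sum_distrib_left sum.distrib character_mult)
  then show ?thesis
    by (simp only: chern_value_add chern_value_diff chern_value_sum chern_value_character)
qed

lemma chern_value_insert_snd:
  assumes "\<nu> \<in> rpartitions r" "finite \<mu>" "b \<notin> \<mu>"
  shows "chern_value m (ext_class r t1 t2 u u' \<nu> (insert b \<mu>)) = chern_value m (ext_class r t1 t2 u u' \<nu> \<mu>)
    * ((\<Prod>a\<in>add_corners r \<nu>. nonzero_part (m + (weight t1 t2 u a - (t1 + t2) - weight t1 t2 u' b)))
      / (\<Prod>c\<in>rem_corners r \<nu>. nonzero_part (m + (weight t1 t2 u c - weight t1 t2 u' b))))"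
proof -
  have "ext_class r t1 t2 u u' \<nu> (insert b \<mu>) = ext_class r t1 t2 u u' \<nu> \<mu>
      + ((\<Sum>a\<in>add_corners r \<nu>. character (weight t1 t2 u a - (t1 + t2) - weight t1 t2 u' b))
        - (\<Sum>c\<in>rem_corners r \<nu>. character (weight t1 t2 u c - weight t1 t2 u' b)))"
    using assms(2,3)
    by (simp add: ext_class_corners_fst[OF assms(1)] algebra_simps sum_distrib_left sum.distrib character_mult)
  then show ?thesis
    by (simp only: chern_value_add chern_value_diff chern_value_sum chern_value_character)
qed

text \<open>The left summand indexes pairs with an addable box of \<mu>, the right one the terms
  with the framing weights; the negative weights belong to pairs with a removable box of
  \<mu>.\<close>

definition pos_weight ::
    "'a::field \<Rightarrow> 'a \<Rightarrow> (nat \<Rightarrow> 'a) \<Rightarrow> (nat \<Rightarrow> 'a) \<Rightarrow> (box \<times> box) + (nat \<times> box) \<Rightarrow> 'a" where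
  "pos_weight t1 t2 u u' = case_sum (\<lambda>(b, a). weight t1 t2 u b - weight t1 t2 u' a)
     (\<lambda>(i, c). u i - (t1 + t2) - weight t1 t2 u' c)"

lemma lookup_ext_class:
  assumes "\<nu> \<in> rpartitions r" "\<mu> \<in> rpartitions r"
  shows "Poly_Mapping.lookup (ext_class r t1 t2 u u' \<nu> \<mu>) w
    = (\<Sum>x\<in>\<nu> \<times> add_corners r \<mu> <+> {..<r} \<times> \<mu>. of_bool (pos_weight t1 t2 u u' x = w))
    - (\<Sum>(b, c)\<in>\<nu> \<times> rem_corners r \<mu>. of_bool (weight t1 t2 u b - weight t1 t2 u' c - (t1 + t2) = w))"
proof -
  have fin: "finite \<nu>" "finite \<mu>" "finite (add_corners r \<mu>)" "finite (rem_corners r \<mu>)"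
    using assms rpartitions_finite finite_add_corners finite_rem_corners by blast+
  have "ext_class r t1 t2 u u' \<nu> \<mu>
    = (\<Sum>(b, a)\<in>\<nu> \<times> add_corners r \<mu>. character (weight t1 t2 u b - weight t1 t2 u' a))
    - (\<Sum>(b, c)\<in>\<nu> \<times> rem_corners r \<mu>. character (weight t1 t2 u b - weight t1 t2 u' c - (t1 + t2)))
    + (\<Sum>(i, c)\<in>{..<r} \<times> \<mu>. character (u i - (t1 + t2) - weight t1 t2 u' c))"
    unfolding ext_class_corners_snd[OF assms(2)] right_diff_distrib sum_product character_mult sum.cartesian_product
    by (simp add: algebra_simps)
  then show ?thesis
    using fin by (simp add: lookup_add lookup_minus lookup_sum lookup_character sum.Plus pos_weight_def case_prod_unfold del: sum_of_bool_eq)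
qed

subsection \<open>Effectivity\<close>

definition col_height :: "box set \<Rightarrow> nat \<Rightarrow> nat \<Rightarrow> nat" where
  "col_height \<mu> j x = (LEAST y. (j, x, y) \<notin> \<mu>)"

definition row_length :: "box set \<Rightarrow> nat \<Rightarrow> nat \<Rightarrow> nat" where
  "row_length \<mu> j y = (LEAST x. (j, x, y) \<notin> \<mu>)"

lemma col_height_less_iff:
  assumes "\<mu> \<in> rpartitions r"
  shows "(j, x, y) \<in> \<mu> \<longleftrightarrow> y < col_height \<mu> j x"
proof
  have "finite ((\<lambda>y. (j, x, y)) -` \<mu>)"
    using rpartitions_finite[OF assms] by (intro finite_vimageI) (auto simp: inj_def)
  then obtain y0 where "(j, x, y0) \<notin> \<mu>" using ex_new_if_finite[OF infinite_UNIV_nat] by blast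
  then have L: "(j, x, col_height \<mu> j x) \<notin> \<mu>" unfolding col_height_def by (rule LeastI)
  show "y < col_height \<mu> j x" if "(j, x, y) \<in> \<mu>"
    using L rpartitions_down[OF assms that order_refl, of "col_height \<mu> j x"] by (cases "y < col_height \<mu> j x") auto
  show "(j, x, y) \<in> \<mu>" if "y < col_height \<mu> j x"
    using not_less_Least[of y "\<lambda>y. (j, x, y) \<notin> \<mu>"] that unfolding col_height_def by blast
qed

lemma row_length_less_iff:
  assumes "\<mu> \<in> rpartitions r"
  shows "(j, x, y) \<in> \<mu> \<longleftrightarrow> x < row_length \<mu> j y"
proof
  have "finite ((\<lambda>x. (j, x, y)) -` \<mu>)"
    using rpartitions_finite[OF assms] by (intro finite_vimageI) (auto simp: inj_def)
  then obtain x0 where "(j, x0, y) \<notin> \<mu>" using ex_new_if_finite[OF infinite_UNIV_nat] by blast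
  then have L: "(j, row_length \<mu> j y, y) \<notin> \<mu>" unfolding row_length_def by (rule LeastI)
  show "x < row_length \<mu> j y" if "(j, x, y) \<in> \<mu>"
    using L rpartitions_down[OF assms that _ order_refl, of "row_length \<mu> j y"] by (cases "x < row_length \<mu> j y") auto
  show "(j, x, y) \<in> \<mu>" if "x < row_length \<mu> j y"
    using not_less_Least[of x "\<lambda>x. (j, x, y) \<notin> \<mu>"] that unfolding row_length_def by blast
qed

text \<open>A negative weight, given by \<open>b\<close> in \<open>\<nu>\<close> and a removable box \<open>c\<close> of \<open>\<mu>\<close>, cancels against the
  positive one obtained by sliding both boxes down or left until \<open>diag_box c\<close> becomes an addable
  box of \<open>\<mu>\<close>; if neither is possible inside the quadrant, it cancels against the box \<open>c - b\<close> of \<open>\<mu>\<close>.\<close>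

fun slide :: "box set \<Rightarrow> box \<times> box \<Rightarrow> (box \<times> box) + (nat \<times> box)" where
  "slide \<mu> ((i, b1, b2), (j, c1, c2)) =
    (if b2 \<le> c2 \<and> c1 < b1 then
       Inl ((i, b1 + row_length \<mu> j (Suc c2) - Suc c1, b2), (j, row_length \<mu> j (Suc c2), Suc c2))
     else if Suc c2 \<le> b2 + col_height \<mu> j (Suc c1) then
       Inl ((i, b1, b2 + col_height \<mu> j (Suc c1) - Suc c2), (j, Suc c1, col_height \<mu> j (Suc c1)))
     else Inr (i, (j, c1 - b1, c2 - b2)))"

text \<open>A negative weight is the weight of \<open>b\<close> minus that of
  \<open>diag_box c\<close>, which is unchanged when both boxes move by the same vector. Since
  \<open>c\<close> is removable, \<open>l \<le> c1\<close> and \<open>h \<le> c2\<close>; the moves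
  go left or down, so \<open>b\<close> stays in \<nu>.\<close>

lemma slide_facts:
  assumes part: "\<nu> \<in> rpartitions r" "\<mu> \<in> rpartitions r"
    and b: "(i, b1, b2) \<in> \<nu>" and c: "(j, c1, c2) \<in> rem_corners r \<mu>"
  shows "slide \<mu> ((i, b1, b2), (j, c1, c2)) \<in> \<nu> \<times> add_corners r \<mu> <+> {..<r} \<times> \<mu>"
    and "pos_weight t1 t2 u u' (slide \<mu> ((i, b1, b2), (j, c1, c2)))
      = weight t1 t2 u (i, b1, b2) - weight t1 t2 u' (j, c1, c2) - (t1 + t2)"
proof -
  define h where "h = col_height \<mu> j (Suc c1)"
  define l where "l = row_length \<mu> j (Suc c2)"
  note cm = c[unfolded rem_corners_iff[OF part(2)]]
  have lt: "i < r" "j < r" using rpartitions_less[OF part(1) b] rpartitions_less[OF part(2)] cm by auto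
  have hc: "h \<le> c2" using cm unfolding h_def col_height_less_iff[OF part(2)] by simp
  have lc: "l \<le> c1" using cm unfolding l_def row_length_less_iff[OF part(2)] by simp
  have A1: "(j, Suc c1, h) \<in> add_corners r \<mu>"
    unfolding add_corners_iff[OF part(2)] diff_Suc_1
    using lt(2) rpartitions_down[OF part(2), of j c1 c2 c1 h] cm hc
    by (auto simp: col_height_less_iff[OF part(2), of j "Suc c1"] h_def)
  have A2: "(j, l, Suc c2) \<in> add_corners r \<mu>"
    unfolding add_corners_iff[OF part(2)] diff_Suc_1
    using lt(2) rpartitions_down[OF part(2), of j c1 c2 l c2] cm lc
    by (auto simp: row_length_less_iff[OF part(2), of j _ "Suc c2"] l_def)
  have N: "(i, x, y) \<in> \<nu>" if "x \<le> b1" "y \<le> b2" for x y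
    using rpartitions_down[OF part(1) b that] .
  have M: "(j, x, y) \<in> \<mu>" if "x \<le> c1" "y \<le> c2" for x y
    using rpartitions_down[OF part(2) _ that] cm by blast
  show "slide \<mu> ((i, b1, b2), (j, c1, c2)) \<in> \<nu> \<times> add_corners r \<mu> <+> {..<r} \<times> \<mu>"
    using A1 A2 lt hc lc by (auto simp: h_def[symmetric] l_def[symmetric] intro!: InlI InrI N M)
  show "pos_weight t1 t2 u u' (slide \<mu> ((i, b1, b2), (j, c1, c2)))
      = weight t1 t2 u (i, b1, b2) - weight t1 t2 u' (j, c1, c2) - (t1 + t2)"
    using hc lc by (auto simp: h_def[symmetric] l_def[symmetric] pos_weight_def weight_def of_nat_diff algebra_simps)
qed

text \<open>A slide to the left ends in the row above \<open>c\<close>, a slide down in the column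
  to its right, and a removable box is determined by its row or by its column. The first test of
  \<open>slide\<close> keeps left and down images apart.\<close>

lemma inj_on_slide:
  assumes part: "\<mu> \<in> rpartitions r"
  shows "inj_on (slide \<mu>) (\<nu> \<times> rem_corners r \<mu>)"
proof (rule inj_onI)
  fix p q assume pq: "p \<in> \<nu> \<times> rem_corners r \<mu>" "q \<in> \<nu> \<times> rem_corners r \<mu>" "slide \<mu> p = slide \<mu> q"
  obtain i b1 b2 j c1 c2 where p: "p = ((i, b1, b2), (j, c1, c2))" by (metis prod_cases3 surj_pair)
  obtain i' b1' b2' j' c1' c2' where q: "q = ((i', b1', b2'), (j', c1', c2'))" by (metis prod_cases3 surj_pair)
  have c: "(j, c1, c2) \<in> rem_corners r \<mu>" and c': "(j', c1', c2') \<in> rem_corners r \<mu>"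
    and e: "slide \<mu> ((i, b1, b2), j, c1, c2) = slide \<mu> ((i', b1', b2'), j', c1', c2')"
    using pq unfolding p q by blast+
  note cm = c[unfolded rem_corners_iff[OF part]] and cm' = c'[unfolded rem_corners_iff[OF part]]
  have ij: "i' = i" "j' = j" using e by (auto split: if_splits)
  let ?h = "col_height \<mu> j" and ?l = "row_length \<mu> j"
  have 1: "c1 < ?l c2" "\<not> c1 < ?l (Suc c2)" "c1' < ?l c2'" "\<not> c1' < ?l (Suc c2')"
    "\<not> Suc c1 < ?l c2" "\<not> Suc c1' < ?l c2'"
    using cm cm' unfolding ij row_length_less_iff[OF part] by auto
  have 2: "c2 < ?h c1" "\<not> c2 < ?h (Suc c1)" "c2' < ?h c1'" "\<not> c2' < ?h (Suc c1')"
    "\<not> Suc c2 < ?h c1" "\<not> Suc c2' < ?h c1'"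
    using cm cm' unfolding ij col_height_less_iff[OF part] by auto
  have same_row: "c1 = c1'" if "c2 = c2'" using 1 that by simp
  have same_col: "c2 = c2'" if "c1 = c1'" using 2 that by simp
  have next_col: "c2' < ?h (Suc c1)" if "c1 < c1'"
    using rpartitions_down[OF part, of j c1' c2' "Suc c1" c2'] cm' that ij col_height_less_iff[OF part] by auto
  have next_col': "c2 < ?h (Suc c1')" if "c1' < c1"
    using rpartitions_down[OF part, of j c1 c2 "Suc c1'" c2] cm that ij col_height_less_iff[OF part] by auto
  note ne = e[unfolded ij slide.simps]
  let ?P = "b2 \<le> c2 \<and> c1 < b1" and ?V = "Suc c2 \<le> b2 + ?h (Suc c1)"
  let ?P' = "b2' \<le> c2' \<and> c1' < b1'" and ?V' = "Suc c2' \<le> b2' + ?h (Suc c1')"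
  consider (left) ?P ?P' | (left_down) ?P "\<not> ?P'" | (down_left) "\<not> ?P" ?P'
    | (down) "\<not> ?P" ?V "\<not> ?P'" | (out) "\<not> ?P" "\<not> ?V" "\<not> ?P'" by blast
  then have "b1 = b1' \<and> b2 = b2' \<and> c1 = c1' \<and> c2 = c2'"
  proof cases
    case left
    then show ?thesis using ne same_row by auto
  next
    case left_down
    then show ?thesis using ne 1 2 by (cases ?V') auto
  next
    case down_left
    then show ?thesis using ne 1 2 by (cases ?V) auto
  next
    case down
    then show ?thesis using ne same_col by (cases ?V') auto
  next
    case out
    then have V': "\<not> ?V'" using ne by auto
    then have d: "c1 - b1 = c1' - b1'" "c2 - b2 = c2' - b2'" using ne out by auto
    \<comment> \<open>Otherwise the column after \<open>c1\<close> is higher than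
      \<open>c2'\<close>, and failing the second test gives \<open>c2 - b2 > c2'\<close>, against
      the equality of the differences.\<close>
    have "\<not> c1 < c1'" using next_col out V' d by auto
    moreover have "\<not> c1' < c1" using next_col' out V' d by auto
    ultimately have "c1 = c1'" by simp
    then show ?thesis using same_col d out V' by auto
  qed
  then show "p = q" using ij by (simp add: p q)
qed

lemma lookup_ext_class_nonneg:
  assumes "\<nu> \<in> rpartitions r" "\<mu> \<in> rpartitions r"
  shows "Poly_Mapping.lookup (ext_class r t1 t2 u u' \<nu> \<mu>) w \<ge> 0"
proof -
  let ?P = "\<nu> \<times> add_corners r \<mu> <+> {..<r} \<times> \<mu>" and ?N = "\<nu> \<times> rem_corners r \<mu>"
  have fin: "finite ?P"
    using assms rpartitions_finite finite_add_corners by (intro finite_Plus) blast+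
  have "(\<Sum>(b, c)\<in>?N. (of_bool (weight t1 t2 u b - weight t1 t2 u' c - (t1 + t2) = w) :: int))
      = (\<Sum>x\<in>?N. of_bool (pos_weight t1 t2 u u' (slide \<mu> x) = w))"
  proof (intro sum.cong refl)
    fix x assume x: "x \<in> ?N"
    obtain i b1 b2 j c1 c2 where e: "x = ((i, b1, b2), (j, c1, c2))" by (metis prod_cases3 surj_pair)
    have "(i, b1, b2) \<in> \<nu>" "(j, c1, c2) \<in> rem_corners r \<mu>" using x e by auto
    from slide_facts(2)[OF assms this, of t1 t2 u u']
    show "(case x of (b, c) \<Rightarrow> (of_bool (weight t1 t2 u b - weight t1 t2 u' c - (t1 + t2) = w) :: int))
        = of_bool (pos_weight t1 t2 u u' (slide \<mu> x) = w)"
      unfolding e by (simp only: prod.case)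
  qed
  also have "\<dots> = (\<Sum>x\<in>slide \<mu> ` ?N. of_bool (pos_weight t1 t2 u u' x = w))"
    using sum.reindex[OF inj_on_slide[OF assms(2)], of "\<lambda>x. of_bool (pos_weight t1 t2 u u' x = w) :: int" \<nu>]
    by (simp only: comp_def)
  also have "\<dots> \<le> (\<Sum>x\<in>?P. of_bool (pos_weight t1 t2 u u' x = w))"
  proof (rule sum_mono2[OF fin])
    show "slide \<mu> ` ?N \<subseteq> ?P" using slide_facts(1)[OF assms] by (auto simp del: slide.simps)
  qed simp
  finally show ?thesis unfolding lookup_ext_class[OF assms] by simp
qed

text \<open>The fixed points are isolated. No cancellation is involved: each positive and each
  negative term already has a nonzero weight.\<close>

lemma lookup_tangent_class_0:
  assumes "generic_weights t1 t2 u" "\<nu> \<in> rpartitions r"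
  shows "Poly_Mapping.lookup (ext_class r t1 t2 u u \<nu> \<nu>) 0 = 0"
proof -
  interpret generic_weights t1 t2 u by fact
  have "pos_weight t1 t2 u u x \<noteq> 0" if x: "x \<in> \<nu> \<times> add_corners r \<nu> <+> {..<r} \<times> \<nu>" for x
  proof (cases x)
    case (Inl p)
    obtain b a where p: "p = (b, a)" by (cases p)
    have "b \<in> \<nu>" "a \<notin> \<nu>" using x Inl p by (auto simp: add_corners_def)
    then show ?thesis using Inl p by (auto simp: pos_weight_def weight_eq_iff)
  next
    case (Inr p)
    obtain i c where p: "p = (i, c)" by (cases p)
    have "diag_box c \<noteq> (i, 0, 0)" by (cases c) simp
    then have "weight t1 t2 u (diag_box c) \<noteq> weight t1 t2 u (i, 0, 0)" by (simp only: weight_eq_iff not_False_eq_True)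
    then show ?thesis using Inr p by (auto simp: pos_weight_def weight_shift weight_origin algebra_simps)
  qed
  moreover have "weight t1 t2 u b - weight t1 t2 u c - (t1 + t2) \<noteq> 0" if "b \<in> \<nu>" "c \<in> rem_corners r \<nu>" for b c
  proof -
    have "b \<noteq> diag_box c" using diag_rem_not_add(2)[OF assms(2) that(2)] that(1) by auto
    then have "weight t1 t2 u c + (t1 + t2) \<noteq> weight t1 t2 u b" by (simp only: weight_add_t_eq_iff not_False_eq_True)
    then show ?thesis by (auto simp: algebra_simps)
  qed
  ultimately have "(\<Sum>x\<in>\<nu> \<times> add_corners r \<nu> <+> {..<r} \<times> \<nu>. of_bool (pos_weight t1 t2 u u x = 0)) = (0 :: int)"
    "(\<Sum>(b, c)\<in>\<nu> \<times> rem_corners r \<nu>. of_bool (weight t1 t2 u b - weight t1 t2 u c - (t1 + t2) = 0)) = (0 :: int)"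
    by (intro sum.neutral ballI; auto)+
  then show ?thesis
    unfolding lookup_ext_class[OF assms(2,2)] by (simp only: diff_self)
qed

lemma tangent_class_eq: "tangent_class r t1 t2 u \<nu> = ext_class r t1 t2 u u \<nu> \<nu>"
  by (simp add: tangent_class_def ext_class_def)

section \<open>Matrices acting on the Fock space\<close>

lemma rem_chain_rev:
  "rem_chain r \<nu> bs \<and> \<nu> - set bs = \<mu> \<longleftrightarrow> add_chain r \<mu> (rev bs) \<and> \<mu> \<union> set bs = \<nu>"
proof (induction bs arbitrary: \<nu>)
  case Nil
  then show ?case by auto
next
  case (Cons b bs)
  show ?case
  proof
    assume A: "rem_chain r \<nu> (b # bs) \<and> \<nu> - set (b # bs) = \<mu>"
    then have b: "b \<in> rem_corners r \<nu>" "\<nu> \<in> rpartitions r" by auto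
    have "rem_chain r (\<nu> - {b}) bs \<and> \<nu> - {b} - set bs = \<mu>" using A by auto
    then have "add_chain r \<mu> (rev bs)" "\<mu> \<union> set bs = \<nu> - {b}" using Cons.IH by blast+
    moreover have "b \<in> add_corners r (\<nu> - {b})" "insert b (\<nu> - {b}) = \<nu>"
      using corner_remove_add[OF b(2,1)] corner_remove(3)[OF b(1)] by auto
    ultimately show "add_chain r \<mu> (rev (b # bs)) \<and> \<mu> \<union> set (b # bs) = \<nu>"
      by (auto simp: add_chain_snoc)
  next
    assume A: "add_chain r \<mu> (rev (b # bs)) \<and> \<mu> \<union> set (b # bs) = \<nu>"
    then have B: "add_chain r \<mu> (rev bs)" "b \<in> add_corners r (\<mu> \<union> set bs)" "\<nu> = insert b (\<mu> \<union> set bs)"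
      by (auto simp: add_chain_snoc)
    have p: "\<mu> \<union> set bs \<in> rpartitions r" using add_chainD[OF B(1)] by simp
    note C = corner_insert[OF B(2)] corner_insert_rem[OF p B(2)]
    have "rem_chain r (\<mu> \<union> set bs) bs \<and> \<mu> \<union> set bs - set bs = \<mu>" using Cons.IH B(1) by blast
    then show "rem_chain r \<nu> (b # bs) \<and> \<nu> - set (b # bs) = \<mu>"
      using C unfolding B(3) by (auto simp del: Un_iff)
  qed
qed

lemma rem_prod_rev:
  assumes "rem_chain r \<nu> bs"
  shows "rem_prod s \<nu> bs = add_prod s (\<nu> - set bs) (rev bs)"
  using assms
proof (induction bs arbitrary: \<nu>)
  case (Cons b bs)
  note D = rem_chainD[OF Cons.prems]
  have e: "\<nu> - {b} - set bs = \<nu> - set (b # bs)" by auto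
  have i: "insert b ((\<nu> - set (b # bs)) \<union> set bs) = \<nu>" using D by auto
  have "rem_prod s (\<nu> - {b}) bs = add_prod s (\<nu> - set (b # bs)) (rev bs)"
    using Cons.IH[of "\<nu> - {b}"] Cons.prems unfolding e by simp
  then show ?case
    using i by (simp add: add_prod_snoc mult.commute)
qed simp

text \<open>Finite rows let the matrix act on the completion, finite columns preserve finite
  support, and the last condition keeps the support within the r-partitions. All three together are
  stable under transposition.\<close>

definition regular_matrix :: "nat \<Rightarrow> (box set \<Rightarrow> box set \<Rightarrow> 'a::field) \<Rightarrow> bool" where
  "regular_matrix r M \<longleftrightarrow> (\<forall>\<nu>. finite {\<mu>. M \<nu> \<mu> \<noteq> 0}) \<and> (\<forall>\<mu>. finite {\<nu>. M \<nu> \<mu> \<noteq> 0}) \<and>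
     (\<forall>\<nu> \<mu>. M \<nu> \<mu> \<noteq> 0 \<longrightarrow> (\<nu> \<in> rpartitions r \<longleftrightarrow> \<mu> \<in> rpartitions r))"

lemma regular_matrixD:
  assumes "regular_matrix r M"
  shows "finite {\<mu>. M \<nu> \<mu> \<noteq> 0}" "finite {\<nu>. M \<nu> \<mu> \<noteq> 0}"
    "M \<nu> \<mu> \<noteq> 0 \<Longrightarrow> \<nu> \<in> rpartitions r \<longleftrightarrow> \<mu> \<in> rpartitions r"
  using assms unfolding regular_matrix_def by blast+

lemma regular_matrix_transpose: "regular_matrix r M \<Longrightarrow> regular_matrix r (\<lambda>\<mu> \<nu>. M \<nu> \<mu>)"
  unfolding regular_matrix_def by blast

lemma regular_matrix_diag: "regular_matrix r (\<lambda>\<nu> \<mu>. if \<nu> = \<mu> then c \<nu> else 0)"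
proof -
  have "finite {\<mu>. (if \<nu> = \<mu> then c \<nu> else 0) \<noteq> 0}" "finite {\<nu>. (if \<nu> = \<mu> then c \<nu> else 0) \<noteq> 0}" for \<nu> \<mu>
    by (rule finite_subset[of _ "{\<nu>}"]; auto)(rule finite_subset[of _ "{\<mu>}"]; auto)
  then show ?thesis unfolding regular_matrix_def by auto
qed

lemma regular_matrix_diff:
  assumes "regular_matrix r M" "regular_matrix r N"
  shows "regular_matrix r (\<lambda>\<nu> \<mu>. M \<nu> \<mu> - N \<nu> \<mu>)"
proof -
  have "finite {\<mu>. M \<nu> \<mu> - N \<nu> \<mu> \<noteq> 0}" for \<nu>
    by (rule finite_subset[of _ "{\<mu>. M \<nu> \<mu> \<noteq> 0} \<union> {\<mu>. N \<nu> \<mu> \<noteq> 0}"])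
       (use regular_matrixD(1)[OF assms(1)] regular_matrixD(1)[OF assms(2)] in auto)
  moreover have "finite {\<nu>. M \<nu> \<mu> - N \<nu> \<mu> \<noteq> 0}" for \<mu>
    by (rule finite_subset[of _ "{\<nu>. M \<nu> \<mu> \<noteq> 0} \<union> {\<nu>. N \<nu> \<mu> \<noteq> 0}"])
       (use regular_matrixD(2)[OF assms(1)] regular_matrixD(2)[OF assms(2)] in auto)
  ultimately show ?thesis
    using regular_matrixD(3)[OF assms(1)] regular_matrixD(3)[OF assms(2)]
    unfolding regular_matrix_def by (metis diff_self)
qed

lemma op_of_matrix_sum:
  assumes "finite S" "{\<mu>. M \<nu> \<mu> \<noteq> 0} \<subseteq> S"
  shows "op_of_matrix M F \<nu> = (\<Sum>\<mu>\<in>S. M \<nu> \<mu> * F \<mu>)"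
  unfolding op_of_matrix_def using assms by (intro Sum_any.expand_superset) auto

lemma op_of_matrix_diff:
  assumes "regular_matrix r M" "regular_matrix r N"
  shows "op_of_matrix (\<lambda>\<nu> \<mu>. M \<nu> \<mu> - N \<nu> \<mu>) F \<nu> = op_of_matrix M F \<nu> - op_of_matrix N F \<nu>"
proof -
  let ?S = "{\<mu>. M \<nu> \<mu> \<noteq> 0} \<union> {\<mu>. N \<nu> \<mu> \<noteq> 0}"
  have "finite ?S" using assms regular_matrixD(1) by blast
  then show ?thesis
    by (subst (1 2 3) op_of_matrix_sum[of ?S]) (auto simp: sum_subtractf algebra_simps)
qed

lemma op_of_matrix_diag: "op_of_matrix (\<lambda>\<nu> \<mu>. if \<nu> = \<mu> then c \<nu> else 0) F \<nu> = c \<nu> * F \<nu>"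
  by (subst op_of_matrix_sum[of "{\<nu>}"]) auto

lemma op_of_matrix_diag_transpose: "op_of_matrix (\<lambda>\<mu> \<nu>. if \<nu> = \<mu> then c \<nu> else 0) F \<nu> = c \<nu> * F \<nu>"
  by (subst op_of_matrix_sum[of "{\<nu>}"]) auto

text \<open>The kernel of A has infinite rows, so the sum runs over the support of the argument
  instead, which is finite on \<open>fock\<close>.\<close>

definition op_of_kernel :: "(box set \<Rightarrow> box set \<Rightarrow> 'a::field) \<Rightarrow> 'a fockvec \<Rightarrow> 'a fockvec" where
  "op_of_kernel K \<alpha> = (\<lambda>\<nu>. \<Sum>\<mu> | \<alpha> \<mu> \<noteq> 0. K \<nu> \<mu> * \<alpha> \<mu>)"

lemma op_of_kernel_sum:
  assumes "finite S" "{\<mu>. \<alpha> \<mu> \<noteq> 0} \<subseteq> S"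
  shows "op_of_kernel K \<alpha> \<nu> = (\<Sum>\<mu>\<in>S. K \<nu> \<mu> * \<alpha> \<mu>)"
  unfolding op_of_kernel_def using assms by (intro sum.mono_neutral_left) auto

lemma op_of_matrix_kernel:
  assumes "regular_matrix r M" "\<alpha> \<in> fock r"
  shows "op_of_matrix M (op_of_kernel K \<alpha>) \<nu> = (\<Sum>\<mu> | \<alpha> \<mu> \<noteq> 0. op_of_matrix M (\<lambda>\<nu>. K \<nu> \<mu>) \<nu> * \<alpha> \<mu>)"
proof -
  have f: "finite {\<mu>. M \<nu> \<mu> \<noteq> 0}" using regular_matrixD(1)[OF assms(1)] .
  show ?thesis
    unfolding op_of_matrix_sum[where S = "{\<mu>. M \<nu> \<mu> \<noteq> 0}" and \<nu> = \<nu> and M = M, OF f order_refl] op_of_kernel_def sum_distrib_left sum_distrib_right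
    by (subst sum.swap) (simp add: mult.assoc)
qed

lemma op_of_matrix_fock:
  fixes M :: "box set \<Rightarrow> box set \<Rightarrow> 'a::field"
  assumes "regular_matrix r M" "\<alpha> \<in> fock r"
  shows "finite (\<Union>\<mu>\<in>{\<mu>. \<alpha> \<mu> \<noteq> 0}. {\<nu>. M \<nu> \<mu> \<noteq> 0})"
    and "{\<nu>. op_of_matrix M \<alpha> \<nu> \<noteq> 0} \<subseteq> (\<Union>\<mu>\<in>{\<mu>. \<alpha> \<mu> \<noteq> 0}. {\<nu>. M \<nu> \<mu> \<noteq> 0})"
    and "op_of_matrix M \<alpha> \<in> fock r"
proof -
  let ?S = "\<Union>\<mu>\<in>{\<mu>. \<alpha> \<mu> \<noteq> 0}. {\<nu>. M \<nu> \<mu> \<noteq> 0}"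
  show f: "finite ?S"
    using assms regular_matrixD(2)[OF assms(1)] by (intro finite_UN_I) (auto simp: fock_def)
  have nz: "\<exists>\<mu>. \<alpha> \<mu> \<noteq> 0 \<and> M \<nu> \<mu> \<noteq> 0" if "op_of_matrix M \<alpha> \<nu> \<noteq> 0" for \<nu>
  proof (rule ccontr)
    assume "\<not> (\<exists>\<mu>. \<alpha> \<mu> \<noteq> 0 \<and> M \<nu> \<mu> \<noteq> 0)"
    then have "(\<lambda>\<mu>. M \<nu> \<mu> * \<alpha> \<mu>) = (\<lambda>_. 0)" by (auto simp: fun_eq_iff)
    then have "op_of_matrix M \<alpha> \<nu> = Sum_any (\<lambda>_ :: box set. 0 :: 'a)"
      unfolding op_of_matrix_def by (rule arg_cong)
    then have "op_of_matrix M \<alpha> \<nu> = 0" by simp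
    with that show False by simp
  qed
  then show s: "{\<nu>. op_of_matrix M \<alpha> \<nu> \<noteq> 0} \<subseteq> ?S" by blast
  have "\<nu> \<in> rpartitions r" if \<nu>: "op_of_matrix M \<alpha> \<nu> \<noteq> 0" for \<nu>
  proof -
    obtain \<mu> where \<mu>: "\<alpha> \<mu> \<noteq> 0" "M \<nu> \<mu> \<noteq> 0" using nz[OF \<nu>] by blast
    then have "\<mu> \<in> rpartitions r" using assms(2) by (auto simp: fock_def)
    then show ?thesis using regular_matrixD(3)[OF assms(1) \<mu>(2)] by simp
  qed
  then show "op_of_matrix M \<alpha> \<in> fock r"
    using finite_subset[OF s f] by (auto simp: fock_def)
qed

lemma op_of_kernel_matrix:
  assumes "regular_matrix r M" "\<alpha> \<in> fock r"
  shows "op_of_kernel K (op_of_matrix M \<alpha>) \<nu> = (\<Sum>\<mu> | \<alpha> \<mu> \<noteq> 0. op_of_matrix (\<lambda>\<mu> \<mu>'. M \<mu>' \<mu>) (K \<nu>) \<mu> * \<alpha> \<mu>)"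
proof -
  let ?S = "\<Union>\<mu>\<in>{\<mu>. \<alpha> \<mu> \<noteq> 0}. {\<nu>. M \<nu> \<mu> \<noteq> 0}"
  note F = op_of_matrix_fock[OF assms]
  have fin: "finite {\<mu>. \<alpha> \<mu> \<noteq> 0}" using assms(2) by (simp add: fock_def)
  have "op_of_matrix M \<alpha> \<mu>' = (\<Sum>\<mu> | \<alpha> \<mu> \<noteq> 0. M \<mu>' \<mu> * \<alpha> \<mu>)" for \<mu>'
    unfolding op_of_matrix_def by (rule Sum_any.expand_superset[OF fin]) auto
  then have "op_of_kernel K (op_of_matrix M \<alpha>) \<nu> = (\<Sum>\<mu>'\<in>?S. \<Sum>\<mu> | \<alpha> \<mu> \<noteq> 0. K \<nu> \<mu>' * (M \<mu>' \<mu> * \<alpha> \<mu>))"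
    unfolding op_of_kernel_sum[OF F(1,2)] by (simp add: sum_distrib_left)
  also have "\<dots> = (\<Sum>\<mu> | \<alpha> \<mu> \<noteq> 0. \<Sum>\<mu>'\<in>?S. K \<nu> \<mu>' * (M \<mu>' \<mu> * \<alpha> \<mu>))" by (rule sum.swap)
  also have "\<dots> = (\<Sum>\<mu> | \<alpha> \<mu> \<noteq> 0. op_of_matrix (\<lambda>\<mu> \<mu>'. M \<mu>' \<mu>) (K \<nu>) \<mu> * \<alpha> \<mu>)"
  proof (rule sum.cong[OF refl])
    fix \<mu> assume "\<mu> \<in> {\<mu>. \<alpha> \<mu> \<noteq> 0}"
    then have "{\<mu>'. M \<mu>' \<mu> \<noteq> 0} \<subseteq> ?S" by blast
    from op_of_matrix_sum[of ?S "\<lambda>\<mu> \<mu>'. M \<mu>' \<mu>" \<mu> "K \<nu>", OF F(1) this]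
    show "(\<Sum>\<mu>'\<in>?S. K \<nu> \<mu>' * (M \<mu>' \<mu> * \<alpha> \<mu>)) = op_of_matrix (\<lambda>\<mu> \<mu>'. M \<mu>' \<mu>) (K \<nu>) \<mu> * \<alpha> \<mu>"
      by (simp only: sum_distrib_right) (simp add: ac_simps)
  qed
  finally show ?thesis .
qed

text \<open>Reduces a commutator to its coefficients at pairs of fixed points: \<open>M\<close> acts
  on the kernel in the first argument, the transpose of \<open>M'\<close> in the second.\<close>

lemma commutator_kernel:
  assumes "regular_matrix r M" "regular_matrix r M'" "\<alpha> \<in> fock r"
  shows "commutator (op_of_matrix M) (op_of_matrix M') (op_of_kernel K) \<alpha> \<nu>
    = (\<Sum>\<mu> | \<alpha> \<mu> \<noteq> 0. (op_of_matrix M (\<lambda>\<nu>. K \<nu> \<mu>) \<nu> - op_of_matrix (\<lambda>\<mu> \<mu>'. M' \<mu>' \<mu>) (K \<nu>) \<mu>) * \<alpha> \<mu>)"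
  unfolding commutator_def op_of_matrix_kernel[OF assms(1,3)] op_of_kernel_matrix[OF assms(2,3)]
  by (simp add: sum_subtractf left_diff_distrib)

section \<open>Heisenberg and Virasoro operators as matrices of chain sums\<close>

context generic_weights
begin

definition chain_term :: "('a list \<Rightarrow> 'a) \<Rightarrow> 'a list \<Rightarrow> 'a" where
  "chain_term P zs = P zs / gaps (t1 + t2) zs"

lemma regular_chain_matrix: "regular_matrix r (chain_matrix r k P s)"
proof -
  have "finite {\<mu>. chain_matrix r k P s \<nu> \<mu> \<noteq> 0}" for \<nu>
  proof (rule finite_subset)
    show "{\<mu>. chain_matrix r k P s \<nu> \<mu> \<noteq> 0} \<subseteq> (\<lambda>bs. \<nu> - set bs) ` rem_chains r k \<nu>"
      by (auto simp: chain_matrix_def skew_chains_def elim!: sum.not_neutral_contains_not_neutral)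
  qed (simp add: finite_rem_chains)
  moreover have "finite {\<nu>. chain_matrix r k P s \<nu> \<mu> \<noteq> 0}" for \<mu>
  proof (rule finite_subset)
    show "{\<nu>. chain_matrix r k P s \<nu> \<mu> \<noteq> 0} \<subseteq> (\<lambda>bs. \<mu> \<union> set bs) ` add_chains r k \<mu>"
    proof
      fix \<nu> assume "\<nu> \<in> {\<nu>. chain_matrix r k P s \<nu> \<mu> \<noteq> 0}"
      then obtain bs where "bs \<in> skew_chains r k \<nu> \<mu>"
        by (auto simp: chain_matrix_def elim!: sum.not_neutral_contains_not_neutral)
      then have "rem_chain r \<nu> bs \<and> \<nu> - set bs = \<mu>" "length bs = k"
        by (auto simp: skew_chains_def rem_chains_def)
      then have "rev bs \<in> add_chains r k \<mu>" "\<mu> \<union> set (rev bs) = \<nu>"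
        unfolding rem_chain_rev by (auto simp: add_chains_def)
      then show "\<nu> \<in> (\<lambda>bs. \<mu> \<union> set bs) ` add_chains r k \<mu>" by blast
    qed
  qed (simp add: finite_add_chains)
  moreover have "\<nu> \<in> rpartitions r \<and> \<mu> \<in> rpartitions r" if nz: "chain_matrix r k P s \<nu> \<mu> \<noteq> 0" for \<nu> \<mu>
  proof -
    obtain bs where "bs \<in> skew_chains r k \<nu> \<mu>"
      using nz by (auto simp: chain_matrix_def elim!: sum.not_neutral_contains_not_neutral)
    then have "rem_chain r \<nu> bs" "\<nu> - set bs = \<mu>" by (auto simp: skew_chains_def rem_chains_def)
    then show ?thesis using rem_chainD by blast
  qed
  ultimately show ?thesis unfolding regular_matrix_def by blast
qed

lemma op_of_chain_matrix:
  "op_of_matrix (chain_matrix r k P s) F \<nu>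
    = (\<Sum>bs\<in>rem_chains r k \<nu>. chain_term P (map (weight t1 t2 u) bs) * rem_prod s \<nu> bs * F (\<nu> - set bs))"
proof -
  let ?S = "(\<lambda>bs. \<nu> - set bs) ` rem_chains r k \<nu>"
  have sub: "{\<mu>. chain_matrix r k P s \<nu> \<mu> \<noteq> 0} \<subseteq> ?S"
    by (auto simp: chain_matrix_def skew_chains_def elim!: sum.not_neutral_contains_not_neutral)
  have "op_of_matrix (chain_matrix r k P s) F \<nu> = (\<Sum>\<mu>\<in>?S. chain_matrix r k P s \<nu> \<mu> * F \<mu>)"
    using sub by (intro op_of_matrix_sum) (simp_all add: finite_rem_chains)
  also have "\<dots> = (\<Sum>\<mu>\<in>?S. \<Sum>bs | bs \<in> rem_chains r k \<nu> \<and> \<nu> - set bs = \<mu>.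
      chain_term P (map (weight t1 t2 u) bs) * rem_prod s \<nu> bs * F (\<nu> - set bs))"
    unfolding chain_matrix_def skew_chains_def sum_distrib_right chain_term_def
    by (intro sum.cong refl) auto
  also have "\<dots> = (\<Sum>bs\<in>rem_chains r k \<nu>. chain_term P (map (weight t1 t2 u) bs) * rem_prod s \<nu> bs * F (\<nu> - set bs))"
    by (rule sum.group) (auto simp: finite_rem_chains)
  finally show ?thesis .
qed

lemma op_of_chain_matrix_transpose:
  "op_of_matrix (\<lambda>\<mu> \<nu>. chain_matrix r k P s \<nu> \<mu>) F \<mu>
    = (\<Sum>bs\<in>add_chains r k \<mu>. chain_term P (rev (map (weight t1 t2 u) bs)) * add_prod s \<mu> bs * F (\<mu> \<union> set bs))"
proof -
  let ?S = "(\<lambda>bs. \<mu> \<union> set bs) ` add_chains r k \<mu>"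
  let ?G = "\<lambda>bs. chain_term P (rev (map (weight t1 t2 u) bs)) * add_prod s \<mu> bs"
  have m: "chain_matrix r k P s \<nu> \<mu> = (\<Sum>bs | bs \<in> add_chains r k \<mu> \<and> \<mu> \<union> set bs = \<nu>. ?G bs)" for \<nu>
    unfolding chain_matrix_def
  proof (rule sum.reindex_bij_witness[of _ rev rev])
    fix bs assume "bs \<in> skew_chains r k \<nu> \<mu>"
    then have A: "rem_chain r \<nu> bs" "\<nu> - set bs = \<mu>" "length bs = k"
      by (auto simp: skew_chains_def rem_chains_def)
    then show "rev bs \<in> {bs \<in> add_chains r k \<mu>. \<mu> \<union> set bs = \<nu>}"
      using rem_chain_rev[of r \<nu> bs \<mu>] by (auto simp: add_chains_def)
    show "?G (rev bs) = P (map (weight t1 t2 u) bs) / gaps (t1 + t2) (map (weight t1 t2 u) bs) * rem_prod s \<nu> bs"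
      using rem_prod_rev[OF A(1), of s] A(2) by (simp add: chain_term_def rev_map)
  next
    fix bs assume "bs \<in> {bs \<in> add_chains r k \<mu>. \<mu> \<union> set bs = \<nu>}"
    then show "rev bs \<in> skew_chains r k \<nu> \<mu>"
      using rem_chain_rev[of r \<nu> "rev bs" \<mu>] by (auto simp: add_chains_def skew_chains_def rem_chains_def)
  qed simp_all
  have sub: "{\<nu>. chain_matrix r k P s \<nu> \<mu> \<noteq> 0} \<subseteq> ?S"
    unfolding m by (auto elim!: sum.not_neutral_contains_not_neutral)
  have "op_of_matrix (\<lambda>\<mu> \<nu>. chain_matrix r k P s \<nu> \<mu>) F \<mu> = (\<Sum>\<nu>\<in>?S. chain_matrix r k P s \<nu> \<mu> * F \<nu>)"
    using sub by (intro op_of_matrix_sum) (simp_all add: finite_add_chains)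
  also have "\<dots> = (\<Sum>\<nu>\<in>?S. \<Sum>bs | bs \<in> add_chains r k \<mu> \<and> \<mu> \<union> set bs = \<nu>. ?G bs * F (\<mu> \<union> set bs))"
    unfolding m sum_distrib_right by (intro sum.cong refl) auto
  also have "\<dots> = (\<Sum>bs\<in>add_chains r k \<mu>. ?G bs * F (\<mu> \<union> set bs))"
    by (rule sum.group) (auto simp: finite_add_chains)
  finally show ?thesis .
qed

definition L_list :: "nat \<Rightarrow> nat \<Rightarrow> 'a list \<Rightarrow> 'a" where
  "L_list r k zs = (ends zs - (of_nat k - 1) * of_nat r * (t1 + t2)) / (2 * t1 * t2)"

lemma L_poly_eq: "k > 0 \<Longrightarrow> L_poly r t1 t2 k z = L_list r k (map z [1..<Suc k])"
  by (simp add: L_poly_def L_list_def ends_def hd_map last_map del: upt_Suc)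

definition B_matrix :: "nat \<Rightarrow> int \<Rightarrow> box set \<Rightarrow> box set \<Rightarrow> 'a" where
  "B_matrix r n = (if n < 0 then chain_matrix r (nat (- n)) (\<lambda>_. 1) (plus_step r)
     else if n > 0 then (\<lambda>\<mu> \<nu>. chain_matrix r (nat n) (\<lambda>_. 1) (minus_step r) \<nu> \<mu>)
     else (\<lambda>\<nu> \<mu>. if \<nu> = \<mu> then - (\<Sum>i<r. ubar r t1 t2 u i) else 0))"

definition L_zero :: "nat \<Rightarrow> box set \<Rightarrow> 'a" where
  "L_zero r \<nu> = of_nat (card \<nu>) + of_nat r * ((of_nat r)\<^sup>2 - 1) * (t1 + t2)\<^sup>2 / (24 * t1 * t2)
     - 1 / (2 * t1 * t2) * (\<Sum>i<r. (ubar r t1 t2 u i)\<^sup>2)"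

definition L_matrix :: "nat \<Rightarrow> int \<Rightarrow> box set \<Rightarrow> box set \<Rightarrow> 'a" where
  "L_matrix r n = (if n < 0 then chain_matrix r (nat (- n)) (L_list r (nat (- n))) (plus_step r)
     else if n > 0 then (\<lambda>\<mu> \<nu>. chain_matrix r (nat n) (L_list r (nat n)) (minus_step r) \<nu> \<mu>)
     else (\<lambda>\<nu> \<mu>. if \<nu> = \<mu> then L_zero r \<nu> else 0))"

lemma regular_B_matrix: "regular_matrix r (B_matrix r n)"
  by (simp add: B_matrix_def regular_chain_matrix regular_matrix_transpose[OF regular_chain_matrix]
      regular_matrix_diag[of r "\<lambda>_. - (\<Sum>i<r. ubar r t1 t2 u i)"])

lemma regular_L_matrix: "regular_matrix r (L_matrix r n)"
  by (simp add: L_matrix_def regular_chain_matrix regular_matrix_transpose[OF regular_chain_matrix]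
      regular_matrix_diag)

lemma B_op_eq: "B_op r t1 t2 u n = op_of_matrix (B_matrix r n)"
proof -
  have p: "C_plus r t1 t2 u k (\<lambda>_. 1) = chain_matrix r k (\<lambda>_. 1) (plus_step r)" for k
    by (intro ext C_plus_eq) simp
  have m: "C_minus r t1 t2 u k (\<lambda>_. 1) = (\<lambda>\<mu> \<nu>. chain_matrix r k (\<lambda>_. 1) (minus_step r) \<nu> \<mu>)" for k
    by (intro ext C_minus_eq) simp
  show ?thesis
    using op_of_matrix_diag[of "\<lambda>_. - (\<Sum>i<r. ubar r t1 t2 u i)"]
    by (auto simp: B_op_def B_matrix_def p m fun_eq_iff)
qed

lemma L_op_eq: "L_op r t1 t2 u n = op_of_matrix (L_matrix r n)"
proof -
  have p: "C_plus r t1 t2 u k (L_poly r t1 t2 k) = chain_matrix r k (L_list r k) (plus_step r)" if "k > 0" for k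
    by (intro ext C_plus_eq L_poly_eq that)
  have m: "C_minus r t1 t2 u k (L_poly r t1 t2 k) = (\<lambda>\<mu> \<nu>. chain_matrix r k (L_list r k) (minus_step r) \<nu> \<mu>)"
    if "k > 0" for k
    by (intro ext C_minus_eq L_poly_eq that)
  consider "n < 0" | "n > 0" | "n = 0" by linarith
  then show ?thesis
  proof cases
    case 1 then show ?thesis using p[of "nat (- n)"] by (simp add: L_op_def L_matrix_def)
  next
    case 2 then show ?thesis using m[of "nat n"] by (simp add: L_op_def L_matrix_def)
  next
    case 3 then show ?thesis
      by (simp add: L_op_def L_matrix_def fun_eq_iff op_of_matrix_diag L_zero_def)
  qed
qed

end

section \<open>Commutators with a kernel expressed by mixed sums\<close>

context kernel
begin

text \<open>Unlike in \<open>mixed_sum\<close>, the weights of the boxes added to \<open>\<mu>\<close> are not shifted by \<open>m\<close>.\<close>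

definition remove_sum :: "(nat \<Rightarrow> 'a list \<Rightarrow> 'a) \<Rightarrow> nat \<Rightarrow> box set \<Rightarrow> box set \<Rightarrow> 'a" where
  "remove_sum P k \<nu> \<mu> = (\<Sum>bs\<in>rem_chains r k \<nu>. fst.chain_term (P k) (map \<chi> bs) * rem_prod s \<nu> bs * K (\<nu> - set bs) \<mu>)"

definition add_sum :: "(nat \<Rightarrow> 'a list \<Rightarrow> 'a) \<Rightarrow> nat \<Rightarrow> box set \<Rightarrow> box set \<Rightarrow> 'a" where
  "add_sum P k \<nu> \<mu> = (\<Sum>bs\<in>add_chains r k \<mu>. snd.chain_term (P k) (rev (map \<chi>' bs)) * add_prod s' \<mu> bs * K \<nu> (\<mu> \<union> set bs))"

abbreviation "one_list \<equiv> \<lambda>(k :: nat) (_ :: 'a list). 1 :: 'a"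

context
  fixes \<nu> \<mu> assumes part: "\<nu> \<in> rpartitions r" "\<mu> \<in> rpartitions r"
begin

lemma remove_sum_eq: "remove_sum P k \<nu> \<mu> = mixed_sum \<nu> \<mu> k 0 (P k)"
  unfolding remove_sum_def mixed_sum_def add_chains_0[OF part(2)] fst.chain_term_def
  by (simp add: chain_coeff_def chain_weights_def ac_simps)

lemma rev_map_shift: "rev (map (\<lambda>b. \<chi>' b - m) bs) = map (\<lambda>z. z - m) (rev (map \<chi>' bs))"
  by (simp add: rev_map comp_def)

lemma add_sum_one: "add_sum one_list k \<nu> \<mu> = mixed_sum \<nu> \<mu> 0 k (\<lambda>_. 1)"
  unfolding add_sum_def mixed_sum_def rem_chains_0[OF part(1)] snd.chain_term_def
  by (simp add: chain_coeff_def chain_weights_def rev_map_shift gaps_shift ac_simps)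

text \<open>Gaps depend only on differences, but \<open>ends\<close> grows by \<open>2 * m\<close>
  when its two weights are shifted back. This is one source of the B operators on the right of the
  Virasoro relation.\<close>

lemma add_sum_ends:
  assumes "k > 0"
  shows "add_sum (\<lambda>_. ends) k \<nu> \<mu> = mixed_sum \<nu> \<mu> 0 k ends + 2 * m * mixed_sum \<nu> \<mu> 0 k (\<lambda>_. 1)"
proof -
  have "fst.chain_term ends (rev (map \<chi>' bs)) = ends (rev (map (\<lambda>b. \<chi>' b - m) bs)) / gaps t (rev (map (\<lambda>b. \<chi>' b - m) bs))
      + 2 * m * (1 / gaps t (rev (map (\<lambda>b. \<chi>' b - m) bs)))" if "bs \<in> add_chains r k \<mu>" for bs
  proof -
    have "rev (map \<chi>' bs) \<noteq> []" using that assms by (auto simp: add_chains_def)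
    then have "ends (rev (map \<chi>' bs)) = ends (map (\<lambda>z. z - m) (rev (map \<chi>' bs))) + 2 * m"
      by (simp add: ends_def hd_map last_map)
    then show ?thesis
      unfolding fst.chain_term_def rev_map_shift gaps_shift by (simp add: add_divide_distrib)
  qed
  then have e: "fst.chain_term ends (rev (map \<chi>' bs)) * add_prod s' \<mu> bs * K \<nu> (\<mu> \<union> set bs)
      = chain_coeff \<nu> \<mu> [] bs * (ends (chain_weights [] bs) / gaps t (chain_weights [] bs))
      + 2 * m * (chain_coeff \<nu> \<mu> [] bs * (1 / gaps t (chain_weights [] bs)))" if "bs \<in> add_chains r k \<mu>" for bs
    using that by (simp add: chain_coeff_def chain_weights_def algebra_simps)
  show ?thesis
    unfolding add_sum_def mixed_sum_def rem_chains_0[OF part(1)] sum_distrib_left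
    using e by (simp add: sum.distrib)
qed

lemma chain_term_L_list:
  "fst.chain_term (fst.L_list r k) zs = (fst.chain_term ends zs - (of_nat k - 1) * of_nat r * t * fst.chain_term (\<lambda>_. 1) zs) / (2 * t1 * t2)"
proof -
  have "((e - c) / d) / g = (e / g - c * (1 / g)) / d" for e c d g :: 'a
    by (simp add: diff_divide_distrib[symmetric] mult.commute)
  then show ?thesis unfolding fst.chain_term_def fst.L_list_def .
qed

lemma remove_sum_L:
  "remove_sum (fst.L_list r) k \<nu> \<mu> = (remove_sum (\<lambda>_. ends) k \<nu> \<mu> - (of_nat k - 1) * of_nat r * t * remove_sum one_list k \<nu> \<mu>) / (2 * t1 * t2)"
  unfolding remove_sum_def chain_term_L_list sum_distrib_left sum_subtractf[symmetric] sum_divide_distrib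
  by (intro sum.cong refl) (simp add: algebra_simps)

lemma add_sum_L:
  "add_sum (fst.L_list r) k \<nu> \<mu> = (add_sum (\<lambda>_. ends) k \<nu> \<mu> - (of_nat k - 1) * of_nat r * t * add_sum one_list k \<nu> \<mu>) / (2 * t1 * t2)"
  unfolding add_sum_def chain_term_L_list sum_distrib_left sum_subtractf[symmetric] sum_divide_distrib
  by (intro sum.cong refl) (simp add: algebra_simps)

lemma add_sum_one_eq:
  "k > 0 \<Longrightarrow> add_sum one_list k \<nu> \<mu> = remove_sum one_list k \<nu> \<mu> - K \<nu> \<mu> * \<phi> r"
  using mixed_sum_one[OF part, of "k - 1"] by (simp add: remove_sum_eq add_sum_one algebra_simps)

lemma L_sum_one:
  "2 * t1 * t2 * (remove_sum (fst.L_list r) 1 \<nu> \<mu> - add_sum (fst.L_list r) 1 \<nu> \<mu>)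
    = K \<nu> \<mu> * ((\<phi> r)\<^sup>2 + 2 * t1 * t2 * (of_nat (card \<nu>) - of_nat (card \<mu>))
        + (\<Sum>i<r. (u' i - m)\<^sup>2) - (\<Sum>i<r. (u i - t)\<^sup>2))
      - 2 * m * add_sum one_list 1 \<nu> \<mu>"
proof -
  have nz: "2 * t1 * t2 \<noteq> 0" using fst.t_nonzero by simp
  have c: "c * (x / c - y / c) = x - y" if "c \<noteq> 0" for c x y :: 'a
    using that by (simp add: diff_divide_distrib[symmetric])
  have "of_nat 1 - 1 = (0 :: 'a)" by simp
  then show ?thesis
    unfolding remove_sum_L add_sum_L c[OF nz]
    using mixed_sum_base(2)[OF part]
    by (simp add: remove_sum_eq add_sum_ends add_sum_one)
qed

text \<open>The normalising term \<open>(k - 1) r t\<close> grows by \<open>r t\<close> per step and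
  turns the constant difference \<open>K \<nu> \<mu> * \<phi> r\<close> of the B sums into
  \<open>r t \<phi> r\<close> times \<open>K \<nu> \<mu>\<close>. The other terms are the residues
  at the two ends and, with the factor m, the shift of the weights.\<close>

lemma L_sum_Suc:
  assumes "k > 0"
  shows "2 * t1 * t2 * ((remove_sum (fst.L_list r) (Suc k) \<nu> \<mu> - remove_sum (fst.L_list r) k \<nu> \<mu>)
      - (add_sum (fst.L_list r) (Suc k) \<nu> \<mu> - add_sum (fst.L_list r) k \<nu> \<mu>))
    = K \<nu> \<mu> * ((\<phi> r)\<^sup>2 - t * \<phi> r - of_nat r * t * \<phi> r)
      - 2 * t * add_sum one_list k \<nu> \<mu>
      - 2 * m * (add_sum one_list (Suc k) \<nu> \<mu> - add_sum one_list k \<nu> \<mu>)"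
proof -
  have nz: "2 * t1 * t2 \<noteq> 0" using fst.t_nonzero by simp
  have c: "c * ((x1 / c - x2 / c) - (x3 / c - x4 / c)) = (x1 - x3) - (x2 - x4)" if "c \<noteq> 0" for c x1 x2 x3 x4 :: 'a
    using that by (simp add: diff_divide_distrib[symmetric])
  obtain n where n: "k = Suc n" using assms by (cases k) auto
  define F where "F = \<phi> r"
  define ME A where "ME j l = mixed_sum \<nu> \<mu> j l ends" and "A l = mixed_sum \<nu> \<mu> 0 l (\<lambda>_. 1)" for j l
  have one: "mixed_sum \<nu> \<mu> l 0 (\<lambda>_. 1) = A l + K \<nu> \<mu> * F" if "l > 0" for l
    using mixed_sum_one[OF part, of "l - 1"] that by (simp add: A_def F_def algebra_simps)
  have ends: "ME (Suc k) 0 = ME 0 (Suc k) + (ME k 0 - ME 0 k)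
      + (F - t) * (A k + K \<nu> \<mu> * F) - (F + t) * A k"
    using mixed_sum_ends[OF part, of n] one[OF assms]
    by (simp add: n ME_def A_def[symmetric] F_def[symmetric]) (simp add: algebra_simps)
  show ?thesis
    unfolding remove_sum_L add_sum_L c[OF nz] unfolding remove_sum_eq add_sum_one add_sum_ends[OF assms]
      add_sum_ends[OF zero_less_Suc] ME_def[symmetric] one[OF assms] one[OF zero_less_Suc] A_def[symmetric] F_def[symmetric] ends
    by (simp add: power2_eq_square algebra_simps)
qed

end

end

section \<open>The Ext operator\<close>

lemma finite_rpartitions_card: "finite {\<mu>. \<mu> \<in> rpartitions r \<and> card \<mu> = d}"
proof (rule finite_subset)
  show "{\<mu>. \<mu> \<in> rpartitions r \<and> card \<mu> = d} \<subseteq> Pow ({..<r} \<times> {..<d} \<times> {..<d})"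
  proof (intro subsetI PowI)
    fix \<mu> b assume \<mu>: "\<mu> \<in> {\<mu>. \<mu> \<in> rpartitions r \<and> card \<mu> = d}" and b: "b \<in> \<mu>"
    obtain i x y where e: "b = (i, x, y)" by (cases b)
    have p: "\<mu> \<in> rpartitions r" "card \<mu> = d" using \<mu> by auto
    have "(\<lambda>x'. (i, x', y)) ` {..x} \<subseteq> \<mu>" "(\<lambda>y'. (i, x, y')) ` {..y} \<subseteq> \<mu>"
      using rpartitions_down[OF p(1)] b e by auto
    then have "card ((\<lambda>x'. (i, x', y)) ` {..x}) \<le> d" "card ((\<lambda>y'. (i, x, y')) ` {..y}) \<le> d"
      using card_mono[OF rpartitions_finite[OF p(1)]] p(2) by blast+
    then have "x < d" "y < d" by (auto simp: card_image inj_on_def)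
    then show "b \<in> {..<r} \<times> {..<d} \<times> {..<d}"
      using rpartitions_less[OF p(1)] b e by auto
  qed
qed simp

context generic_pair
begin

definition ext_kernel :: "nat \<Rightarrow> box set \<Rightarrow> box set \<Rightarrow> 'a" where
  "ext_kernel r \<nu> \<mu> = (if \<nu> \<in> rpartitions r
     then chern_value m (ext_class r t1 t2 u u' \<nu> \<mu>) / chern_value 0 (ext_class r t1 t2 u' u' \<mu> \<mu>) else 0)"

lemma lookup_ext_class_generic:
  assumes "\<nu> \<in> rpartitions r" "\<mu> \<in> rpartitions r"
  shows "Poly_Mapping.lookup (ext_class r t1 t2 u u' \<nu> \<mu>) (- m) = 0"
proof -
  have n: "\<chi> b - \<chi>' a \<noteq> - m" "\<chi> b - \<chi>' a - t \<noteq> - m" "u i - t - \<chi>' a \<noteq> - m" for b a i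
    using weight_shift_neq(1)[of b a] weight_shift_neq(3)[of b a] weight_shift_neq(3)[of "(i, 0, 0)" a]
    by (auto simp: algebra_simps weight_origin)
  have "pos_weight t1 t2 u u' x \<noteq> - m" for x
    using n by (auto simp: pos_weight_def split: sum.splits)
  then have "(\<Sum>x\<in>\<nu> \<times> add_corners r \<mu> <+> {..<r} \<times> \<mu>. of_bool (pos_weight t1 t2 u u' x = - m)) = (0 :: int)"
    by (intro sum.neutral) simp
  moreover have "(\<Sum>(b, c)\<in>\<nu> \<times> rem_corners r \<mu>. of_bool (\<chi> b - \<chi>' c - t = - m)) = (0 :: int)"
    using n(2) by (intro sum.neutral) auto
  ultimately show ?thesis
    unfolding lookup_ext_class[OF assms] by (simp only: diff_self)
qed

text \<open>The normalised Chern polynomial and the push-forward carry the same sign, so it cancels.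
  Effectivity and the genericity of m make the Chern polynomial a product of nonzero
  factors.\<close>

lemma ext_kernel_eq:
  assumes "\<nu> \<in> rpartitions r" "\<mu> \<in> rpartitions r" "m \<noteq> 0"
  shows "(- 1) ^ (r * card \<mu>) * (ext_chern_poly r t1 t2 m u u' \<nu> \<mu> / euler_class (tangent_class r t1 t2 u' \<mu>))
    = ext_kernel r \<nu> \<mu>"
proof -
  have E: "ext_chern_poly r t1 t2 m u u' \<nu> \<mu>
      = (- 1) ^ (r * card \<mu>) * chern_value m (ext_class r t1 t2 u u' \<nu> \<mu>)"
    unfolding ext_chern_poly_def Let_def rank_taut_class nat_int
    using chern_polynomial_eq[OF lookup_ext_class_nonneg[OF assms(1,2)] lookup_ext_class_generic[OF assms(1,2)] assms(3)]
    by simp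
  have T: "euler_class (tangent_class r t1 t2 u' \<mu>) = chern_value 0 (ext_class r t1 t2 u' u' \<mu> \<mu>)"
    unfolding tangent_class_eq
    by (intro euler_class_eq lookup_tangent_class_0 assms snd.generic_weights_axioms)
  have "(- 1) ^ n * ((- 1) ^ n * x / y) = x / y" for n and x y :: 'a
    by (simp add: mult.assoc[symmetric] power_add[symmetric] mult_2[symmetric])
  then show ?thesis unfolding E T ext_kernel_def using assms(1) by simp
qed

lemma ext_op_eq:
  assumes "m \<noteq> 0" "\<alpha> \<in> fock r"
  shows "ext_op r t1 t2 m u u' \<alpha> = op_of_kernel (ext_kernel r) \<alpha>"
proof
  fix \<nu>
  let ?S = "{\<mu>. \<alpha> \<mu> \<noteq> 0}"
  have S: "finite ?S" "?S \<subseteq> rpartitions r" using assms(2) by (auto simp: fock_def)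
  have block: "ext_block r t1 t2 m u u' d d' \<alpha> \<nu>
    = (if \<nu> \<in> rpartitions r \<and> card \<nu> = d then \<Sum>\<mu> | \<mu> \<in> ?S \<and> card \<mu> = d'. ext_kernel r \<nu> \<mu> * \<alpha> \<mu> else 0)" for d d'
  proof (cases "\<nu> \<in> rpartitions r \<and> card \<nu> = d")
    case True
    have "ext_block r t1 t2 m u u' d d' \<alpha> \<nu> = (\<Sum>\<mu> | \<mu> \<in> rpartitions r \<and> card \<mu> = d'.
      (- 1) ^ (r * d') * (ext_chern_poly r t1 t2 m u u' \<nu> \<mu> * \<alpha> \<mu> / euler_class (tangent_class r t1 t2 u' \<mu>)))"
      using True by (simp add: ext_block_def pushforward_def sum_distrib_left)
    also have "\<dots> = (\<Sum>\<mu> | \<mu> \<in> rpartitions r \<and> card \<mu> = d'. ext_kernel r \<nu> \<mu> * \<alpha> \<mu>)"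
    proof (rule sum.cong[OF refl])
      fix \<mu> assume \<mu>: "\<mu> \<in> {\<mu>. \<mu> \<in> rpartitions r \<and> card \<mu> = d'}"
      then have "ext_kernel r \<nu> \<mu> = (- 1) ^ (r * d') * (ext_chern_poly r t1 t2 m u u' \<nu> \<mu> / euler_class (tangent_class r t1 t2 u' \<mu>))"
        using ext_kernel_eq[of \<nu> r \<mu>] True assms(1) by auto
      then show "(- 1) ^ (r * d') * (ext_chern_poly r t1 t2 m u u' \<nu> \<mu> * \<alpha> \<mu> / euler_class (tangent_class r t1 t2 u' \<mu>))
          = ext_kernel r \<nu> \<mu> * \<alpha> \<mu>"
        by simp
    qed
    also have "\<dots> = (\<Sum>\<mu> | \<mu> \<in> ?S \<and> card \<mu> = d'. ext_kernel r \<nu> \<mu> * \<alpha> \<mu>)"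
      using S(2) by (intro sum.mono_neutral_right finite_rpartitions_card) auto
    finally show ?thesis using True by simp
  qed (auto simp: ext_block_def pushforward_def)
  show "ext_op r t1 t2 m u u' \<alpha> \<nu> = op_of_kernel (ext_kernel r) \<alpha> \<nu>"
  proof (cases "\<nu> \<in> rpartitions r")
    case False
    then have "ext_op r t1 t2 m u u' \<alpha> \<nu> = Sum_any (\<lambda>_ :: nat \<times> nat. 0)"
      unfolding ext_op_def block by (simp add: case_prod_unfold)
    then show ?thesis using False by (simp add: op_of_kernel_def ext_kernel_def)
  next
    case True
    let ?f = "\<lambda>d'. \<Sum>\<mu> | \<mu> \<in> ?S \<and> card \<mu> = d'. ext_kernel r \<nu> \<mu> * \<alpha> \<mu>"
    let ?A = "{card \<nu>} \<times> card ` ?S"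
    have "ext_op r t1 t2 m u u' \<alpha> \<nu> = (\<Sum>(d, d')\<in>?A. ext_block r t1 t2 m u u' d d' \<alpha> \<nu>)"
      unfolding ext_op_def
    proof (rule Sum_any.expand_superset)
      show "{x. (case x of (d, d') \<Rightarrow> ext_block r t1 t2 m u u' d d' \<alpha> \<nu>) \<noteq> 0} \<subseteq> ?A"
        unfolding block by (auto split: if_splits elim!: sum.not_neutral_contains_not_neutral)
    qed (use S in simp)
    also have "\<dots> = (\<Sum>d'\<in>card ` ?S. ?f d')"
      using True by (simp add: sum.cartesian_product[symmetric] block)
    also have "\<dots> = (\<Sum>\<mu>\<in>?S. ext_kernel r \<nu> \<mu> * \<alpha> \<mu>)"
      using S(1) by (intro sum.group) auto
    finally show ?thesis by (simp add: op_of_kernel_def)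
  qed
qed

lemma corner_fun_snd_nonzero:
  assumes "\<mu> \<in> rpartitions r"
  shows "corner_fun r t1 t2 u' \<mu> (\<chi> b + m - t) \<noteq> 0"
proof -
  have 1: "\<chi> b + m - t - \<chi>' a + t \<noteq> 0" for a
    using weight_shift_neq(1)[of b a] by (auto simp: algebra_simps)
  have 2: "\<chi> b + m - t - \<chi>' a \<noteq> 0" for a
    using weight_shift_neq(3)[of b a] by (auto simp: algebra_simps)
  show ?thesis
    unfolding corner_fun_def
    using 1 2 finite_add_corners[OF assms] finite_rem_corners[OF assms] by (simp add: prod_zero_iff)
qed

lemma corner_fun_fst_nonzero:
  assumes "\<nu> \<in> rpartitions r"
  shows "corner_fun r t1 t2 u \<nu> (\<chi>' b - m) \<noteq> 0"
proof -
  have 1: "\<chi>' b - m - \<chi> a + t \<noteq> 0" for a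
    using weight_shift_neq(3)[of a b] by (auto simp: algebra_simps)
  have 2: "\<chi>' b - m - \<chi> a \<noteq> 0" for a
    using weight_shift_neq(1)[of a b] by (auto simp: algebra_simps)
  show ?thesis
    unfolding corner_fun_def
    using 1 2 finite_add_corners[OF assms] finite_rem_corners[OF assms] by (simp add: prod_zero_iff)
qed

lemma ext_kernel_insert_fst:
  assumes "\<nu> \<in> rpartitions r" "\<mu> \<in> rpartitions r" "b \<in> add_corners r \<nu>"
  shows "ext_kernel r (insert b \<nu>) \<mu> = ext_kernel r \<nu> \<mu> * corner_fun r t1 t2 u' \<mu> (\<chi> b + m - t)"
proof -
  note ins = corner_insert[OF assms(3)]
  have 1: "nonzero_part (m + (\<chi> b - \<chi>' a)) = \<chi> b + m - t - \<chi>' a + t" for a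
    using weight_shift_neq(1)[of b a] by (auto simp: nonzero_part_def algebra_simps)
  have 2: "nonzero_part (m + (\<chi> b - \<chi>' a - t)) = \<chi> b + m - t - \<chi>' a" for a
    using weight_shift_neq(3)[of b a] by (auto simp: nonzero_part_def algebra_simps)
  show ?thesis
    using chern_value_insert_fst[OF assms(2) rpartitions_finite[OF assms(1)] ins(2), of m t1 t2 u u', unfolded 1 2]
    by (simp add: ext_kernel_def ins(1) assms(1) corner_fun_def)
qed

text \<open>There are r more addable than removable corners, so reversing the sign of every factor
  costs \<open>(- 1) ^ r\<close>.\<close>

lemma prod_negate_corners:
  assumes "\<nu> \<in> rpartitions r"
  shows "(\<Prod>a\<in>add_corners r \<nu>. - f a) / (\<Prod>c\<in>rem_corners r \<nu>. - g c)
    = (- 1) ^ r * ((\<Prod>a\<in>add_corners r \<nu>. f a) / (\<Prod>c\<in>rem_corners r \<nu>. g c :: 'a))"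
proof -
  have n: "(\<Prod>x\<in>A. - h x) = (- 1) ^ card A * prod h A" for A :: "box set" and h :: "box \<Rightarrow> 'a"
    using prod.distrib[of "\<lambda>_. - 1" h A] by simp
  have "((- 1) ^ (k + r) * x) / ((- 1) ^ k * y) = (- 1) ^ r * (x / y)" for k and x y :: 'a
    by (simp add: power_add)
  then show ?thesis unfolding n card_corners[OF assms] .
qed

text \<open>The box enters the two arguments of the Ext class one after the other, the second
  argument being enlarged first. Hence one corner function belongs to the smaller shape and the
  other to the larger.\<close>

lemma tangent_insert:
  assumes "\<mu> \<in> rpartitions r" "b \<in> add_corners r \<mu>"
  shows "chern_value 0 (ext_class r t1 t2 u' u' (insert b \<mu>) (insert b \<mu>))
    = chern_value 0 (ext_class r t1 t2 u' u' \<mu> \<mu>)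
      * ((- 1) ^ r * corner_fun r t1 t2 u' \<mu> (\<chi>' b) * corner_fun r t1 t2 u' (insert b \<mu>) (\<chi>' b - t))"
proof -
  note ins = corner_insert[OF assms(2)]
  note fin = rpartitions_finite[OF assms(1)]
  have A: "nonzero_part (0 + (\<chi>' b - \<chi>' a)) = \<chi>' b - t - \<chi>' a + t" if "a \<in> add_corners r (insert b \<mu>)" for a
    using that by (auto simp: nonzero_part_def snd.weight_eq_iff add_corners_def)
  have R: "nonzero_part (0 + (\<chi>' b - \<chi>' c - t)) = \<chi>' b - t - \<chi>' c" if c: "c \<in> rem_corners r (insert b \<mu>)" for c
  proof -
    have "b \<noteq> diag_box c" using snd.diag_rem_not_add(2)[OF ins(1) c] by auto
    then have "\<chi>' c + t \<noteq> \<chi>' b" by (simp only: snd.weight_add_t_eq_iff not_False_eq_True)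
    then show ?thesis by (auto simp: nonzero_part_def algebra_simps)
  qed
  have A': "nonzero_part (0 + (\<chi>' a - t - \<chi>' b)) = - (\<chi>' b - \<chi>' a + t)" if a: "a \<in> add_corners r \<mu>" for a
  proof -
    obtain i x y where e: "b = (i, x, y)" by (cases b)
    have "a \<noteq> diag_box b"
      using a ins(2) rpartitions_down[OF assms(1), of i x "Suc y" x y] e
      by (auto simp: add_corners_iff[OF assms(1)])
    then have "\<chi>' b + t \<noteq> \<chi>' a" by (simp only: snd.weight_add_t_eq_iff not_False_eq_True)
    then show ?thesis by (auto simp: nonzero_part_def algebra_simps)
  qed
  have R': "nonzero_part (0 + (\<chi>' c - \<chi>' b)) = - (\<chi>' b - \<chi>' c)" if "c \<in> rem_corners r \<mu>" for c
    using that ins(2) by (auto simp: nonzero_part_def snd.weight_eq_iff rem_corners_def)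
  have 1: "chern_value 0 (ext_class r t1 t2 u' u' (insert b \<mu>) (insert b \<mu>))
      = chern_value 0 (ext_class r t1 t2 u' u' \<mu> (insert b \<mu>)) * corner_fun r t1 t2 u' (insert b \<mu>) (\<chi>' b - t)"
    unfolding chern_value_insert_fst[OF ins(1) fin ins(2), of 0 t1 t2 u' u'] corner_fun_def using A R by simp
  have 2: "chern_value 0 (ext_class r t1 t2 u' u' \<mu> (insert b \<mu>))
      = chern_value 0 (ext_class r t1 t2 u' u' \<mu> \<mu>) * ((- 1) ^ r * corner_fun r t1 t2 u' \<mu> (\<chi>' b))"
    unfolding chern_value_insert_snd[OF assms(1) fin ins(2), of 0 t1 t2 u' u'] corner_fun_def
      prod_negate_corners[OF assms(1), symmetric] using A' R' by simp
  show ?thesis unfolding 1 2 by (simp add: ac_simps)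
qed

text \<open>The Chern class of Ext and the tangent weights at \<mu> both pick up
  \<open>(- 1) ^ r\<close>, which disappears in the quotient.\<close>

lemma ext_kernel_insert_snd:
  assumes "\<nu> \<in> rpartitions r" "\<mu> \<in> rpartitions r" "b \<in> add_corners r \<mu>"
  shows "ext_kernel r \<nu> (insert b \<mu>) = ext_kernel r \<nu> \<mu> * corner_fun r t1 t2 u \<nu> (\<chi>' b - m)
    / (corner_fun r t1 t2 u' \<mu> (\<chi>' b) * corner_fun r t1 t2 u' (insert b \<mu>) (\<chi>' b - t))"
proof -
  note ins = corner_insert[OF assms(3)]
  have 1: "nonzero_part (m + (\<chi> a - t - \<chi>' b)) = - (\<chi>' b - m - \<chi> a + t)" for a
    using weight_shift_neq(3)[of a b] by (auto simp: nonzero_part_def algebra_simps)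
  have 2: "nonzero_part (m + (\<chi> a - \<chi>' b)) = - (\<chi>' b - m - \<chi> a)" for a
    using weight_shift_neq(1)[of a b] by (auto simp: nonzero_part_def algebra_simps)
  have "chern_value m (ext_class r t1 t2 u u' \<nu> (insert b \<mu>))
      = chern_value m (ext_class r t1 t2 u u' \<nu> \<mu>) * ((- 1) ^ r * corner_fun r t1 t2 u \<nu> (\<chi>' b - m))"
    using chern_value_insert_snd[OF assms(1) rpartitions_finite[OF assms(2)] ins(2), of m t1 t2 u u', unfolded 1 2]
    unfolding prod_negate_corners[OF assms(1)] corner_fun_def .
  moreover have "(x * ((- 1) ^ r * y)) / (z * ((- 1) ^ r * v * w)) = x / z * y / (v * w)" for x y z v w :: 'a
    by simp
  ultimately show ?thesis
    using assms(1) by (simp add: ext_kernel_def tangent_insert[OF assms(2,3)])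
qed

lemma corner_fun_snd_diag_nonzero:
  assumes "\<mu> \<in> rpartitions r" "b \<in> add_corners r \<mu>"
  shows "corner_fun r t1 t2 u' \<mu> (\<chi>' b) \<noteq> 0" "corner_fun r t1 t2 u' (insert b \<mu>) (\<chi>' b - t) \<noteq> 0"
  using tangent_insert[OF assms] chern_value_nonzero[of 0 "ext_class r t1 t2 u' u' (insert b \<mu>) (insert b \<mu>)"]
  by auto

text \<open>Enlarging \<mu> divides the coefficient by two corner functions coming from its tangent
  space. The step of \<open>C_plus\<close> cancels the one of the smaller shape; in
  \<open>kernel_minus\<close> the step of \<open>C_minus\<close> cancels the one of the
  larger.\<close>

lemma kernel_plus: "kernel t1 t2 u u' m r (ext_kernel r) (fst.plus_step r) (snd.plus_step r)"
proof unfold_locales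
  fix \<nu> \<mu> b assume p: "\<nu> \<in> rpartitions r" "\<mu> \<in> rpartitions r"
  show "ext_kernel r (\<nu> - {b}) \<mu> * fst.plus_step r \<nu> b = ext_kernel r \<nu> \<mu> * remove_weight r \<nu> \<mu> b"
    if b: "b \<in> rem_corners r \<nu>"
  proof -
    note rem = corner_remove[OF b]
    show ?thesis
      using ext_kernel_insert_fst[OF rem(1) p(2) corner_remove_add[OF p(1) b]] corner_fun_snd_nonzero[OF p(2), of b]
      unfolding rem(3) by (simp add: fst.plus_step_def remove_weight_def)
  qed
  show "ext_kernel r \<nu> (insert b \<mu>) * snd.plus_step r (insert b \<mu>) b = ext_kernel r \<nu> \<mu> * add_weight r \<nu> \<mu> b"
    if b: "b \<in> add_corners r \<mu>"
  proof -
    note ins = corner_insert[OF b]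
    show ?thesis
      unfolding ext_kernel_insert_snd[OF p b] snd.plus_step_def ins(3) add_weight_def
      using corner_fun_snd_diag_nonzero[OF p(2) b] by (simp add: ac_simps)
  qed
qed

lemma kernel_minus:
  "kernel t1 t2 u' u (t - m) r (\<lambda>\<mu> \<nu>. ext_kernel r \<nu> \<mu>) (snd.minus_step r) (fst.minus_step r)"
proof -
  interpret swap: generic_pair t1 t2 u' u "t - m" by (rule generic_pair_swap)
  show ?thesis
  proof unfold_locales
    fix \<mu> \<nu> b assume p: "\<mu> \<in> rpartitions r" "\<nu> \<in> rpartitions r"
    show "ext_kernel r \<nu> (\<mu> - {b}) * snd.minus_step r \<mu> b = ext_kernel r \<nu> \<mu> * swap.remove_weight r \<mu> \<nu> b"
      if b: "b \<in> rem_corners r \<mu>"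
    proof -
      note rem = corner_remove[OF b] and add = corner_remove_add[OF p(1) b]
      have "\<chi>' b + (t - m) - t = \<chi>' b - m" by simp
      then show ?thesis
        using ext_kernel_insert_snd[OF p(2) rem(1) add] corner_fun_fst_nonzero[OF p(2), of b]
          corner_fun_snd_diag_nonzero[OF rem(1) add]
        unfolding rem(3) snd.minus_step_def swap.remove_weight_def by simp
    qed
    show "ext_kernel r (insert b \<nu>) \<mu> * fst.minus_step r (insert b \<nu>) b = ext_kernel r \<nu> \<mu> * swap.add_weight r \<mu> \<nu> b"
      if b: "b \<in> add_corners r \<nu>"
    proof -
      have "\<chi> b - (t - m) = \<chi> b + m - t" by simp
      then show ?thesis
        by (simp only: ext_kernel_insert_fst[OF p(2,1) b] fst.minus_step_def swap.add_weight_def) simp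
    qed
  qed
qed

end

section \<open>From matrix coefficients to commutators of operators\<close>

context generic_pair
begin

text \<open>The Heisenberg and the Virasoro relation share this shape, so both reduce to identities
  at pairs of r-partitions. Where \<nu> is not an r-partition every term vanishes.\<close>

lemma ext_op_commutator:
  assumes "m \<noteq> 0" "\<alpha> \<in> fock r"
    and reg: "regular_matrix r M" "regular_matrix r M'" "regular_matrix r N1" "regular_matrix r N2"
    and id: "\<And>\<nu> \<mu>. \<nu> \<in> rpartitions r \<Longrightarrow> \<mu> \<in> rpartitions r \<Longrightarrow>
      op_of_matrix M (\<lambda>\<nu>. ext_kernel r \<nu> \<mu>) \<nu> - op_of_matrix (\<lambda>\<mu> \<mu>'. M' \<mu>' \<mu>) (ext_kernel r \<nu>) \<mu>
      = x * op_of_matrix N1 (\<lambda>\<nu>. ext_kernel r \<nu> \<mu>) \<nu> - y * op_of_matrix N2 (\<lambda>\<nu>. ext_kernel r \<nu> \<mu>) \<nu>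
        - z * ext_kernel r \<nu> \<mu>"
  shows "commutator (op_of_matrix M) (op_of_matrix M') (ext_op r t1 t2 m u u') \<alpha>
    = (\<lambda>\<nu>. x * op_of_matrix N1 (ext_op r t1 t2 m u u' \<alpha>) \<nu> - y * op_of_matrix N2 (ext_op r t1 t2 m u u' \<alpha>) \<nu>
        - z * ext_op r t1 t2 m u u' \<alpha> \<nu>)"
proof
  fix \<nu>
  let ?K = "ext_kernel r" and ?A = "ext_op r t1 t2 m u u'"
  note A = ext_op_eq[OF assms(1)]
  have zero: "op_of_matrix M (\<lambda>\<nu>. ?K \<nu> \<mu>) \<nu> = 0"
    if "\<nu> \<notin> rpartitions r" "regular_matrix r M" for M :: "box set \<Rightarrow> box set \<Rightarrow> 'a" and \<nu> \<mu>
  proof -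
    have "(\<lambda>\<nu>'. M \<nu> \<nu>' * ?K \<nu>' \<mu>) = (\<lambda>_. 0)"
      using regular_matrixD(3)[OF that(2), of \<nu>] that(1) by (auto simp: fun_eq_iff ext_kernel_def)
    then have "op_of_matrix M (\<lambda>\<nu>. ?K \<nu> \<mu>) \<nu> = Sum_any (\<lambda>_ :: box set. 0 :: 'a)"
      unfolding op_of_matrix_def by (rule arg_cong)
    then show ?thesis by simp
  qed
  have id': "op_of_matrix M (\<lambda>\<nu>. ?K \<nu> \<mu>) \<nu> - op_of_matrix (\<lambda>\<mu> \<mu>'. M' \<mu>' \<mu>) (?K \<nu>) \<mu>
      = x * op_of_matrix N1 (\<lambda>\<nu>. ?K \<nu> \<mu>) \<nu> - y * op_of_matrix N2 (\<lambda>\<nu>. ?K \<nu> \<mu>) \<nu> - z * ?K \<nu> \<mu>"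
    if "\<alpha> \<mu> \<noteq> 0" for \<mu>
  proof (cases "\<nu> \<in> rpartitions r")
    case True
    then show ?thesis using id that assms(2) by (auto simp: fock_def)
  next
    case False
    have "?K \<nu> = (\<lambda>_. 0)" using False by (simp add: ext_kernel_def fun_eq_iff)
    then show ?thesis using zero[OF False] reg by (simp add: op_of_matrix_def)
  qed
  have "commutator (op_of_matrix M) (op_of_matrix M') ?A \<alpha> \<nu>
      = commutator (op_of_matrix M) (op_of_matrix M') (op_of_kernel ?K) \<alpha> \<nu>"
    unfolding commutator_def A[OF assms(2)] A[OF op_of_matrix_fock(3)[OF reg(2) assms(2)]] ..
  also have "\<dots> = (\<Sum>\<mu> | \<alpha> \<mu> \<noteq> 0. (x * op_of_matrix N1 (\<lambda>\<nu>. ?K \<nu> \<mu>) \<nu> - y * op_of_matrix N2 (\<lambda>\<nu>. ?K \<nu> \<mu>) \<nu>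
      - z * ?K \<nu> \<mu>) * \<alpha> \<mu>)"
    unfolding commutator_kernel[OF reg(1,2) assms(2)] using id' by (intro sum.cong refl) simp
  also have "\<dots> = x * op_of_matrix N1 (?A \<alpha>) \<nu> - y * op_of_matrix N2 (?A \<alpha>) \<nu> - z * ?A \<alpha> \<nu>"
    unfolding A[OF assms(2)] op_of_matrix_kernel[OF reg(3) assms(2)] op_of_matrix_kernel[OF reg(4) assms(2)]
    unfolding op_of_kernel_def by (simp add: sum_subtractf sum.distrib sum_distrib_left algebra_simps)
  finally show "commutator (op_of_matrix M) (op_of_matrix M') ?A \<alpha> \<nu>
    = x * op_of_matrix N1 (?A \<alpha>) \<nu> - y * op_of_matrix N2 (?A \<alpha>) \<nu> - z * ?A \<alpha> \<nu>" .
qed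

lemma op_of_zero_matrices:
  "op_of_matrix (fst.B_matrix r 0) F \<nu> = - (\<Sum>i<r. ubar r t1 t2 u i) * F \<nu>"
  "op_of_matrix (fst.L_matrix r 0) F \<nu> = fst.L_zero r \<nu> * F \<nu>"
  "op_of_matrix (\<lambda>\<mu> \<mu>'. snd.L_matrix r 0 \<mu>' \<mu>) F \<nu> = snd.L_zero r \<nu> * F \<nu>"
  using op_of_matrix_diag[of "\<lambda>_. - (\<Sum>i<r. ubar r t1 t2 u i)"]
  by (simp_all add: fst.B_matrix_def fst.L_matrix_def snd.L_matrix_def op_of_matrix_diag op_of_matrix_diag_transpose)

lemma sum_squares_shift: "(\<Sum>i<r. (v i - c)\<^sup>2) = (\<Sum>i<r. (v i)\<^sup>2) - 2 * c * (\<Sum>i<r. v i) + of_nat r * c\<^sup>2" for v :: "nat \<Rightarrow> 'a"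
  by (simp add: power2_diff sum.distrib sum_subtractf sum_distrib_left algebra_simps)

lemma sum_ubar:
  fixes r :: nat and h v defines "h \<equiv> (of_nat r - 1) * t / 2"
  shows "(\<Sum>i<r. ubar r t1 t2 v i) = (\<Sum>i<r. v i) + of_nat r * h"
    and "(\<Sum>i<r. (ubar r t1 t2 v i)\<^sup>2) = (\<Sum>i<r. (v i)\<^sup>2) + 2 * h * (\<Sum>i<r. v i) + of_nat r * h\<^sup>2"
proof -
  have u: "ubar r t1 t2 v = (\<lambda>i. v i - (- h))" by (simp add: ubar_def h_def fun_eq_iff)
  show "(\<Sum>i<r. ubar r t1 t2 v i) = (\<Sum>i<r. v i) + of_nat r * h" unfolding u by (simp add: sum.distrib)
  show "(\<Sum>i<r. (ubar r t1 t2 v i)\<^sup>2) = (\<Sum>i<r. (v i)\<^sup>2) + 2 * h * (\<Sum>i<r. v i) + of_nat r * h\<^sup>2"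
    unfolding u sum_squares_shift by simp
qed

text \<open>The summand with 24 in its denominator and the squares of the shift in
  \<open>ubar\<close> are the same for both sets of parameters and drop out.\<close>

lemma L_zero_diff:
  fixes r :: nat and h defines "h \<equiv> (of_nat r - 1) * t / 2"
  shows "2 * t1 * t2 * (fst.L_zero r \<nu> - snd.L_zero r \<mu>) = 2 * t1 * t2 * (of_nat (card \<nu>) - of_nat (card \<mu>))
    - ((\<Sum>i<r. (u i)\<^sup>2) + 2 * h * (\<Sum>i<r. u i)) + ((\<Sum>i<r. (u' i)\<^sup>2) + 2 * h * (\<Sum>i<r. u' i))"
proof -
  have c: "c * ((a + w - 1 / c * x) - (b + w - 1 / c * y)) = c * (a - b) - x + y" if "c \<noteq> 0" for a b c w x y :: 'a
    using that by (simp add: algebra_simps)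
  have nz: "2 * t1 * t2 \<noteq> 0" using fst.t_nonzero by simp
  show ?thesis
    unfolding fst.L_zero_def snd.L_zero_def c[OF nz] sum_ubar h_def by (simp add: algebra_simps)
qed

lemma divide_by_double:
  assumes "2 * t1 * t2 * X = 2 * a * R - 2 * b * R' - C * k"
  shows "X = a / (t1 * t2) * R - b / (t1 * t2) * R' - C / (2 * t1 * t2) * k"
proof -
  have nz: "2 * t1 * t2 \<noteq> 0" using fst.t_nonzero by simp
  then have "X = (2 * a * R - 2 * b * R' - C * k) / (2 * t1 * t2)"
    unfolding assms[symmetric] by (rule nonzero_mult_div_cancel_left[symmetric])
  also have "\<dots> = (2 * (a * R)) / (2 * (t1 * t2)) - (2 * (b * R')) / (2 * (t1 * t2)) - (C * k) / (2 * t1 * t2)"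
    by (simp only: diff_divide_distrib mult.assoc)
  also have "\<dots> = a / (t1 * t2) * R - b / (t1 * t2) * R' - C / (2 * t1 * t2) * k"
    by (simp only: mult_divide_mult_cancel_left[OF fst.t_nonzero(4)]) (simp add: mult.commute)
  finally show ?thesis .
qed

section \<open>The commutation relations at a pair of fixed points\<close>

abbreviation "B_left r n \<nu> \<mu> \<equiv> op_of_matrix (fst.B_matrix r n) (\<lambda>\<nu>. ext_kernel r \<nu> \<mu>) \<nu>"
abbreviation "B_right r n \<nu> \<mu> \<equiv> op_of_matrix (\<lambda>\<mu> \<mu>'. snd.B_matrix r n \<mu>' \<mu>) (ext_kernel r \<nu>) \<mu>"
abbreviation "L_left r n \<nu> \<mu> \<equiv> op_of_matrix (fst.L_matrix r n) (\<lambda>\<nu>. ext_kernel r \<nu> \<mu>) \<nu>"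
abbreviation "L_right r n \<nu> \<mu> \<equiv> op_of_matrix (\<lambda>\<mu> \<mu>'. snd.L_matrix r n \<mu>' \<mu>) (ext_kernel r \<nu>) \<mu>"

context
  fixes r :: nat and \<nu> \<mu> :: "box set"
  assumes part: "\<nu> \<in> rpartitions r" "\<mu> \<in> rpartitions r"
begin

interpretation P: kernel t1 t2 u u' m r "ext_kernel r" "fst.plus_step r" "snd.plus_step r"
  by (rule kernel_plus)

interpretation N: kernel t1 t2 u' u "t - m" r "\<lambda>\<mu> \<nu>. ext_kernel r \<nu> \<mu>" "snd.minus_step r" "fst.minus_step r"
  by (rule kernel_minus)

abbreviation "\<beta> \<equiv> \<Sum>i<r. u' i - u i"

lemma plus_sums:
  assumes "k > 0"
  shows "B_left r (- int k) \<nu> \<mu> = P.remove_sum P.one_list k \<nu> \<mu>" "B_right r (- int k) \<nu> \<mu> = P.add_sum P.one_list k \<nu> \<mu>"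
    "L_left r (- int k) \<nu> \<mu> = P.remove_sum (fst.L_list r) k \<nu> \<mu>" "L_right r (- int k) \<nu> \<mu> = P.add_sum (fst.L_list r) k \<nu> \<mu>"
  using assms unfolding P.remove_sum_def P.add_sum_def
  by (simp_all add: fst.B_matrix_def snd.B_matrix_def fst.L_matrix_def snd.L_matrix_def
      fst.op_of_chain_matrix snd.op_of_chain_matrix_transpose)

lemma minus_sums:
  assumes "k > 0"
  shows "B_left r (int k) \<nu> \<mu> = N.add_sum P.one_list k \<mu> \<nu>" "B_right r (int k) \<nu> \<mu> = N.remove_sum P.one_list k \<mu> \<nu>"
    "L_left r (int k) \<nu> \<mu> = N.add_sum (fst.L_list r) k \<mu> \<nu>" "L_right r (int k) \<nu> \<mu> = N.remove_sum (fst.L_list r) k \<mu> \<nu>"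
  using assms unfolding N.remove_sum_def N.add_sum_def
  by (simp_all add: fst.B_matrix_def snd.B_matrix_def fst.L_matrix_def snd.L_matrix_def
      snd.op_of_chain_matrix fst.op_of_chain_matrix_transpose)

lemma swapped_beta: "(\<Sum>i<r. u i - u' i) = - \<beta>"
  by (simp add: sum_subtractf)

lemma B_plus: "k > 0 \<Longrightarrow> B_left r (- int k) \<nu> \<mu> - B_right r (- int k) \<nu> \<mu> = (\<beta> - of_nat r * (m - t)) * ext_kernel r \<nu> \<mu>"
  by (simp add: plus_sums P.add_sum_one_eq[OF part]) (simp add: algebra_simps)

lemma B_minus: "k > 0 \<Longrightarrow> B_left r (int k) \<nu> \<mu> - B_right r (int k) \<nu> \<mu> = (\<beta> - of_nat r * m) * ext_kernel r \<nu> \<mu>"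
  by (simp add: minus_sums N.add_sum_one_eq[OF part(2,1)] swapped_beta) (simp add: algebra_simps)

text \<open>The case k = 1 in free variables: \<open>\<rho>\<close>, \<open>T\<close> and
  \<open>h\<close> stand for r, t and the shift in \<open>ubar\<close>, the other letters for power
  sums of the parameters, the degree term \<open>d\<close>, the kernel \<open>K\<close> and the B
  sum \<open>R\<close>. The squares and \<open>d\<close> coming from L_0 cancel those from infinity,
  and the rest is a multiple of \<open>(\<rho> - 1) * T - 2 * h\<close>.\<close>

lemma L_plus_one_identity:
  fixes \<rho> T :: 'a
  assumes h: "(\<rho> - 1) * T = 2 * h"
  shows "K * ((\<rho> * (T - m) + (S' - S))\<^sup>2 + d + (Q' - 2 * m * S' + \<rho> * m\<^sup>2) - (Q - 2 * T * S + \<rho> * T\<^sup>2))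
      - 2 * m * (R - K * (\<rho> * (T - m) + (S' - S))) - (d - (Q + 2 * h * S) + (Q' + 2 * h * S')) * K
    = 2 * (m - T) * (- (S + \<rho> * h) * K) - 2 * m * R
      - - (\<rho> * (m\<^sup>2 * \<rho> - (\<rho> + 1) * m * T + T\<^sup>2 - (m - T)\<^sup>2) - (2 * m * \<rho> - (\<rho> + 1) * T) * (S' - S) + (S' - S)\<^sup>2) * K"
    (is "?L = ?R")
proof -
  have "?L - ?R = ((\<rho> - 1) * T - 2 * h) * (K * (\<rho> * (T - m) + (S' - S)))"
    by (simp add: power2_eq_square algebra_simps)
  then show ?thesis using h by simp
qed

lemma L_minus_one_identity:
  fixes \<rho> T d d' :: 'a
  assumes h: "(\<rho> - 1) * T = 2 * h" and d: "d' = - d"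
  shows "- (K * ((\<rho> * (T - (T - m)) + - (S' - S))\<^sup>2 + d' + (Q - 2 * (T - m) * S + \<rho> * (T - m)\<^sup>2) - (Q' - 2 * T * S' + \<rho> * T\<^sup>2))
      - 2 * (T - m) * A) - (d - (Q + 2 * h * S) + (Q' + 2 * h * S')) * K
    = 2 * m * (- (S + \<rho> * h) * K) - 2 * (m - T) * A
      - (\<rho> * (m\<^sup>2 * \<rho> - (\<rho> + 1) * m * T + m\<^sup>2) - (2 * m * \<rho> - (\<rho> + 1) * T) * (S' - S) + (S' - S)\<^sup>2) * K"
    (is "?L = ?R")
proof -
  have "?L - ?R = (2 * h - (\<rho> - 1) * T) * (K * (\<rho> * m - (S' - S)))"
    unfolding d by (simp add: power2_eq_square algebra_simps)
  then show ?thesis using h by simp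
qed

lemma L_plus_Suc:
  assumes "k > 0"
  shows "(L_left r (- int (Suc k)) \<nu> \<mu> - L_left r (- int k) \<nu> \<mu>) - (L_right r (- int (Suc k)) \<nu> \<mu> - L_right r (- int k) \<nu> \<mu>)
    = (m - t) / (t1 * t2) * B_left r (- int k) \<nu> \<mu> - m / (t1 * t2) * B_left r (- int (Suc k)) \<nu> \<mu>
      - (- (of_nat r * (m\<^sup>2 * of_nat r - (of_nat r + 1) * m * t + t\<^sup>2)
          - (2 * m * of_nat r - (of_nat r + 1) * t) * \<beta> + \<beta>\<^sup>2)) / (2 * t1 * t2) * ext_kernel r \<nu> \<mu>"
proof (rule divide_by_double)
  define R R' K b where "R = P.remove_sum P.one_list k \<nu> \<mu>" and "R' = P.remove_sum P.one_list (Suc k) \<nu> \<mu>"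
    and "K = ext_kernel r \<nu> \<mu>" and "b = \<beta>"
  note defs = this[symmetric]
  show "2 * t1 * t2 * ((L_left r (- int (Suc k)) \<nu> \<mu> - L_left r (- int k) \<nu> \<mu>) - (L_right r (- int (Suc k)) \<nu> \<mu> - L_right r (- int k) \<nu> \<mu>))
    = 2 * (m - t) * B_left r (- int k) \<nu> \<mu> - 2 * m * B_left r (- int (Suc k)) \<nu> \<mu>
      - - (of_nat r * (m\<^sup>2 * of_nat r - (of_nat r + 1) * m * t + t\<^sup>2)
          - (2 * m * of_nat r - (of_nat r + 1) * t) * \<beta> + \<beta>\<^sup>2) * ext_kernel r \<nu> \<mu>"
    unfolding plus_sums[OF assms] plus_sums[OF zero_less_Suc] P.L_sum_Suc[OF part assms]
      P.add_sum_one_eq[OF part assms] P.add_sum_one_eq[OF part zero_less_Suc] defs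
    by (simp add: power2_eq_square algebra_simps)
qed

lemma L_minus_Suc:
  assumes "k > 0"
  shows "(L_left r (int (Suc k)) \<nu> \<mu> - L_left r (int k) \<nu> \<mu>) - (L_right r (int (Suc k)) \<nu> \<mu> - L_right r (int k) \<nu> \<mu>)
    = m / (t1 * t2) * B_left r (int k) \<nu> \<mu> - (m - t) / (t1 * t2) * B_left r (int (Suc k)) \<nu> \<mu>
      - (of_nat r * (m\<^sup>2 * of_nat r - (of_nat r + 1) * m * t)
          - (2 * m * of_nat r - (of_nat r + 1) * t) * \<beta> + \<beta>\<^sup>2) / (2 * t1 * t2) * ext_kernel r \<nu> \<mu>"
proof (rule divide_by_double)
  define A A' K b where "A = N.add_sum P.one_list k \<mu> \<nu>" and "A' = N.add_sum P.one_list (Suc k) \<mu> \<nu>"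
    and "K = ext_kernel r \<nu> \<mu>" and "b = \<beta>"
  note defs = this[symmetric]
  let ?L = "\<lambda>n. N.add_sum (fst.L_list r) n \<mu> \<nu>" and ?M = "\<lambda>n. N.remove_sum (fst.L_list r) n \<mu> \<nu>"
  have neg: "2 * t1 * t2 * ((?L (Suc k) - ?L k) - (?M (Suc k) - ?M k)) = - (2 * t1 * t2 * ((?M (Suc k) - ?M k) - (?L (Suc k) - ?L k)))"
    by (simp add: algebra_simps)
  show "2 * t1 * t2 * ((L_left r (int (Suc k)) \<nu> \<mu> - L_left r (int k) \<nu> \<mu>) - (L_right r (int (Suc k)) \<nu> \<mu> - L_right r (int k) \<nu> \<mu>))
    = 2 * m * B_left r (int k) \<nu> \<mu> - 2 * (m - t) * B_left r (int (Suc k)) \<nu> \<mu>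
      - (of_nat r * (m\<^sup>2 * of_nat r - (of_nat r + 1) * m * t)
          - (2 * m * of_nat r - (of_nat r + 1) * t) * \<beta> + \<beta>\<^sup>2) * ext_kernel r \<nu> \<mu>"
    unfolding minus_sums[OF assms] minus_sums[OF zero_less_Suc] neg N.L_sum_Suc[OF part(2,1) assms]
      swapped_beta defs
    by (simp add: power2_eq_square algebra_simps)
qed

lemma L_plus_one:
  "(L_left r (- 1) \<nu> \<mu> - L_left r 0 \<nu> \<mu>) - (L_right r (- 1) \<nu> \<mu> - L_right r 0 \<nu> \<mu>)
    = (m - t) / (t1 * t2) * B_left r 0 \<nu> \<mu> - m / (t1 * t2) * B_left r (- 1) \<nu> \<mu>
      - (- (of_nat r * (m\<^sup>2 * of_nat r - (of_nat r + 1) * m * t + t\<^sup>2 - (m - t)\<^sup>2)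
          - (2 * m * of_nat r - (of_nat r + 1) * t) * \<beta> + \<beta>\<^sup>2)) / (2 * t1 * t2) * ext_kernel r \<nu> \<mu>"
proof (rule divide_by_double)
  define R K where "R = P.remove_sum P.one_list 1 \<nu> \<mu>" and "K = ext_kernel r \<nu> \<mu>"
  define S S' Q Q' where "S = (\<Sum>i<r. u i)" and "S' = (\<Sum>i<r. u' i)" and "Q = (\<Sum>i<r. (u i)\<^sup>2)" and "Q' = (\<Sum>i<r. (u' i)\<^sup>2)"
  define T where "T = t"
  define d where "d = 2 * t1 * t2 * (of_nat (card \<nu>) - of_nat (card \<mu>) :: 'a)"
  have b: "\<beta> = S' - S" by (simp add: sum_subtractf S_def S'_def)
  have LR: "x * ((a - z * K) - (c - w * K)) = x * (a - c) - (x * (z - w)) * K" for x a c z w :: 'a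
    by (simp add: algebra_simps)
  have s: "L_left r (- 1) \<nu> \<mu> = P.remove_sum (fst.L_list r) 1 \<nu> \<mu>" "L_right r (- 1) \<nu> \<mu> = P.add_sum (fst.L_list r) 1 \<nu> \<mu>"
    "B_left r (- 1) \<nu> \<mu> = R"
    using plus_sums[of 1] by (simp_all add: R_def)
  show "2 * t1 * t2 * ((L_left r (- 1) \<nu> \<mu> - L_left r 0 \<nu> \<mu>) - (L_right r (- 1) \<nu> \<mu> - L_right r 0 \<nu> \<mu>))
    = 2 * (m - t) * B_left r 0 \<nu> \<mu> - 2 * m * B_left r (- 1) \<nu> \<mu>
      - - (of_nat r * (m\<^sup>2 * of_nat r - (of_nat r + 1) * m * t + t\<^sup>2 - (m - t)\<^sup>2)
          - (2 * m * of_nat r - (of_nat r + 1) * t) * \<beta> + \<beta>\<^sup>2) * ext_kernel r \<nu> \<mu>"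
    unfolding s op_of_zero_matrices K_def[symmetric] LR P.L_sum_one[OF part] L_zero_diff
      P.add_sum_one_eq[OF part zero_less_one] R_def[symmetric] sum_squares_shift sum_ubar
    unfolding b S_def[symmetric] S'_def[symmetric] Q_def[symmetric] Q'_def[symmetric] d_def[symmetric]
    unfolding T_def[symmetric]
    by (rule L_plus_one_identity) (simp add: fst.t_nonzero(4))
qed

lemma L_minus_one:
  "(L_left r 1 \<nu> \<mu> - L_left r 0 \<nu> \<mu>) - (L_right r 1 \<nu> \<mu> - L_right r 0 \<nu> \<mu>)
    = m / (t1 * t2) * B_left r 0 \<nu> \<mu> - (m - t) / (t1 * t2) * B_left r 1 \<nu> \<mu>
      - (of_nat r * (m\<^sup>2 * of_nat r - (of_nat r + 1) * m * t + m\<^sup>2)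
          - (2 * m * of_nat r - (of_nat r + 1) * t) * \<beta> + \<beta>\<^sup>2) / (2 * t1 * t2) * ext_kernel r \<nu> \<mu>"
proof (rule divide_by_double)
  define A K where "A = N.add_sum P.one_list 1 \<mu> \<nu>" and "K = ext_kernel r \<nu> \<mu>"
  define S S' Q Q' where "S = (\<Sum>i<r. u i)" and "S' = (\<Sum>i<r. u' i)" and "Q = (\<Sum>i<r. (u i)\<^sup>2)" and "Q' = (\<Sum>i<r. (u' i)\<^sup>2)"
  define T where "T = t"
  have b: "\<beta> = S' - S" by (simp add: sum_subtractf S_def S'_def)
  have LR: "x * ((a - z * K) - (c - w * K)) = - (x * (c - a)) - (x * (z - w)) * K" for x a c z w :: 'a
    by (simp add: algebra_simps)
  have s: "L_left r 1 \<nu> \<mu> = N.add_sum (fst.L_list r) 1 \<mu> \<nu>" "L_right r 1 \<nu> \<mu> = N.remove_sum (fst.L_list r) 1 \<mu> \<nu>"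
    "B_left r 1 \<nu> \<mu> = A"
    using minus_sums[of 1] by (simp_all add: A_def)
  show "2 * t1 * t2 * ((L_left r 1 \<nu> \<mu> - L_left r 0 \<nu> \<mu>) - (L_right r 1 \<nu> \<mu> - L_right r 0 \<nu> \<mu>))
    = 2 * m * B_left r 0 \<nu> \<mu> - 2 * (m - t) * B_left r 1 \<nu> \<mu>
      - (of_nat r * (m\<^sup>2 * of_nat r - (of_nat r + 1) * m * t + m\<^sup>2)
          - (2 * m * of_nat r - (of_nat r + 1) * t) * \<beta> + \<beta>\<^sup>2) * ext_kernel r \<nu> \<mu>"
    unfolding s op_of_zero_matrices K_def[symmetric] LR N.L_sum_one[OF part(2,1)] L_zero_diff
      swapped_beta A_def[symmetric] sum_squares_shift sum_ubar
    unfolding b S_def[symmetric] S'_def[symmetric] Q_def[symmetric] Q'_def[symmetric]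
    unfolding T_def[symmetric]
    by (rule L_minus_one_identity) (simp_all add: fst.t_nonzero(4) algebra_simps)
qed

end

end

section \<open>Genericity of the indeterminates\<close>

lemma lookup_indet_coeff:
  "Poly_Mapping.lookup (of_int x * Poly_Mapping.single (Poly_Mapping.single k 1) 1 :: (nat \<Rightarrow>\<^sub>0 nat) \<Rightarrow>\<^sub>0 rat)
     (Poly_Mapping.single n 1) = of_int x * of_bool (k = n)"
proof -
  have "Poly_Mapping.single k (1::nat) = Poly_Mapping.single n 1 \<longleftrightarrow> k = n"
    by (metis lookup_single_eq lookup_single_not_eq one_neq_zero)
  moreover have "(of_int x :: (nat \<Rightarrow>\<^sub>0 nat) \<Rightarrow>\<^sub>0 rat) = Poly_Mapping.single 0 (of_int x)"
    by (simp add: single_of_int)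
  ultimately show ?thesis by (simp only: mult_single lookup_single when_def) simp
qed

lemma to_fract_of_int: "to_fract (of_int x) = of_int x"
proof -
  have n: "to_fract (of_nat k) = of_nat k" for k by (induction k) simp_all
  show ?thesis by (cases x) (simp_all add: n)
qed

text \<open>A vanishing linear form in the indeterminates has vanishing coefficients; choosing
  \<open>n\<close> extracts the one needed in each genericity condition.\<close>

lemma indet_combination_zero:
  assumes "of_int x * indet 0 + of_int y * indet 1 + indet a - indet b + of_int e * indet c = 0"
  shows "of_int x * of_bool (0 = n) + of_int y * of_bool (1 = n) + of_bool (a = n) - of_bool (b = n)
    + of_int e * of_bool (c = n) = (0 :: rat)"
proof -
  let ?X = "\<lambda>k. Poly_Mapping.single (Poly_Mapping.single k 1) 1 :: (nat \<Rightarrow>\<^sub>0 nat) \<Rightarrow>\<^sub>0 rat"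
  let ?p = "of_int x * ?X 0 + of_int y * ?X 1 + of_int 1 * ?X a - of_int 1 * ?X b + of_int e * ?X c"
  have "to_fract ?p = 0"
    using assms by (simp add: indet_def to_fract_of_int)
  then have "?p = 0" by (simp only: to_fract_eq_0_iff)
  then have "Poly_Mapping.lookup ?p (Poly_Mapping.single n 1) = 0" by (simp only: lookup_zero)
  then show ?thesis
    unfolding lookup_add lookup_minus lookup_indet_coeff by simp
qed

lemma generic_pair_indet: "generic_pair (indet 0) (indet 1) (\<lambda>i. indet (3 + 2 * i)) (\<lambda>i. indet (4 + 2 * i)) (indet 2)"
proof unfold_locales
  fix x y :: int and i j :: nat
  assume "of_int x * indet 0 + of_int y * indet 1 + indet (3 + 2 * i) - indet (3 + 2 * j) = 0"
  then have "of_int x * indet 0 + of_int y * indet 1 + indet (3 + 2 * i) - indet (3 + 2 * j) + of_int 0 * indet 2 = 0" by simp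
  note c = indet_combination_zero[OF this]
  show "x = 0 \<and> y = 0 \<and> i = j" using c[of 0] c[of 1] c[of "3 + 2 * i"] by (simp split: if_splits)
next
  fix x y :: int and i j :: nat
  assume "of_int x * indet 0 + of_int y * indet 1 + indet (4 + 2 * i) - indet (4 + 2 * j) = 0"
  then have "of_int x * indet 0 + of_int y * indet 1 + indet (4 + 2 * i) - indet (4 + 2 * j) + of_int 0 * indet 2 = 0" by simp
  note c = indet_combination_zero[OF this]
  show "x = 0 \<and> y = 0 \<and> i = j" using c[of 0] c[of 1] c[of "4 + 2 * i"] by (simp split: if_splits)
next
  fix x y :: int and i j :: nat
  show "of_int x * indet 0 + of_int y * indet 1 + indet (3 + 2 * i) - indet (4 + 2 * j) + indet 2 \<noteq> 0"
  proof
    assume "of_int x * indet 0 + of_int y * indet 1 + indet (3 + 2 * i) - indet (4 + 2 * j) + indet 2 = 0"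
    then have "of_int x * indet 0 + of_int y * indet 1 + indet (3 + 2 * i) - indet (4 + 2 * j) + of_int 1 * indet 2 = 0" by simp
    from indet_combination_zero[OF this, of 2] show False by simp
  qed
qed

lemma indet_nonzero: "indet n \<noteq> 0"
proof
  assume "indet n = 0"
  then have "Poly_Mapping.lookup (Poly_Mapping.single (Poly_Mapping.single n 1) (1 :: rat)) (Poly_Mapping.single n (1 :: nat)) = 0"
    by (simp add: indet_def)
  then show False by (simp only: lookup_single_eq one_neq_zero)
qed

theorem theorem12:
  fixes r k :: nat and s :: int
    and t1 t2 t m \<beta> \<epsilon> \<epsilon>' \<delta> :: ratfun
    and u u' :: "nat \<Rightarrow> ratfun"
    and A :: "ratfun fockvec \<Rightarrow> ratfun fockvec"
    and B B' L L' :: "int \<Rightarrow> ratfun fockvec \<Rightarrow> ratfun fockvec"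
  assumes r: "r \<ge> 1" and k: "k > 0" and s: "s = 1 \<or> s = - 1"
    and params: "t1 = indet 0" "t2 = indet 1" "m = indet 2"
      "u = (\<lambda>i. indet (3 + 2 * i))" "u' = (\<lambda>i. indet (4 + 2 * i))"
    and t: "t = t1 + t2"
    and \<beta>: "\<beta> = (\<Sum>i<r. u' i - u i)"
    and A: "A = ext_op r t1 t2 m u u'"
    and B: "B = B_op r t1 t2 u" "B' = B_op r t1 t2 u'"
    and L: "L = L_op r t1 t2 u" "L' = L_op r t1 t2 u'"
    and \<epsilon>: "\<epsilon> = (1 + of_int s) / 2" "\<epsilon>' = (1 - of_int s) / 2"
    and \<delta>: "\<delta> = (if k = 1 then 1 else 0)"
  shows "\<forall>\<alpha>\<in>fock r.
      commutator (B (s * int k)) (B' (s * int k)) A \<alpha>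
        = (\<lambda>\<nu>. (\<beta> - of_nat r * (m - t * \<epsilon>')) * A \<alpha> \<nu>)
    \<and> commutator (op_diff (L (s * int k)) (L (s * (int k - 1))))
                 (op_diff (L' (s * int k)) (L' (s * (int k - 1)))) A \<alpha>
        = (\<lambda>\<nu>. (m - t * \<epsilon>') / (t1 * t2) * B (s * (int k - 1)) (A \<alpha>) \<nu>
             - (m - t * \<epsilon>) / (t1 * t2) * B (s * int k) (A \<alpha>) \<nu>
             - of_int s *
               ((of_nat r * (m\<^sup>2 * of_nat r - (of_nat r + 1) * m * t + t\<^sup>2 * \<epsilon>'
                              + of_int s * \<delta> * (m - t * \<epsilon>')\<^sup>2)
                 - (2 * m * of_nat r - (of_nat r + 1) * t) * \<beta> + \<beta>\<^sup>2) / (2 * t1 * t2))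
               * A \<alpha> \<nu>)"
proof
  fix \<alpha> :: "ratfun fockvec" assume \<alpha>: "\<alpha> \<in> fock r"
  interpret X: generic_pair t1 t2 u u' m
    unfolding params by (rule generic_pair_indet)
  have "m \<noteq> 0" unfolding params by (rule indet_nonzero)
  note comm = X.ext_op_commutator[OF this \<alpha>]
  note reg = X.fst.regular_B_matrix X.snd.regular_B_matrix X.fst.regular_L_matrix X.snd.regular_L_matrix
  note ops = X.fst.B_op_eq X.snd.B_op_eq X.fst.L_op_eq X.snd.L_op_eq
  let ?n = "s * int k" and ?n' = "s * (int k - 1)"
  let ?C = "(of_nat r * (m\<^sup>2 * of_nat r - (of_nat r + 1) * m * t + t\<^sup>2 * \<epsilon>'
                              + of_int s * \<delta> * (m - t * \<epsilon>')\<^sup>2)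
                 - (2 * m * of_nat r - (of_nat r + 1) * t) * \<beta> + \<beta>\<^sup>2) / (2 * t1 * t2)"
  have two: "(2 :: ratfun) \<noteq> 0" by (rule X.fst.t_nonzero)
  have sign: "s = 1 \<and> \<epsilon> = 1 \<and> \<epsilon>' = 0 \<or> s = - 1 \<and> \<epsilon> = 0 \<and> \<epsilon>' = 1"
    using s two by (auto simp: \<epsilon>)
  have B_id: "X.B_left r ?n \<nu> \<mu> - X.B_right r ?n \<nu> \<mu> = (\<beta> - of_nat r * (m - t * \<epsilon>')) * X.ext_kernel r \<nu> \<mu>"
    if "\<nu> \<in> rpartitions r" "\<mu> \<in> rpartitions r" for \<nu> \<mu>
    using sign X.B_plus[OF that k] X.B_minus[OF that k] by (auto simp: t \<beta>)
  have L_id: "(X.L_left r ?n \<nu> \<mu> - X.L_left r ?n' \<nu> \<mu>) - (X.L_right r ?n \<nu> \<mu> - X.L_right r ?n' \<nu> \<mu>)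
      = (m - t * \<epsilon>') / (t1 * t2) * X.B_left r ?n' \<nu> \<mu> - (m - t * \<epsilon>) / (t1 * t2) * X.B_left r ?n \<nu> \<mu>
        - (of_int s * ?C) * X.ext_kernel r \<nu> \<mu>"
    if part: "\<nu> \<in> rpartitions r" "\<mu> \<in> rpartitions r" for \<nu> \<mu>
  \<comment> \<open>For k = 1 the operators of index k - 1 are the scalars B_0 and L_0, and the
    Kronecker delta contributes.\<close>
  proof (cases "k = 1")
    case True
    then have "\<delta> = 1" by (simp add: \<delta>)
    then show ?thesis
      using sign X.L_plus_one[OF part, folded t] X.L_minus_one[OF part, folded t] True by (auto simp: \<beta>)
  next
    case False
    then obtain n where n: "k = Suc n" "n > 0" using k by (cases k) auto
    have pred: "int (Suc n) - 1 = int n" "1 - int (Suc n) = - int n" by simp_all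
    have "\<delta> = 0" using False by (simp add: \<delta>)
    then show ?thesis
      using sign X.L_plus_Suc[OF part n(2), folded t] X.L_minus_Suc[OF part n(2), folded t] n(1)
      by (auto simp: \<beta> pred simp del: of_nat_Suc)
  qed
  have diff: "op_diff (op_of_matrix M) (op_of_matrix N) = op_of_matrix (\<lambda>\<nu> \<mu>. M \<nu> \<mu> - N \<nu> \<mu>)"
    if "regular_matrix r M" "regular_matrix r N" for M N :: "box set \<Rightarrow> box set \<Rightarrow> ratfun"
    using op_of_matrix_diff[OF that] by (intro ext) (simp add: op_diff_def)
  \<comment> \<open>Here the right side is a multiple of A alone: the coefficients of the two
    auxiliary matrices are 0, and the scalar enters through \<open>z\<close> with the opposite
    sign.\<close>
  have "commutator (B ?n) (B' ?n) A \<alpha> = (\<lambda>\<nu>. (\<beta> - of_nat r * (m - t * \<epsilon>')) * A \<alpha> \<nu>)"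
    unfolding A B ops
    by (subst comm[OF reg(1) reg(2) reg(1) reg(1), where x = 0 and y = 0 and z = "- (\<beta> - of_nat r * (m - t * \<epsilon>'))"])
       (simp_all add: B_id del: minus_diff_eq)
  moreover have "commutator (op_diff (L ?n) (L ?n')) (op_diff (L' ?n) (L' ?n')) A \<alpha>
      = (\<lambda>\<nu>. (m - t * \<epsilon>') / (t1 * t2) * B ?n' (A \<alpha>) \<nu> - (m - t * \<epsilon>) / (t1 * t2) * B ?n (A \<alpha>) \<nu>
          - of_int s * ?C * A \<alpha> \<nu>)"
    unfolding A B L ops diff[OF reg(3) reg(3)] diff[OF reg(4) reg(4)]
  proof (rule comm[OF regular_matrix_diff[OF reg(3) reg(3)] regular_matrix_diff[OF reg(4) reg(4)] reg(1) reg(1)])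
    fix \<nu> \<mu> assume part: "\<nu> \<in> rpartitions r" "\<mu> \<in> rpartitions r"
    show "op_of_matrix (\<lambda>\<nu> \<mu>. X.fst.L_matrix r ?n \<nu> \<mu> - X.fst.L_matrix r ?n' \<nu> \<mu>) (\<lambda>\<nu>. X.ext_kernel r \<nu> \<mu>) \<nu>
        - op_of_matrix (\<lambda>\<mu> \<mu>'. X.snd.L_matrix r ?n \<mu>' \<mu> - X.snd.L_matrix r ?n' \<mu>' \<mu>) (X.ext_kernel r \<nu>) \<mu>
      = (m - t * \<epsilon>') / (t1 * t2) * X.B_left r ?n' \<nu> \<mu> - (m - t * \<epsilon>) / (t1 * t2) * X.B_left r ?n \<nu> \<mu>
        - of_int s * ?C * X.ext_kernel r \<nu> \<mu>"
      unfolding op_of_matrix_diff[OF reg(3) reg(3)]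
        op_of_matrix_diff[OF regular_matrix_transpose[OF reg(4)] regular_matrix_transpose[OF reg(4)]]
      by (rule L_id[OF part])
  qed
  ultimately show "commutator (B ?n) (B' ?n) A \<alpha> = (\<lambda>\<nu>. (\<beta> - of_nat r * (m - t * \<epsilon>')) * A \<alpha> \<nu>)
    \<and> commutator (op_diff (L ?n) (L ?n')) (op_diff (L' ?n) (L' ?n')) A \<alpha>
      = (\<lambda>\<nu>. (m - t * \<epsilon>') / (t1 * t2) * B ?n' (A \<alpha>) \<nu> - (m - t * \<epsilon>) / (t1 * t2) * B ?n (A \<alpha>) \<nu>
          - of_int s * ?C * A \<alpha> \<nu>)"
    by (rule conjI)
qed

end
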